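(* Let $\alpha\in(0,1/2)$ be irrational, let $\mathsf f$ be an orientation preserving $C^\infty$-diffeomorphism of $\mathbb T$ with rotation number $2\alpha$, and let $\mathrm D^\sigma=\bigoplus_{n\in\mathbb Z}\mathrm D^\sigma_n$ be the associated deformed Dirac operator (see context). Then $\mathrm D^\sigma$ has compact resolvent if and only if $$\lim_{|n|\to\infty}\big\|(\mathrm D^\sigma_n)^{-1}\big\|=0,$$ and $\mathrm D^\sigma$ has compact resolvent if $\Gamma_n(\mathsf f)=o(\ln n)$.
   Context: $\mathbb T$ is the unit circle, $m$ its normalised Lebesgue measure, $D=\frac{\mathrm d}{\mathrm dz}$ acting on functions on $\mathbb T$, $H^1(\mathbb T)=\{u\text{ absolutely continuous on }\mathbb T: u'\in L^2(\mathbb T,m)\}$, $M_g$ denotes multiplication by $g$. Growth sequence: $\Gamma_n(\mathsf f):=\max\{\|D\mathsf f^n\|_\infty,\|D\mathsf f^{-n}\|_\infty\}$ (so $\Gamma_0(\mathsf f)=1$). For $n\in\mathbb Z$ put $\delta_n(z)=\frac{z(D\mathsf f^{n})(z)}{\mathsf f^{n}(z)}$, $z\in\mathbb T$ (a strictly positive smooth function, equal to $\frac{\mathrm d(m\circ\mathsf f^n)}{\mathrm dm}$). Put $a_n=\sum_{l=1}^{n}\frac1{\Gamma_l(\mathsf f)}$ for $n>0$, $a_0=0$, $a_n=-\sum_{l=1}^{|n|}\frac1{\Gamma_{l-1}(\mathsf f)}$ for $n<0$. Put $\mathrm L_n:=\imath z\frac{\mathrm d}{\mathrm dz}-a_nI$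 on $H^1(\mathbb T)$, so that $\mathrm L_n^*=-\imath z\frac{\mathrm d}{\mathrm dz}-a_nI$, and $$\mathrm D^\sigma_n:=\begin{pmatrix}0&M_{\delta_n^{-1}}\mathrm L_n\\ \mathrm L_n^*M_{\delta_n^{-1}}&0\end{pmatrix}$$ on $L^2(\mathbb T,m)\oplus L^2(\mathbb T,m)$ with domain $H^1(\mathbb T)\oplus H^1(\mathbb T)$. $\mathrm D^\sigma:=\bigoplus_n\mathrm D^\sigma_n$ acts on $\bigoplus_{n\in\mathbb Z}\big(L^2(\mathbb T,m)\oplus L^2(\mathbb T,m)\big)$ with domain $\{\xi=(\xi_n): \xi_n\in H^1(\mathbb T)\oplus H^1(\mathbb T),\ \sum_n\|\mathrm D^\sigma_n\xi_n\|^2<+\infty\}$; it is selfadjoint. For $n\neq0$, $\mathrm D^\sigma_n$ has a bounded inverse; for $n=0$, $(\mathrm D_0^\sigma)^{-1}$ means the inverse on the orthogonal complement of the kernel, extended by $0$ on the kernel. *)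

theory Defs
  imports "HOL-Analysis.Analysis" "HOL-Library.Landau_Symbols"
begin

section \<open>Complex inner product spaces and unbounded operators\<close>

text \<open>
  A complex inner product space is a real one with an isometric complex scalar multiplication;
  \<open>inner\<close> is the real part of the Hermitian product. The orthogonal complement of a
  complex subspace is the same for \<open>inner\<close> and for the Hermitian product.
\<close>

class complex_inner_space = real_inner +
  fixes scaleC :: "complex \<Rightarrow> 'a \<Rightarrow> 'a"
  assumes scaleC_of_real: "scaleC (complex_of_real r) x = scaleR r x"
    and scaleC_add_right: "scaleC c (x + y) = scaleC c x + scaleC c y"
    and scaleC_add_left: "scaleC (c + d) x = scaleC c x + scaleC d x"
    and scaleC_scaleC: "scaleC c (scaleC d x) = scaleC (c * d) x"
    and norm_scaleC: "norm (scaleC c x) = cmod c * norm x"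

instantiation prod :: (complex_inner_space, complex_inner_space) complex_inner_space
begin

definition "scaleC c x = (scaleC c (fst x), scaleC c (snd x))"

instance
proof
  fix c :: complex and x :: "'a \<times> 'b"
  show "norm (scaleC c x) = cmod c * norm x"
    by (simp add: scaleC_prod_def norm_prod_def norm_scaleC power_mult_distrib
        real_sqrt_mult flip: distrib_left)
qed (auto simp: scaleC_prod_def scaleC_of_real scaleC_add_right scaleC_add_left scaleC_scaleC
    scaleR_prod_def)

end

text \<open>
  Unbounded operators are given by their graphs.
\<close>

type_synonym 'a unbounded_op = "('a \<times> 'a) set"

definition compact_operator :: "('a::real_normed_vector \<Rightarrow> 'a) \<Rightarrow> bool" where
  "compact_operator R \<longleftrightarrow> bounded_linear R \<and> compact (closure (R ` cball 0 1))"

text \<open>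
  \<open>is_resolvent A \<mu> R\<close>: \<open>A - \<mu>\<close> maps the domain of \<open>A\<close> bijectively
  onto the whole space, and its inverse is the bounded operator \<open>R\<close>.
\<close>

definition is_resolvent :: "'a::complex_inner_space unbounded_op \<Rightarrow> complex \<Rightarrow> ('a \<Rightarrow> 'a) \<Rightarrow> bool" where
  "is_resolvent A \<mu> R \<longleftrightarrow> bounded_linear R \<and>
     {(y - scaleC \<mu> x, x) | x y. (x, y) \<in> A} = {(v, R v) | v. True}"

definition compact_resolvent :: "'a::complex_inner_space unbounded_op \<Rightarrow> bool" where
  "compact_resolvent A \<longleftrightarrow> (\<exists>\<mu> R. is_resolvent A \<mu> R \<and> compact_operator R)"

definition op_kernel :: "'a::zero unbounded_op \<Rightarrow> 'a set" where
  "op_kernel A = {x. (x, 0) \<in> A}"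

text \<open>
  The inverse of \<open>A\<close> on the orthogonal complement of its kernel, extended by \<open>0\<close> on
  the kernel. For an injective \<open>A\<close> this is the ordinary inverse.
\<close>

definition reduced_inverse :: "'a::real_inner unbounded_op \<Rightarrow> 'a \<Rightarrow> 'a" where
  "reduced_inverse A w = (THE x. \<exists>y k. (x, y) \<in> A \<and> k \<in> op_kernel A \<and> w = y + k \<and>
     x \<in> orthogonal_comp (op_kernel A) \<and> y \<in> orthogonal_comp (op_kernel A))"


section \<open>Hilbert sums indexed by the integers\<close>

typedef (overloaded) 'a l2sum =
  "{x :: int \<Rightarrow> 'a::real_inner. (\<lambda>n. (norm (x n))\<^sup>2) summable_on UNIV}"
  morphisms component Abs_l2sum
  by (rule exI[of _ "\<lambda>_. 0"]) simp

setup_lifting type_definition_l2sum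

lemma mult_le_sum_power2:
  fixes a b :: real
  assumes "0 \<le> a" "0 \<le> b"
  shows "a * b \<le> a\<^sup>2 + b\<^sup>2"
proof -
  have "2 * (a * b) \<le> a\<^sup>2 + b\<^sup>2" using sum_squares_bound[of a b] by (simp add: mult.assoc)
  moreover have "0 \<le> a * b" using assms by simp
  ultimately show ?thesis by linarith
qed

lemma l2sum_inner_summable:
  fixes x y :: "int \<Rightarrow> 'a::real_inner"
  assumes "(\<lambda>n. (norm (x n))\<^sup>2) summable_on UNIV" "(\<lambda>n. (norm (y n))\<^sup>2) summable_on UNIV"
  shows "(\<lambda>n. inner (x n) (y n)) summable_on UNIV"
proof -
  have "(\<lambda>n. (norm (x n))\<^sup>2 + (norm (y n))\<^sup>2) summable_on UNIV"
    using assms by (rule summable_on_add)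
  moreover have "norm (inner (x n) (y n)) \<le> (norm (x n))\<^sup>2 + (norm (y n))\<^sup>2" for n
    using Cauchy_Schwarz_ineq2[of "x n" "y n"] mult_le_sum_power2[of "norm (x n)" "norm (y n)"]
    by simp
  ultimately have "(\<lambda>n. norm (inner (x n) (y n))) summable_on UNIV"
    by (rule summable_on_comparison_test) auto
  then show ?thesis by (rule abs_summable_summable)
qed

lemma l2sum_add_summable:
  fixes x y :: "int \<Rightarrow> 'a::real_inner"
  assumes "(\<lambda>n. (norm (x n))\<^sup>2) summable_on UNIV" "(\<lambda>n. (norm (y n))\<^sup>2) summable_on UNIV"
  shows "(\<lambda>n. (norm (x n + y n))\<^sup>2) summable_on UNIV"
proof -
  have "(norm (x n + y n))\<^sup>2 = (norm (x n))\<^sup>2 + (norm (y n))\<^sup>2 + 2 * inner (x n) (y n)" for n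
    by (simp add: power2_norm_eq_inner inner_add inner_commute)
  then show ?thesis
    using assms l2sum_inner_summable[OF assms]
    by (simp add: summable_on_add summable_on_cmult_right)
qed

lemma l2sum_scale_summable:
  fixes x y :: "int \<Rightarrow> 'a::real_inner"
  assumes "(\<lambda>n. (norm (x n))\<^sup>2) summable_on UNIV" "\<And>n. norm (y n) = r * norm (x n)"
  shows "(\<lambda>n. (norm (y n))\<^sup>2) summable_on UNIV"
  using assms by (simp add: power_mult_distrib summable_on_cmult_right)

instantiation l2sum :: (real_inner) real_inner
begin

lift_definition zero_l2sum :: "'a l2sum" is "\<lambda>_. 0" by simp
lift_definition plus_l2sum :: "'a l2sum \<Rightarrow> 'a l2sum \<Rightarrow> 'a l2sum" is "\<lambda>x y n. x n + y n"
  by (rule l2sum_add_summable)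
lift_definition uminus_l2sum :: "'a l2sum \<Rightarrow> 'a l2sum" is "\<lambda>x n. - x n" by simp
lift_definition minus_l2sum :: "'a l2sum \<Rightarrow> 'a l2sum \<Rightarrow> 'a l2sum" is "\<lambda>x y n. x n - y n"
  subgoal for x y using l2sum_add_summable[of x "\<lambda>n. - y n"] by simp
  done
lift_definition scaleR_l2sum :: "real \<Rightarrow> 'a l2sum \<Rightarrow> 'a l2sum" is "\<lambda>r x n. r *\<^sub>R x n"
  subgoal for r x by (rule l2sum_scale_summable[of x _ "\<bar>r\<bar>"]) simp_all
  done
lift_definition inner_l2sum :: "'a l2sum \<Rightarrow> 'a l2sum \<Rightarrow> real" is
  "\<lambda>x y. \<Sum>\<^sub>\<infinity>n. inner (x n) (y n)" .

definition "norm_l2sum (x :: 'a l2sum) = sqrt (inner x x)"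
definition "dist_l2sum (x :: 'a l2sum) y = norm (x - y)"
definition "sgn_l2sum (x :: 'a l2sum) = inverse (norm x) *\<^sub>R x"
definition [code del]: "(uniformity :: ('a l2sum \<times> 'a l2sum) filter) =
  (INF e\<in>{0 <..}. principal {(x, y). dist x y < e})"
definition [code del]: "open (U :: 'a l2sum set) =
  (\<forall>x\<in>U. eventually (\<lambda>(x', y). x' = x \<longrightarrow> y \<in> U) uniformity)"

instance
proof
  fix x y z :: "'a l2sum" and r s :: real
  show "x + y + z = x + (y + z)" by transfer (simp add: add.assoc)
  show "x + y = y + x" by transfer (simp add: add.commute)
  show "0 + x = x" by transfer simp
  show "- x + x = 0" by transfer simp
  show "x - y = x + - y" by transfer simp
  show "r *\<^sub>R (x + y) = r *\<^sub>R x + r *\<^sub>R y" by transfer (simp add: scaleR_add_right)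
  show "(r + s) *\<^sub>R x = r *\<^sub>R x + s *\<^sub>R x" by transfer (simp add: scaleR_add_left)
  show "r *\<^sub>R s *\<^sub>R x = (r * s) *\<^sub>R x" by transfer simp
  show "1 *\<^sub>R x = x" by transfer simp
  show "dist x y = norm (x - y)" by (rule dist_l2sum_def)
  show "sgn x = inverse (norm x) *\<^sub>R x" by (rule sgn_l2sum_def)
  show "(uniformity :: ('a l2sum \<times> 'a l2sum) filter) =
      (INF e\<in>{0 <..}. principal {(x, y). dist x y < e})"
    by (rule uniformity_l2sum_def)
  show "open U = (\<forall>x\<in>U. \<forall>\<^sub>F (x', y) in uniformity. x' = x \<longrightarrow> y \<in> U)" for U :: "'a l2sum set"
    by (rule open_l2sum_def)
  show "inner x y = inner y x" by transfer (simp add: inner_commute)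
  show "inner (x + y) z = inner x z + inner y z"
    by transfer (simp add: inner_add_left infsum_add l2sum_inner_summable)
  show "inner (r *\<^sub>R x) y = r * inner x y"
    by transfer (simp add: infsum_cmult_right')
  show "0 \<le> inner x x" by transfer (simp add: infsum_nonneg)
  show "inner x x = 0 \<longleftrightarrow> x = 0"
  proof (transfer, safe)
    fix x :: "int \<Rightarrow> 'a"
    assume *: "(\<lambda>n. (norm (x n))\<^sup>2) summable_on UNIV" and "(\<Sum>\<^sub>\<infinity>n. inner (x n) (x n)) = 0"
    then have "inner (x n) (x n) = 0" for n
      using nonneg_infsum_le_0D[of "\<lambda>n. inner (x n) (x n)" UNIV n] l2sum_inner_summable[OF * *]
      by auto
    then show "x = (\<lambda>_. 0)" by auto
  qed simp
  show "norm x = sqrt (inner x x)" by (rule norm_l2sum_def)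
qed

end

instantiation l2sum :: (complex_inner_space) complex_inner_space
begin

lift_definition scaleC_l2sum :: "complex \<Rightarrow> 'a l2sum \<Rightarrow> 'a l2sum" is "\<lambda>c x n. scaleC c (x n)"
  subgoal for c x by (rule l2sum_scale_summable[of x _ "cmod c"]) (simp_all add: norm_scaleC)
  done

instance
proof
  fix x y :: "'a l2sum" and c d :: complex and r :: real
  show "scaleC (complex_of_real r) x = r *\<^sub>R x" by transfer (simp add: scaleC_of_real)
  show "scaleC c (x + y) = scaleC c x + scaleC c y" by transfer (simp add: scaleC_add_right)
  show "scaleC (c + d) x = scaleC c x + scaleC d x" by transfer (simp add: scaleC_add_left)
  show "scaleC c (scaleC d x) = scaleC (c * d) x" by transfer (simp add: scaleC_scaleC)
  have "inner (scaleC c x) (scaleC c x) = (cmod c)\<^sup>2 * inner x x"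
    by transfer (simp add: norm_scaleC power_mult_distrib infsum_cmult_right' flip: power2_norm_eq_inner)
  then show "norm (scaleC c x) = cmod c * norm x"
    by (simp add: norm_l2sum_def real_sqrt_mult)
qed

end


section \<open>The circle and its \<open>L\<^sup>2\<close> space\<close>

abbreviation circle :: "complex set" where
  "circle \<equiv> sphere 0 1"

definition circle_measure :: "complex measure" where
  "circle_measure = completion (distr (uniform_measure lborel {0..<1::real})
     (restrict_space borel circle) (\<lambda>t. cis (2 * pi * t)))"

definition square_integrable :: "(complex \<Rightarrow> complex) \<Rightarrow> bool" where
  "square_integrable f \<longleftrightarrow> f \<in> borel_measurable circle_measure \<and>
     integrable circle_measure (\<lambda>z. (cmod (f z))\<^sup>2)"

lemma square_integrable_add:
  assumes "square_integrable f" "square_integrable g"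
  shows "square_integrable (\<lambda>z. f z + g z)"
proof -
  have "(cmod (f z + g z))\<^sup>2 \<le> 2 * (cmod (f z))\<^sup>2 + 2 * (cmod (g z))\<^sup>2" for z
  proof -
    have "(cmod (f z + g z))\<^sup>2 \<le> (cmod (f z) + cmod (g z))\<^sup>2"
      by (intro power_mono norm_triangle_ineq) simp
    also have "\<dots> \<le> 2 * (cmod (f z))\<^sup>2 + 2 * (cmod (g z))\<^sup>2"
      using zero_le_power2[of "cmod (f z) - cmod (g z)"] by (simp add: power2_diff power2_sum)
    finally show ?thesis .
  qed
  moreover have "integrable circle_measure (\<lambda>z. 2 * (cmod (f z))\<^sup>2 + 2 * (cmod (g z))\<^sup>2)"
    using assms by (simp add: square_integrable_def)
  moreover have [measurable]: "f \<in> borel_measurable circle_measure" "g \<in> borel_measurable circle_measure"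
    using assms by (simp_all add: square_integrable_def)
  ultimately show ?thesis unfolding square_integrable_def
    by (auto intro: Bochner_Integration.integrable_bound)
qed

lemma square_integrable_scale:
  "square_integrable f \<Longrightarrow> square_integrable (\<lambda>z. c * f z)"
  unfolding square_integrable_def
  by (auto simp: norm_mult power_mult_distrib intro: borel_measurable_times)

lemma square_integrable_inner:
  assumes "square_integrable f" "square_integrable g"
  shows "integrable circle_measure (\<lambda>z. f z * cnj (g z))"
proof -
  have [measurable]: "f \<in> borel_measurable circle_measure" "g \<in> borel_measurable circle_measure"
    using assms by (simp_all add: square_integrable_def)
  have "cmod (f z) * cmod (g z) \<le> (cmod (f z))\<^sup>2 + (cmod (g z))\<^sup>2" for z
    by (rule mult_le_sum_power2) simp_all
  moreover have "integrable circle_measure (\<lambda>z. (cmod (f z))\<^sup>2 + (cmod (g z))\<^sup>2)"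
    using assms by (simp add: square_integrable_def)
  moreover have "(\<lambda>z. f z * cnj (g z)) \<in> borel_measurable circle_measure"
  proof -
    have [measurable]: "cnj \<in> borel_measurable borel"
      by (intro borel_measurable_continuous_onI continuous_intros)
    show ?thesis by measurable
  qed
  ultimately show ?thesis
    by (elim Bochner_Integration.integrable_bound) (auto simp: norm_mult)
qed

quotient_type circle_L2 = "complex \<Rightarrow> complex" / partial:
  "\<lambda>f g. square_integrable f \<and> square_integrable g \<and> (AE z in circle_measure. f z = g z)"
  morphisms rep_L2 class_L2
proof (rule part_equivpI)
  show "\<exists>f. square_integrable f \<and> square_integrable f \<and> (AE z in circle_measure. f z = f z)"
    by (rule exI[of _ "\<lambda>_. 0"]) (simp add: square_integrable_def)
  show "symp (\<lambda>f g. square_integrable f \<and> square_integrable g \<and> (AE z in circle_measure. f z = g z))"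
    by (rule sympI) (auto elim: AE_mp)
  show "transp (\<lambda>f g. square_integrable f \<and> square_integrable g \<and> (AE z in circle_measure. f z = g z))"
    by (rule transpI) (auto elim: AE_mp)
qed

instantiation circle_L2 :: complex_inner_space
begin

lift_definition zero_circle_L2 :: circle_L2 is "\<lambda>_. 0"
  by (simp add: square_integrable_def)
lift_definition plus_circle_L2 :: "circle_L2 \<Rightarrow> circle_L2 \<Rightarrow> circle_L2" is "\<lambda>f g z. f z + g z"
  by (auto intro: square_integrable_add elim: AE_mp)
lift_definition scaleC_circle_L2 :: "complex \<Rightarrow> circle_L2 \<Rightarrow> circle_L2" is "\<lambda>c f z. c * f z"
  by (auto intro: square_integrable_scale elim: AE_mp)
lift_definition inner_circle_L2 :: "circle_L2 \<Rightarrow> circle_L2 \<Rightarrow> real" is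
  "\<lambda>f g. Re (integral\<^sup>L circle_measure (\<lambda>z. f z * cnj (g z)))"
  by (auto intro!: arg_cong[where f = Re] integral_cong_AE
      borel_measurable_integrable square_integrable_inner elim: AE_mp)

definition "scaleR_circle_L2 r (x :: circle_L2) = scaleC (complex_of_real r) x"
definition "uminus_circle_L2 (x :: circle_L2) = scaleC (-1) x"
definition "minus_circle_L2 (x :: circle_L2) y = x + - y"
definition "norm_circle_L2 (x :: circle_L2) = sqrt (inner x x)"
definition "dist_circle_L2 (x :: circle_L2) y = norm (x - y)"
definition "sgn_circle_L2 (x :: circle_L2) = inverse (norm x) *\<^sub>R x"
definition [code del]: "(uniformity :: (circle_L2 \<times> circle_L2) filter) =
  (INF e\<in>{0 <..}. principal {(x, y). dist x y < e})"
definition [code del]: "open (U :: circle_L2 set) =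
  (\<forall>x\<in>U. eventually (\<lambda>(x', y). x' = x \<longrightarrow> y \<in> U) uniformity)"

instance
proof
  note si = square_integrable_add square_integrable_scale
  fix x y z :: circle_L2 and r s :: real and c d :: complex
  show "x + y + z = x + (y + z)" by transfer (auto intro!: si simp: add.assoc)
  show "x + y = y + x" by transfer (auto intro!: si simp: add.commute)
  show "0 + x = x" by transfer auto
  show "- x + x = 0" unfolding uminus_circle_L2_def
    by transfer (auto simp: square_integrable_def)
  show "x - y = x + - y" by (rule minus_circle_L2_def)
  show cr: "scaleC c (x + y) = scaleC c x + scaleC c y" for c
    by transfer (auto intro!: si simp: distrib_left)
  show cl: "scaleC (c + d) x = scaleC c x + scaleC d x" for c d
    by transfer (auto intro!: si simp: distrib_right)
  show cc: "scaleC c (scaleC d x) = scaleC (c * d) x" for c d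
    by transfer (auto intro!: si simp: mult.assoc)
  show "scaleC (complex_of_real r) x = r *\<^sub>R x" by (simp add: scaleR_circle_L2_def)
  show "r *\<^sub>R (x + y) = r *\<^sub>R x + r *\<^sub>R y" by (simp add: scaleR_circle_L2_def cr)
  show "(r + s) *\<^sub>R x = r *\<^sub>R x + s *\<^sub>R x" by (simp add: scaleR_circle_L2_def cl)
  show "r *\<^sub>R s *\<^sub>R x = (r * s) *\<^sub>R x" by (simp add: scaleR_circle_L2_def cc)
  show "1 *\<^sub>R x = x" unfolding scaleR_circle_L2_def by transfer auto
  show "dist x y = norm (x - y)" by (rule dist_circle_L2_def)
  show "sgn x = inverse (norm x) *\<^sub>R x" by (rule sgn_circle_L2_def)
  show "(uniformity :: (circle_L2 \<times> circle_L2) filter) =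
      (INF e\<in>{0 <..}. principal {(x, y). dist x y < e})"
    by (rule uniformity_circle_L2_def)
  show "open U = (\<forall>x\<in>U. \<forall>\<^sub>F (x', y) in uniformity. x' = x \<longrightarrow> y \<in> U)" for U :: "circle_L2 set"
    by (rule open_circle_L2_def)
  show "inner x y = inner y x"
  proof transfer
    fix f g :: "complex \<Rightarrow> complex"
    have "integral\<^sup>L circle_measure (\<lambda>z. g z * cnj (f z)) =
        cnj (integral\<^sup>L circle_measure (\<lambda>z. f z * cnj (g z)))"
      by (simp add: mult.commute flip: Bochner_Integration.integral_cnj)
    then show "Re (integral\<^sup>L circle_measure (\<lambda>z. f z * cnj (g z))) =
        Re (integral\<^sup>L circle_measure (\<lambda>z. g z * cnj (f z)))" by simp
  qed
  show "inner (x + y) z = inner x z + inner y z"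
    by transfer (simp add: distrib_right square_integrable_inner)
  show "inner (r *\<^sub>R x) y = r * inner x y" unfolding scaleR_circle_L2_def
    by transfer (simp add: mult.assoc)
  have inner_self: "Re (integral\<^sup>L circle_measure (\<lambda>z. f z * cnj (f z))) =
      integral\<^sup>L circle_measure (\<lambda>z. (cmod (f z))\<^sup>2)" for f
    by (simp flip: complex_norm_square of_real_power)
  show "0 \<le> inner x x"
    by transfer (simp add: inner_self)
  show "inner x x = 0 \<longleftrightarrow> x = 0"
    by transfer (auto simp: inner_self square_integrable_def integral_nonneg_eq_0_iff_AE)
  show "norm x = sqrt (inner x x)" by (rule norm_circle_L2_def)
  have "inner (scaleC c x) (scaleC c x) = (cmod c)\<^sup>2 * inner x x"
    by transfer (simp only: inner_self norm_mult power_mult_distrib integral_mult_right_zero)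
  then show "norm (scaleC c x) = cmod c * norm x"
    by (simp add: norm_circle_L2_def real_sqrt_mult)
qed

end


section \<open>Differentiation on the circle\<close>

text \<open>
  The derivative \<open>d/dz\<close> along the circle: the difference quotients use points of the circle
  only. For \<open>z = cis \<theta>\<close> and \<open>F \<theta> = f (cis \<theta>)\<close> this gives
  \<open>\<i> z f'(z) = F'(\<theta>)\<close>. Only the values on \<open>circle\<close> of functions of type
  \<open>complex \<Rightarrow> complex\<close> are ever relevant below.
\<close>

definition circle_deriv :: "(complex \<Rightarrow> complex) \<Rightarrow> complex \<Rightarrow> complex" where
  "circle_deriv f z = (THE d. (f has_field_derivative d) (at z within circle))"

definition circle_smooth :: "(complex \<Rightarrow> complex) \<Rightarrow> bool" where
  "circle_smooth f \<longleftrightarrow>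
     (\<forall>k. \<forall>z\<in>circle. (circle_deriv ^^ k) f field_differentiable (at z within circle))"

definition circle_absolutely_continuous :: "(complex \<Rightarrow> complex) \<Rightarrow> bool" where
  "circle_absolutely_continuous u \<longleftrightarrow>
     (\<forall>\<epsilon>>0. \<exists>\<delta>>0. \<forall>(N::nat) (a::nat \<Rightarrow> real) b.
        (\<forall>i<N. 0 \<le> a i \<and> a i \<le> b i \<and> b i \<le> 2 * pi) \<and>
        disjoint_family_on (\<lambda>i. {a i<..<b i}) {..<N} \<and>
        (\<Sum>i<N. b i - a i) < \<delta> \<longrightarrow>
        (\<Sum>i<N. cmod (u (cis (b i)) - u (cis (a i)))) < \<epsilon>)"

definition circle_H1 :: "(complex \<Rightarrow> complex) set" where
  "circle_H1 = {u. circle_absolutely_continuous u \<and> square_integrable (circle_deriv u)}"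


section \<open>Circle diffeomorphisms\<close>

definition circle_diffeo :: "(complex \<Rightarrow> complex) \<Rightarrow> bool" where
  "circle_diffeo f \<longleftrightarrow> bij_betw f circle circle \<and>
     circle_smooth f \<and> circle_smooth (the_inv_into circle f)"

definition circle_lift :: "(complex \<Rightarrow> complex) \<Rightarrow> (real \<Rightarrow> real) \<Rightarrow> bool" where
  "circle_lift f F \<longleftrightarrow>
     continuous_on UNIV F \<and> (\<forall>x. f (cis (2 * pi * x)) = cis (2 * pi * F x))"

definition orientation_preserving :: "(complex \<Rightarrow> complex) \<Rightarrow> bool" where
  "orientation_preserving f \<longleftrightarrow> (\<exists>F. circle_lift f F \<and> strict_mono F)"

text \<open>
  The rotation number is measured in full turns, so that it is \<open>\<rho>\<close> modulo \<open>1\<close> for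
  the rotation \<open>z \<mapsto> cis (2 * pi * \<rho>) * z\<close>; the choice of the lift accounts for the
  integer ambiguity.
\<close>

definition has_rotation_number :: "(complex \<Rightarrow> complex) \<Rightarrow> real \<Rightarrow> bool" where
  "has_rotation_number f \<rho> \<longleftrightarrow>
     (\<exists>F. circle_lift f F \<and> (\<forall>x. (\<lambda>n. ((F ^^ n) x - x) / real n) \<longlonglongrightarrow> \<rho>))"

definition circle_iter :: "(complex \<Rightarrow> complex) \<Rightarrow> int \<Rightarrow> complex \<Rightarrow> complex" where
  "circle_iter f n = (if n \<ge> 0 then f ^^ nat n else the_inv_into circle f ^^ nat (- n))"

definition circle_sup_norm :: "(complex \<Rightarrow> complex) \<Rightarrow> real" where
  "circle_sup_norm g = (SUP z\<in>circle. cmod (g z))"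

definition growth :: "(complex \<Rightarrow> complex) \<Rightarrow> nat \<Rightarrow> real" where
  "growth f n = max (circle_sup_norm (circle_deriv (circle_iter f (int n))))
                    (circle_sup_norm (circle_deriv (circle_iter f (- int n))))"


section \<open>The deformed Dirac operator\<close>

definition dirac_delta :: "(complex \<Rightarrow> complex) \<Rightarrow> int \<Rightarrow> complex \<Rightarrow> complex" where
  "dirac_delta f n z = z * circle_deriv (circle_iter f n) z / circle_iter f n z"

definition dirac_a :: "(complex \<Rightarrow> complex) \<Rightarrow> int \<Rightarrow> real" where
  "dirac_a f n = (if n > 0 then (\<Sum>l=1..nat n. 1 / growth f l)
     else if n = 0 then 0
     else - (\<Sum>l=1..nat \<bar>n\<bar>. 1 / growth f (l - 1)))"

text \<open>
  \<open>dirac_L a\<close> is \<open>\<i> z d/dz - a\<close> and \<open>dirac_L_adj a\<close> is its Hilbert space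
  adjoint \<open>- \<i> z d/dz - a\<close>, both on \<open>circle_H1\<close>.
\<close>

definition dirac_L :: "real \<Rightarrow> (complex \<Rightarrow> complex) \<Rightarrow> complex \<Rightarrow> complex" where
  "dirac_L a u z = \<i> * z * circle_deriv u z - complex_of_real a * u z"

definition dirac_L_adj :: "real \<Rightarrow> (complex \<Rightarrow> complex) \<Rightarrow> complex \<Rightarrow> complex" where
  "dirac_L_adj a u z = - (\<i> * z * circle_deriv u z) - complex_of_real a * u z"

definition dirac_component ::
    "(complex \<Rightarrow> complex) \<Rightarrow> int \<Rightarrow> (circle_L2 \<times> circle_L2) unbounded_op" where
  "dirac_component f n =
     {((class_L2 u, class_L2 v),
       (class_L2 (\<lambda>z. inverse (dirac_delta f n z) * dirac_L (dirac_a f n) v z),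
        class_L2 (dirac_L_adj (dirac_a f n) (\<lambda>z. inverse (dirac_delta f n z) * u z)))) | u v.
      u \<in> circle_H1 \<and> v \<in> circle_H1}"

text \<open>
  Since \<open>\<eta>\<close> ranges over the Hilbert sum, the domain consists of the \<open>\<xi>\<close> with
  components in the domains of the summands and square summable images.
\<close>

definition dirac :: "(complex \<Rightarrow> complex) \<Rightarrow> (circle_L2 \<times> circle_L2) l2sum unbounded_op" where
  "dirac f = {(\<xi>, \<eta>). \<forall>n. (component \<xi> n, component \<eta> n) \<in> dirac_component f n}"

end

theory Submission
  imports Defs "HOL-Complex_Analysis.Great_Picard" "HOL-Real_Asymp.Real_Asymp"
begin

text \<open>
  For \<open>n \<noteq> 0\<close> the component \<open>D\<^sub>n\<close> is invertible with an explicit compact inverse: periodic solutions of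
  \<open>F' - c F = G\<close> on \<open>[0, 2\<pi>]\<close> are given by variation of constants, they are equicontinuous when \<open>G\<close> runs
  through the unit ball of \<open>L\<^sup>2\<close>, and multiplication by \<open>\<delta>\<^sub>n\<close> is bounded. If the norms of the inverses tend to
  \<open>0\<close>, a Neumann series at a small common \<open>\<mu> \<noteq> 0\<close> gives resolvents whose direct sum is a norm limit of compact
  operators; if they do not, infinitely many orthonormal vectors lie in the image of a bounded set
  under the resolvent. For real \<open>a\<close> integration by parts gives \<open>\<bar>a\<bar> \<parallel>F\<parallel> \<le> \<parallel>F' - a F\<parallel>\<close>, hence the norm of the inverse
  is at most \<open>\<Gamma>\<^sub>n / \<bar>a\<^sub>n\<bar>\<close>, and \<open>a\<^sub>n\<close> grows at least like \<open>n / ln n\<close>.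

  Since the derivative on the circle is a pointwise one, the identification of its inverse rests on
  Lebesgue's theory: an absolutely continuous function is a difference of increasing ones, which
  have densities by Radon-Nikodym, and indefinite integrals are differentiable almost everywhere.
\<close>

section \<open>Absolutely continuous functions on an interval\<close>

text \<open>At \<open>n = 0\<close> the number \<open>a\<close> vanishes and the component has a
  kernel, so the summands share no inverse at \<open>0\<close> and need a common resolvent point. It
  is \<open>\<mu> = 1 / (2 * K)\<close>, where \<open>K \<ge> 1\<close> bounds the norms of all
  inverses with \<open>n \<noteq> 0\<close>: then \<open>\<mu>\<close> times each norm is at most
  \<open>1 / 2\<close>, as the contraction behind the Neumann series demands, and
  \<open>0 < \<mu> < 1\<close> keeps clear of the integers, the real points at which the periodic
  problems arising from \<open>n = 0\<close> degenerate. Each of the two entries of the inverse of a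
  component contains the weight \<open>\<delta>\<close> once, next to a solution operator of norm at
  most \<open>1 / \<bar>a\<bar>\<close>; hence a single factor of the growth sequence in the norm
  bound. If the growth is at most \<open>ln k\<close> for \<open>k \<ge> N\<close>, the bound
  becomes \<open>(ln m)^2 / (m - N - 1)\<close> with \<open>m = \<bar>n\<bar>\<close>. Graph
  elements are classes modulo null sets, while the domain imposes pointwise conditions on a
  representative; equations are therefore moved to angles, solved there by continuous functions, and
  carried back along \<open>Arg2pi\<close>.\<close>

definition abs_cont_on :: "real \<Rightarrow> real \<Rightarrow> (real \<Rightarrow> 'a::real_normed_vector) \<Rightarrow> bool" where
  "abs_cont_on l r F \<longleftrightarrow>
     (\<forall>\<epsilon>>0. \<exists>\<delta>>0. \<forall>(N::nat) (a::nat \<Rightarrow> real) b.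
        (\<forall>i<N. l \<le> a i \<and> a i \<le> b i \<and> b i \<le> r) \<and>
        disjoint_family_on (\<lambda>i. {a i<..<b i}) {..<N} \<and>
        (\<Sum>i<N. b i - a i) < \<delta> \<longrightarrow>
        (\<Sum>i<N. norm (F (b i) - F (a i))) < \<epsilon>)"

text \<open>The index set is any finite set: later families are indexed by pairs, when families are
  refined, and by sets of intervals, when a null set is covered.\<close>

definition interval_family :: "real \<Rightarrow> real \<Rightarrow> 'i set \<Rightarrow> ('i \<Rightarrow> real) \<Rightarrow> ('i \<Rightarrow> real) \<Rightarrow> bool" where
  "interval_family l r I a b \<longleftrightarrow> finite I \<and> (\<forall>i\<in>I. l \<le> a i \<and> a i \<le> b i \<and> b i \<le> r) \<and>
     disjoint_family_on (\<lambda>i. {a i<..<b i}) I"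

lemma interval_family_mono:
  "interval_family l r I a b \<Longrightarrow> l' \<le> l \<Longrightarrow> r \<le> r' \<Longrightarrow> interval_family l' r' I a b"
  unfolding interval_family_def by (metis order_trans)

lemma abs_cont_onD:
  fixes F :: "real \<Rightarrow> 'a::real_normed_vector"
  assumes "abs_cont_on l r F" "\<epsilon> > 0"
  obtains \<delta> where "\<delta> > 0" "\<And>(I::'i set) a b. interval_family l r I a b \<Longrightarrow>
    (\<Sum>i\<in>I. b i - a i) < \<delta> \<Longrightarrow> (\<Sum>i\<in>I. norm (F (b i) - F (a i))) < \<epsilon>"
proof -
  from assms obtain \<delta> where \<delta>: "\<delta> > 0" and *: "\<And>(N::nat) (a::nat \<Rightarrow> real) b.
        (\<forall>i<N. l \<le> a i \<and> a i \<le> b i \<and> b i \<le> r) \<and>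
        disjoint_family_on (\<lambda>i. {a i<..<b i}) {..<N} \<and>
        (\<Sum>i<N. b i - a i) < \<delta> \<Longrightarrow>
        (\<Sum>i<N. norm (F (b i) - F (a i))) < \<epsilon>"
    unfolding abs_cont_on_def by blast
  show ?thesis
  proof
    fix I :: "'i set" and a b
    assume fam: "interval_family l r I a b" and len: "(\<Sum>i\<in>I. b i - a i) < \<delta>"
    then have "finite I" by (simp add: interval_family_def)
    then obtain h where h: "bij_betw h {..<card I} I"
      using ex_bij_betw_nat_finite atLeast0LessThan by metis
    have "(\<Sum>i<card I. norm (F (b (h i)) - F (a (h i)))) < \<epsilon>"
    proof (rule *, intro conjI)
      show "\<forall>i<card I. l \<le> a (h i) \<and> a (h i) \<le> b (h i) \<and> b (h i) \<le> r"
        using fam h by (auto simp: interval_family_def bij_betw_def)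
      show "disjoint_family_on (\<lambda>i. {a (h i)<..<b (h i)}) {..<card I}"
        using fam h unfolding interval_family_def disjoint_family_on_def bij_betw_def inj_on_def
        by (metis image_eqI)
      show "(\<Sum>i<card I. b (h i) - a (h i)) < \<delta>"
        using len sum.reindex_bij_betw[OF h, of "\<lambda>i. b i - a i"] by simp
    qed
    then show "(\<Sum>i\<in>I. norm (F (b i) - F (a i))) < \<epsilon>"
      using sum.reindex_bij_betw[OF h, of "\<lambda>i. norm (F (b i) - F (a i))"] by simp
  qed (rule \<delta>)
qed

lemma abs_cont_onI:
  fixes F :: "real \<Rightarrow> 'a::real_normed_vector"
  assumes "\<And>\<epsilon>. \<epsilon> > 0 \<Longrightarrow> \<exists>\<delta>>0. \<forall>(N::nat) a b. interval_family l r {..<N} a b \<longrightarrow>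
    (\<Sum>i<N. b i - a i) < \<delta> \<longrightarrow> (\<Sum>i<N. norm (F (b i) - F (a i))) < \<epsilon>"
  shows "abs_cont_on l r F"
  unfolding abs_cont_on_def
proof (intro allI impI)
  fix \<epsilon> :: real assume "\<epsilon> > 0"
  from assms[OF this] show "\<exists>\<delta>>0. \<forall>(N::nat) a b.
        (\<forall>i<N. l \<le> a i \<and> a i \<le> b i \<and> b i \<le> r) \<and>
        disjoint_family_on (\<lambda>i. {a i<..<b i}) {..<N} \<and>
        (\<Sum>i<N. b i - a i) < \<delta> \<longrightarrow>
        (\<Sum>i<N. norm (F (b i) - F (a i))) < \<epsilon>"
    unfolding interval_family_def by (simp add: imp_conjL Ball_def)
qed

text \<open>The gaps between the intervals contribute a nonnegative amount. The induction counts
  nondegenerate intervals only: a one-point interval may lie inside another one without violating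
  disjointness of the open intervals, which would spoil the ordering, but its increment is
  zero.\<close>

lemma interval_family_mono_sum_le:
  fixes \<phi> :: "real \<Rightarrow> real"
  assumes "interval_family l r I a b" "mono_on {l..r} \<phi>" "l \<le> r"
  shows "(\<Sum>i\<in>I. \<phi> (b i) - \<phi> (a i)) \<le> \<phi> r - \<phi> l"
  using assms
proof (induction "card {i\<in>I. a i < b i}" arbitrary: I r rule: less_induct)
  case less
  define J where "J = {i\<in>I. a i < b i}"
  have fin: "finite I" "finite J" using less.prems by (auto simp: interval_family_def J_def)
  have bd: "\<And>i. i \<in> I \<Longrightarrow> l \<le> a i \<and> a i \<le> b i \<and> b i \<le> r"
    using less.prems by (auto simp: interval_family_def)
  have disj: "\<And>i j. i \<in> I \<Longrightarrow> j \<in> I \<Longrightarrow> i \<noteq> j \<Longrightarrow> {a i<..<b i} \<inter> {a j<..<b j} = {}"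
    using less.prems by (auto simp: interval_family_def disjoint_family_on_def)
  have mono: "\<And>x y. l \<le> x \<Longrightarrow> x \<le> y \<Longrightarrow> y \<le> r \<Longrightarrow> \<phi> x \<le> \<phi> y"
    using less.prems(2) by (auto simp: mono_on_def)
  have eq: "(\<Sum>i\<in>I. \<phi> (b i) - \<phi> (a i)) = (\<Sum>i\<in>J. \<phi> (b i) - \<phi> (a i))"
  proof (rule sum.mono_neutral_right)
    show "\<forall>i\<in>I - J. \<phi> (b i) - \<phi> (a i) = 0"
      using bd by (force simp: J_def)
  qed (use fin in \<open>auto simp: J_def\<close>)
  show ?case
  proof (cases "J = {}")
    case True
    then show ?thesis using eq mono[of l r] less.prems(3) by simp
  next
    case False
    \<comment> \<open>Peel off the interval with the largest left end; all others then end before it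
      begins, and the induction hypothesis applies with \<open>r\<close> replaced by that left
      end.\<close>
    then have "Max (a ` J) \<in> a ` J" using fin(2) by (intro Max_in) auto
    then obtain k where "k \<in> J" "a k = Max (a ` J)" by auto
    then have k: "k \<in> J" "\<And>i. i \<in> J \<Longrightarrow> a i \<le> a k" using fin(2) by auto
    then have kI: "k \<in> I" "a k < b k" by (auto simp: J_def)
    have ab: "b i \<le> a k" if "i \<in> J - {k}" for i
    proof (rule ccontr)
      assume "\<not> b i \<le> a k"
      \<comment> \<open>The midpoint between the larger left end and the smaller right end would be
        common to both open intervals.\<close>
      then have "(a k + min (b i) (b k)) / 2 \<in> {a i<..<b i} \<inter> {a k<..<b k}"
        using k(2)[of i] kI that by (auto simp: J_def min_def field_simps)
      then show False using disj[of i k] that kI by (auto simp: J_def)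
    qed
    have J': "{i \<in> J - {k}. a i < b i} = J - {k}" by (auto simp: J_def)
    have "(\<Sum>i\<in>J - {k}. \<phi> (b i) - \<phi> (a i)) \<le> \<phi> (a k) - \<phi> l"
    proof (rule less.hyps)
      show "card {i \<in> J - {k}. a i < b i} < card {i \<in> I. a i < b i}"
        unfolding J' using card_Diff1_less[OF fin(2) k(1)] by (simp add: J_def)
      show "interval_family l (a k) (J - {k}) a b"
        using bd ab disj fin by (auto simp: interval_family_def disjoint_family_on_def J_def)
      show "mono_on {l..a k} \<phi>"
        using less.prems(2) bd[OF kI(1)] by (auto simp: mono_on_def)
      show "l \<le> a k" using bd kI by auto
    qed
    moreover have "(\<Sum>i\<in>J. \<phi> (b i) - \<phi> (a i)) = \<phi> (b k) - \<phi> (a k) + (\<Sum>i\<in>J - {k}. \<phi> (b i) - \<phi> (a i))"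
      using k fin by (simp add: sum.remove)
    moreover have "\<phi> (b k) \<le> \<phi> r" using mono[of "b k" r] bd[OF kI(1)] by auto
    ultimately show ?thesis using eq by linarith
  qed
qed

lemma interval_family_length_le:
  "interval_family l r I a b \<Longrightarrow> l \<le> r \<Longrightarrow> (\<Sum>i\<in>I. b i - a i) \<le> r - l"
  using interval_family_mono_sum_le[of l r I a b "\<lambda>x. x"] by (simp add: mono_on_def)

lemma interval_family_single: "l \<le> s \<Longrightarrow> s \<le> t \<Longrightarrow> t \<le> r \<Longrightarrow> interval_family l r {x} (\<lambda>_. s) (\<lambda>_. t)"
  by (simp add: interval_family_def disjoint_family_on_def)

lemma abs_cont_on_imp_continuous_on:
  fixes F :: "real \<Rightarrow> 'a::real_normed_vector"
  assumes "abs_cont_on l r F"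
  shows "continuous_on {l..r} F"
  unfolding continuous_on_iff
proof (intro ballI allI impI)
  fix x e :: real assume x: "x \<in> {l..r}" and e: "e > 0"
  obtain \<delta> where \<delta>: "\<delta> > 0" "\<And>(I::unit set) a b. interval_family l r I a b \<Longrightarrow>
    (\<Sum>i\<in>I. b i - a i) < \<delta> \<Longrightarrow> (\<Sum>i\<in>I. norm (F (b i) - F (a i))) < e"
    using abs_cont_onD[OF assms e] by blast
  show "\<exists>d>0. \<forall>x'\<in>{l..r}. dist x' x < d \<longrightarrow> dist (F x') (F x) < e"
  proof (intro exI[of _ \<delta>] conjI ballI impI)
    fix y assume y: "y \<in> {l..r}" "dist y x < \<delta>"
    show "dist (F y) (F x) < e"
    proof (cases "x \<le> y")
      case True
      then show ?thesis
        using \<delta>(2)[of "{()}" "\<lambda>_. x" "\<lambda>_. y", OF interval_family_single] x y by (auto simp: dist_norm)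
    next
      case False
      then show ?thesis
        using \<delta>(2)[of "{()}" "\<lambda>_. y" "\<lambda>_. x", OF interval_family_single] x y
        by (auto simp: dist_norm norm_minus_commute)
    qed
  qed (rule \<delta>)
qed

text \<open>All closure properties below reduce to this one comparison of increments; two dominating
  functions are allowed because the product rule produces two terms.\<close>

lemma abs_cont_on_dominated:
  fixes F :: "real \<Rightarrow> 'a::real_normed_vector" and G :: "real \<Rightarrow> 'b::real_normed_vector"
    and H :: "real \<Rightarrow> 'c::real_normed_vector"
  assumes G: "abs_cont_on l r G" and H: "abs_cont_on l r H"
    and le: "\<And>s t. s \<in> {l..r} \<Longrightarrow> t \<in> {l..r} \<Longrightarrow>
      norm (F t - F s) \<le> C * norm (G t - G s) + C * norm (H t - H s)"
  shows "abs_cont_on l r F"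
proof (rule abs_cont_onI)
  fix \<epsilon> :: real assume "\<epsilon> > 0"
  \<comment> \<open>The factor \<open>2\<close> serves the two dominating functions; adding
    \<open>1\<close> to \<open>\<bar>C\<bar>\<close> avoids division by zero and makes the final
    inequality strict.\<close>
  define \<eta> where "\<eta> = \<epsilon> / (2 * (\<bar>C\<bar> + 1))"
  have \<eta>: "\<eta> > 0" using \<open>\<epsilon> > 0\<close> by (simp add: \<eta>_def)
  obtain d1 where d1: "d1 > 0" "\<And>(I::nat set) a b. interval_family l r I a b \<Longrightarrow>
    (\<Sum>i\<in>I. b i - a i) < d1 \<Longrightarrow> (\<Sum>i\<in>I. norm (G (b i) - G (a i))) < \<eta>"
    using abs_cont_onD[OF G \<eta>] by blast
  obtain d2 where d2: "d2 > 0" "\<And>(I::nat set) a b. interval_family l r I a b \<Longrightarrow>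
    (\<Sum>i\<in>I. b i - a i) < d2 \<Longrightarrow> (\<Sum>i\<in>I. norm (H (b i) - H (a i))) < \<eta>"
    using abs_cont_onD[OF H \<eta>] by blast
  show "\<exists>\<delta>>0. \<forall>(N::nat) a b. interval_family l r {..<N} a b \<longrightarrow>
    (\<Sum>i<N. b i - a i) < \<delta> \<longrightarrow> (\<Sum>i<N. norm (F (b i) - F (a i))) < \<epsilon>"
  proof (intro exI[of _ "min d1 d2"] conjI allI impI)
    fix N :: nat and a b
    assume fam: "interval_family l r {..<N} a b" and len: "(\<Sum>i<N. b i - a i) < min d1 d2"
    have 1: "(\<Sum>i<N. norm (G (b i) - G (a i))) < \<eta>" "(\<Sum>i<N. norm (H (b i) - H (a i))) < \<eta>"
      using d1(2)[OF fam] d2(2)[OF fam] len by auto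
    have "(\<Sum>i<N. norm (F (b i) - F (a i))) \<le>
        (\<Sum>i<N. \<bar>C\<bar> * norm (G (b i) - G (a i)) + \<bar>C\<bar> * norm (H (b i) - H (a i)))"
    proof (rule sum_mono)
      fix i assume "i \<in> {..<N}"
      then have "a i \<in> {l..r}" "b i \<in> {l..r}" using fam by (force simp: interval_family_def)+
      from le[OF this] have "norm (F (b i) - F (a i)) \<le> C * norm (G (b i) - G (a i)) + C * norm (H (b i) - H (a i))" .
      also have "\<dots> \<le> \<bar>C\<bar> * norm (G (b i) - G (a i)) + \<bar>C\<bar> * norm (H (b i) - H (a i))"
        by (intro add_mono mult_right_mono norm_ge_zero abs_ge_self)
      finally show "norm (F (b i) - F (a i)) \<le>
          \<bar>C\<bar> * norm (G (b i) - G (a i)) + \<bar>C\<bar> * norm (H (b i) - H (a i))" .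
    qed
    also have "\<dots> = \<bar>C\<bar> * ((\<Sum>i<N. norm (G (b i) - G (a i))) + (\<Sum>i<N. norm (H (b i) - H (a i))))"
      by (simp add: sum.distrib sum_distrib_left algebra_simps)
    also have "\<dots> \<le> \<bar>C\<bar> * (\<eta> + \<eta>)"
      by (intro mult_left_mono add_mono less_imp_le 1 abs_ge_zero)
    also have "\<dots> < (\<bar>C\<bar> + 1) * (\<eta> + \<eta>)" using \<eta> by (intro mult_strict_right_mono) linarith+
    also have "\<dots> = \<epsilon>"
    proof -
      have "K * (\<epsilon> / (2 * K) + \<epsilon> / (2 * K)) = \<epsilon>" if "K > 0" for K
        using that by (simp add: field_simps)
      from this[of "\<bar>C\<bar> + 1"] show ?thesis by (simp add: \<eta>_def)
    qed
    finally show "(\<Sum>i<N. norm (F (b i) - F (a i))) < \<epsilon>" .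
  qed (use d1(1) d2(1) in auto)
qed

lemma abs_cont_on_ident: "abs_cont_on l r (\<lambda>x. x)"
proof (rule abs_cont_onI)
  fix \<epsilon> :: real assume "\<epsilon> > 0"
  show "\<exists>\<delta>>0. \<forall>(N::nat) a b. interval_family l r {..<N} a b \<longrightarrow>
    (\<Sum>i<N. b i - a i) < \<delta> \<longrightarrow> (\<Sum>i<N. norm (b i - a i)) < \<epsilon>"
  proof (intro exI[of _ \<epsilon>] conjI allI impI)
    fix N :: nat and a b
    assume "interval_family l r {..<N} a b" and less: "(\<Sum>i<N. b i - a i) < \<epsilon>"
    then have "(\<Sum>i<N. norm (b i - a i)) = (\<Sum>i<N. b i - a i)"
      by (intro sum.cong) (auto simp: interval_family_def)
    with less show "(\<Sum>i<N. norm (b i - a i)) < \<epsilon>" by linarith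
  qed fact
qed

lemma abs_cont_on_Lipschitz:
  assumes "\<And>s t. s \<in> {l..r} \<Longrightarrow> t \<in> {l..r} \<Longrightarrow> norm (F t - F s) \<le> C * \<bar>t - s\<bar>"
  shows "abs_cont_on l r F"
proof (rule abs_cont_on_dominated[OF abs_cont_on_ident abs_cont_on_ident])
  fix s t assume "s \<in> {l..r}" "t \<in> {l..r}"
  then have "norm (F t - F s) \<le> C * \<bar>t - s\<bar>" by (rule assms)
  also have "\<dots> \<le> \<bar>C\<bar> * \<bar>t - s\<bar>" by (rule mult_right_mono) auto
  also have "\<dots> \<le> \<bar>C\<bar> * \<bar>t - s\<bar> + \<bar>C\<bar> * \<bar>t - s\<bar>" by simp
  finally show "norm (F t - F s) \<le> \<bar>C\<bar> * norm (t - s) + \<bar>C\<bar> * norm (t - s)" unfolding real_norm_def .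
qed

lemma abs_cont_on_mult:
  fixes F G :: "real \<Rightarrow> 'a::real_normed_algebra"
  assumes F: "abs_cont_on l r F" and G: "abs_cont_on l r G"
  shows "abs_cont_on l r (\<lambda>x. F x * G x)"
proof -
  have "bounded (F ` {l..r})" "bounded (G ` {l..r})"
    by (rule compact_imp_bounded compact_continuous_image abs_cont_on_imp_continuous_on compact_Icc F G)+
  then obtain B B' where B: "\<And>x. x \<in> {l..r} \<Longrightarrow> norm (F x) \<le> B"
    and B': "\<And>x. x \<in> {l..r} \<Longrightarrow> norm (G x) \<le> B'"
    unfolding bounded_iff by blast
  show ?thesis
  proof (rule abs_cont_on_dominated[OF F G, where C = "max B B'"])
    fix s t assume st: "s \<in> {l..r}" "t \<in> {l..r}"
    have "norm (F t * G t - F s * G s) = norm ((F t - F s) * G t + F s * (G t - G s))"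
      by (simp add: algebra_simps)
    also have "\<dots> \<le> norm (F t - F s) * norm (G t) + norm (F s) * norm (G t - G s)"
      by (intro norm_triangle_le add_mono norm_mult_ineq)
    also have "\<dots> \<le> norm (F t - F s) * max B B' + max B B' * norm (G t - G s)"
      using B[OF st(1)] B'[OF st(2)] by (intro add_mono mult_left_mono mult_right_mono) auto
    finally show "norm (F t * G t - F s * G s) \<le>
      max B B' * norm (F t - F s) + max B B' * norm (G t - G s)" by (simp add: mult.commute)
  qed
qed

lemma abs_cont_on_add:
  "abs_cont_on l r F \<Longrightarrow> abs_cont_on l r G \<Longrightarrow> abs_cont_on l r (\<lambda>x. F x + G x)"
  by (rule abs_cont_on_dominated[where C = 1 and G = F and H = G])
    (auto simp: add_diff_add intro: norm_triangle_ineq)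

lemma abs_cont_on_bounded_linear:
  assumes "bounded_linear T" "abs_cont_on l r F"
  shows "abs_cont_on l r (\<lambda>x. T (F x))"
proof -
  interpret T: bounded_linear T by fact
  obtain K where K: "K > 0" "\<And>x. norm (T x) \<le> norm x * K" using T.pos_bounded by blast
  show ?thesis
  proof (rule abs_cont_on_dominated[OF assms(2,2)])
    fix s t
    have "norm (T (F t) - T (F s)) \<le> K * norm (F t - F s)"
      using K(2)[of "F t - F s"] by (simp add: T.diff mult.commute)
    also have "\<dots> \<le> K * norm (F t - F s) + K * norm (F t - F s)" using K(1) by simp
    finally show "norm (T (F t) - T (F s)) \<le> K * norm (F t - F s) + K * norm (F t - F s)" .
  qed
qed

lemma abs_cont_on_diff:
  assumes "abs_cont_on l r F" "abs_cont_on l r G"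
  shows "abs_cont_on l r (\<lambda>x. F x - G x)"
  using abs_cont_on_add[OF assms(1) abs_cont_on_bounded_linear[OF _ assms(2), of uminus]]
  by (simp add: bounded_linear_minus[OF bounded_linear_ident])

text \<open>Cutting at \<open>x\<close> by \<open>min\<close> and \<open>max\<close> keeps the index
  set: an interval on the wrong side of \<open>x\<close> collapses to the point \<open>x\<close>,
  where increments vanish. No case distinction on the position of \<open>x\<close> is needed
  later.\<close>

lemma interval_family_split:
  assumes "interval_family l r I a b" "l \<le> x" "x \<le> r"
  shows "interval_family l x I (\<lambda>i. min x (a i)) (\<lambda>i. min x (b i))"
    and "interval_family x r I (\<lambda>i. max x (a i)) (\<lambda>i. max x (b i))"
proof -
  have fin: "finite I" and le: "\<And>i. i \<in> I \<Longrightarrow> l \<le> a i \<and> a i \<le> b i \<and> b i \<le> r"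
    and disj: "disjoint_family_on (\<lambda>i. {a i<..<b i}) I"
    using assms by (auto simp: interval_family_def)
  have "disjoint_family_on (\<lambda>i. {min x (a i)<..<min x (b i)}) I"
    using disj unfolding disjoint_family_on_def by (fastforce simp: disjoint_iff)
  moreover have "disjoint_family_on (\<lambda>i. {max x (a i)<..<max x (b i)}) I"
    using disj unfolding disjoint_family_on_def by (fastforce simp: disjoint_iff)
  moreover have "l \<le> min x (a i) \<and> min x (a i) \<le> min x (b i) \<and> min x (b i) \<le> x"
    "x \<le> max x (a i) \<and> max x (a i) \<le> max x (b i) \<and> max x (b i) \<le> r" if "i \<in> I" for i
    using le[OF that] assms(2,3) by linarith+
  ultimately show "interval_family l x I (\<lambda>i. min x (a i)) (\<lambda>i. min x (b i))"
    "interval_family x r I (\<lambda>i. max x (a i)) (\<lambda>i. max x (b i))"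
    using fin unfolding interval_family_def by blast+
qed

lemma min_max_increment:
  fixes F :: "real \<Rightarrow> real"
  shows "F b - F a = (F (min x b) - F (min x a)) + (F (max x b) - F (max x a))"
  by (auto simp: min_def max_def)

section \<open>Positive variation and the Jordan decomposition\<close>

definition increments :: "(real \<Rightarrow> real) \<Rightarrow> real \<Rightarrow> real \<Rightarrow> real set" where
  "increments F x y = {(\<Sum>i<N. F (b i) - F (a i)) | (N::nat) a b. interval_family x y {..<N} a b}"

text \<open>Increments are summed with their sign, so the supremum is the positive variation and not
  the total one. Both it and its difference with \<open>F\<close> increase, which is the
  decomposition used for densities.\<close>

definition pos_variation :: "(real \<Rightarrow> real) \<Rightarrow> real \<Rightarrow> real \<Rightarrow> real" where
  "pos_variation F x y = Sup (increments F x y)"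

lemma incrementsI:
  "interval_family x y {..<N} a b \<Longrightarrow> (\<Sum>i<N. F (b i) - F (a i)) \<in> increments F x y" for N :: nat
  unfolding increments_def by blast

lemma zero_in_increments: "0 \<in> increments F x y"
  unfolding increments_def
  by (rule CollectI, rule exI[of _ 0]) (simp add: interval_family_def disjoint_family_on_def)

lemma increments_mono: "x' \<le> x \<Longrightarrow> y \<le> y' \<Longrightarrow> increments F x y \<subseteq> increments F x' y'"
  unfolding increments_def using interval_family_mono by blast

text \<open>An interval of length at most \<open>\<delta> / 2\<close> contributes less than
  \<open>1\<close> to any sum of increments, and finitely many such pieces make up
  \<open>{x..y}\<close>.\<close>

lemma increments_bdd_above:
  assumes "abs_cont_on l r F" "l \<le> x" "x \<le> y" "y \<le> r"
  shows "bdd_above (increments F x y)"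
proof -
  obtain \<delta> where \<delta>: "\<delta> > 0" "\<And>(I::nat set) a b. interval_family l r I a b \<Longrightarrow>
    (\<Sum>i\<in>I. b i - a i) < \<delta> \<Longrightarrow> (\<Sum>i\<in>I. norm (F (b i) - F (a i))) < 1"
    using abs_cont_onD[OF assms(1), of 1] by auto
  have *: "(\<Sum>i<N. F (b i) - F (a i)) \<le> k"
    if "z \<in> {x..y}" "z \<le> x + real k * (\<delta> / 2)" "interval_family x z {..<N} a b" for z k a b and N :: nat
    using that
  proof (induction k arbitrary: z N a b)
    case 0
    then have "z = x" by auto
    with 0 have "\<forall>i\<in>{..<N}. a i = b i" by (force simp: interval_family_def)
    then show ?case by simp
  next
    case (Suc k)
    \<comment> \<open>The last piece \<open>{w..z}\<close> has length at most
      \<open>\<delta> / 2\<close>; the maximum keeps the cut inside the interval when less than that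
      is left.\<close>
    define w where "w = max x (z - \<delta> / 2)"
    have w: "x \<le> w" "w \<le> z" "w \<in> {x..y}" "z - w \<le> \<delta> / 2"
      using Suc.prems(1) \<delta>(1) unfolding w_def atLeastAtMost_iff by linarith+
    note sp = interval_family_split[OF Suc.prems(3) w(1,2)]
    have 1: "(\<Sum>i<N. F (min w (b i)) - F (min w (a i))) \<le> k"
    proof (rule Suc.IH[OF w(3) _ sp(1)])
      have "z - \<delta> / 2 \<le> x + real k * (\<delta> / 2)" "0 \<le> real k * (\<delta> / 2)"
        using Suc.prems(2) \<delta>(1) by (auto simp: field_simps)
      then show "w \<le> x + real k * (\<delta> / 2)" unfolding w_def by simp
    qed
    have "(\<Sum>i<N. norm (F (max w (b i)) - F (max w (a i)))) < 1"
    proof (rule \<delta>(2))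
      show "interval_family l r {..<N} (\<lambda>i. max w (a i)) (\<lambda>i. max w (b i))"
        using sp(2) by (rule interval_family_mono) (use w assms Suc.prems in auto)
      show "(\<Sum>i<N. max w (b i) - max w (a i)) < \<delta>"
        using interval_family_length_le[OF sp(2) w(2)] w(4) \<delta>(1) by linarith
    qed
    moreover have "(\<Sum>i<N. F (max w (b i)) - F (max w (a i))) \<le>
        (\<Sum>i<N. norm (F (max w (b i)) - F (max w (a i))))"
      by (rule sum_mono) auto
    moreover have "(\<Sum>i<N. F (b i) - F (a i)) = (\<Sum>i<N. F (min w (b i)) - F (min w (a i))) +
        (\<Sum>i<N. F (max w (b i)) - F (max w (a i)))"
      unfolding sum.distrib[symmetric] by (rule sum.cong[OF refl], rule min_max_increment)
    ultimately show ?case using 1 by simp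
  qed
  obtain k :: nat where "(y - x) / (\<delta> / 2) \<le> real k" using real_arch_simple by blast
  then have "y \<le> x + real k * (\<delta> / 2)" using \<delta>(1) by (simp add: field_simps)
  then have "s \<le> real k" if "s \<in> increments F x y" for s
    using that *[of y k] assms(3) by (auto simp: increments_def)
  then show ?thesis by (auto simp: bdd_above_def)
qed

lemma pos_variation_mono:
  assumes F: "abs_cont_on l r F" and "l \<le> x" "x \<le> y" "y \<le> r"
  shows "pos_variation F l x \<le> pos_variation F l y"
  unfolding pos_variation_def
  by (rule cSup_subset_mono)
    (use increments_mono[of l l x y F] increments_bdd_above[OF F] zero_in_increments[of F l x] assms in auto)

text \<open>Appending \<open>{x..y}\<close> to any family in \<open>{l..x}\<close> gives a family in
  \<open>{l..y}\<close>. The inequality says that positive variation minus \<open>F\<close> is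
  increasing.\<close>

lemma pos_variation_increment:
  assumes F: "abs_cont_on l r F" and xy: "l \<le> x" "x \<le> y" "y \<le> r"
  shows "pos_variation F l x + (F y - F x) \<le> pos_variation F l y"
proof -
  have "pos_variation F l x \<le> pos_variation F l y - (F y - F x)"
    unfolding pos_variation_def[of F l x]
  proof (rule cSup_least)
    fix s assume "s \<in> increments F l x"
    then obtain N :: nat and a b where s: "s = (\<Sum>i<N. F (b i) - F (a i))" "interval_family l x {..<N} a b"
      by (auto simp: increments_def)
    have "(\<Sum>i<Suc N. F ((b(N := y)) i) - F ((a(N := x)) i)) \<in> increments F l y"
      unfolding increments_def
    proof (rule CollectI, intro exI conjI)
      show "interval_family l y {..<Suc N} (a(N := x)) (b(N := y))"
        unfolding interval_family_def
      proof (intro conjI ballI)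
        have bd: "l \<le> a i \<and> a i \<le> b i \<and> b i \<le> x" if "i < N" for i
          using s(2) that by (auto simp: interval_family_def)
        show "l \<le> (a(N := x)) i" "(a(N := x)) i \<le> (b(N := y)) i" "(b(N := y)) i \<le> y"
          if "i \<in> {..<Suc N}" for i
          using that bd[of i] xy by (auto simp: less_Suc_eq)
        have "{a i<..<b i} \<inter> {x<..<y} = {}" if "i < N" for i
          using bd[OF that] by auto
        moreover have "{a i<..<b i} \<inter> {a j<..<b j} = {}" if "i < N" "j < N" "i \<noteq> j" for i j
          using s(2) that by (auto simp: interval_family_def disjoint_family_on_def)
        ultimately show "disjoint_family_on (\<lambda>i. {(a(N := x)) i<..<(b(N := y)) i}) {..<Suc N}"
          unfolding disjoint_family_on_def
          by (metis Int_commute fun_upd_apply lessThan_iff less_antisym)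
      qed simp
    qed (rule refl)
    moreover have "(\<Sum>i<Suc N. F ((b(N := y)) i) - F ((a(N := x)) i)) = s + (F y - F x)"
      unfolding s(1) sum.lessThan_Suc by simp
    ultimately show "s \<le> pos_variation F l y - (F y - F x)"
      unfolding pos_variation_def
      using cSup_upper[OF _ increments_bdd_above[OF F order_refl, of y], of "s + (F y - F x)"] xy by simp
  qed (use zero_in_increments in blast)
  then show ?thesis by simp
qed

text \<open>Every family in \<open>{l..y}\<close> splits at \<open>x\<close>. This expresses an
  increment of the variation through \<open>F\<close> on that interval alone, which is how smallness
  passes from \<open>F\<close> to its variation.\<close>

lemma pos_variation_diff_le:
  assumes F: "abs_cont_on l r F" and xy: "l \<le> x" "x \<le> y" "y \<le> r"
  shows "pos_variation F l y - pos_variation F l x \<le> pos_variation F x y"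
proof -
  have "pos_variation F l y \<le> pos_variation F l x + pos_variation F x y"
    unfolding pos_variation_def[of F l y]
  proof (rule cSup_least)
    fix s assume "s \<in> increments F l y"
    then obtain N :: nat and a b where s: "s = (\<Sum>i<N. F (b i) - F (a i))" "interval_family l y {..<N} a b"
      by (auto simp: increments_def)
    note sp = interval_family_split[OF s(2) xy(1,2)]
    have "(\<Sum>i<N. F (min x (b i)) - F (min x (a i))) \<in> increments F l x"
      "(\<Sum>i<N. F (max x (b i)) - F (max x (a i))) \<in> increments F x y"
      by (rule incrementsI[OF sp(1)], rule incrementsI[OF sp(2)])
    then have "(\<Sum>i<N. F (min x (b i)) - F (min x (a i))) \<le> pos_variation F l x"
      "(\<Sum>i<N. F (max x (b i)) - F (max x (a i))) \<le> pos_variation F x y"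
      unfolding pos_variation_def using increments_bdd_above[OF F] xy by (auto intro!: cSup_upper)
    moreover have "s = (\<Sum>i<N. F (min x (b i)) - F (min x (a i))) + (\<Sum>i<N. F (max x (b i)) - F (max x (a i)))"
      unfolding s(1) sum.distrib[symmetric] by (rule sum.cong[OF refl], rule min_max_increment)
    ultimately show "s \<le> pos_variation F l x + pos_variation F x y" by linarith
  qed (use zero_in_increments in blast)
  then show ?thesis by simp
qed

text \<open>Inside each interval of the given family a nearly optimal subfamily is chosen. All
  subfamilies together form one family of no greater total length, to which absolute continuity of
  \<open>F\<close> applies.\<close>

lemma abs_cont_on_pos_variation:
  assumes F: "abs_cont_on l r F"
  shows "abs_cont_on l r (pos_variation F l)"
proof (rule abs_cont_onI)
  fix \<epsilon> :: real assume \<epsilon>: "\<epsilon> > 0"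
  obtain \<delta> where \<delta>: "\<delta> > 0" "\<And>(I::(nat \<times> nat) set) a b. interval_family l r I a b \<Longrightarrow>
    (\<Sum>i\<in>I. b i - a i) < \<delta> \<Longrightarrow> (\<Sum>i\<in>I. norm (F (b i) - F (a i))) < \<epsilon> / 2"
    using abs_cont_onD[OF F, of "\<epsilon> / 2"] \<epsilon> by auto
  show "\<exists>\<delta>>0. \<forall>(N::nat) x y. interval_family l r {..<N} x y \<longrightarrow>
    (\<Sum>j<N. y j - x j) < \<delta> \<longrightarrow> (\<Sum>j<N. norm (pos_variation F l (y j) - pos_variation F l (x j))) < \<epsilon>"
  proof (intro exI[of _ \<delta>] conjI allI impI)
    fix N :: nat and x y
    assume fam: "interval_family l r {..<N} x y" and len: "(\<Sum>j<N. y j - x j) < \<delta>"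
    have xy: "l \<le> x j" "x j \<le> y j" "y j \<le> r" if "j < N" for j
      using fam that by (auto simp: interval_family_def)
    \<comment> \<open>Loss per interval in approaching the supremum; over \<open>N\<close> intervals
      the losses stay within \<open>\<epsilon> / 2\<close>.\<close>
    define \<eta> where "\<eta> = \<epsilon> / (2 * (real N + 1))"
    have \<eta>: "\<eta> > 0" "real N * \<eta> \<le> \<epsilon> / 2" using \<epsilon> by (auto simp: \<eta>_def field_simps)
    have "\<exists>(n::nat) a b. interval_family (x j) (y j) {..<n} a b \<and>
        pos_variation F (x j) (y j) - \<eta> \<le> (\<Sum>i<n. F (b i) - F (a i))" if j: "j < N" for j
    proof -
      have "\<exists>s\<in>increments F (x j) (y j). pos_variation F (x j) (y j) - \<eta> < s"
        unfolding pos_variation_def using increments_bdd_above[OF F xy(1-3)[OF j]] zero_in_increments \<eta>(1)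
        by (intro less_cSupD) auto
      then show ?thesis unfolding increments_def by fastforce
    qed
    then obtain n :: "nat \<Rightarrow> nat" and a b where nab: "\<And>j. j < N \<Longrightarrow> interval_family (x j) (y j) {..<n j} (a j) (b j)"
      "\<And>j. j < N \<Longrightarrow> pos_variation F (x j) (y j) - \<eta> \<le> (\<Sum>i<n j. F (b j i) - F (a j i))"
      by metis
    define I where "I = (SIGMA j:{..<N}. {..<n j})"
    have inner: "x j \<le> a j i \<and> a j i \<le> b j i \<and> b j i \<le> y j" if "j < N" "i < n j" for i j
      using nab(1)[OF that(1)] that(2) by (auto simp: interval_family_def)
    have "(\<Sum>p\<in>I. norm (F (b (fst p) (snd p)) - F (a (fst p) (snd p)))) < \<epsilon> / 2"
    proof (rule \<delta>(2))
      show "interval_family l r I (\<lambda>p. a (fst p) (snd p)) (\<lambda>p. b (fst p) (snd p))"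
        unfolding interval_family_def
      proof (intro conjI)
        show "finite I" by (simp add: I_def)
        show "\<forall>p\<in>I. l \<le> a (fst p) (snd p) \<and> a (fst p) (snd p) \<le> b (fst p) (snd p) \<and> b (fst p) (snd p) \<le> r"
        proof
          fix p assume "p \<in> I"
          then have p: "fst p < N" "snd p < n (fst p)" by (auto simp: I_def)
          show "l \<le> a (fst p) (snd p) \<and> a (fst p) (snd p) \<le> b (fst p) (snd p) \<and> b (fst p) (snd p) \<le> r"
            using inner[OF p] xy[OF p(1)] by linarith
        qed
        show "disjoint_family_on (\<lambda>p. {a (fst p) (snd p)<..<b (fst p) (snd p)}) I"
          unfolding disjoint_family_on_def
        proof (intro ballI impI)
          fix p q assume pq: "p \<in> I" "q \<in> I" "p \<noteq> q"
          obtain j i j' i' where p: "p = (j, i)" "q = (j', i')" by fastforce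
          then have ji: "j < N" "i < n j" "j' < N" "i' < n j'" using pq by (auto simp: I_def)
          show "{a (fst p) (snd p)<..<b (fst p) (snd p)} \<inter> {a (fst q) (snd q)<..<b (fst q) (snd q)} = {}"
          proof (cases "j = j'")
            case True
            then have "i \<noteq> i'" using pq p by auto
            then show ?thesis using nab(1)[OF ji(1)] ji True p
              by (auto simp: interval_family_def disjoint_family_on_def)
          next
            case False
            then have "{x j<..<y j} \<inter> {x j'<..<y j'} = {}"
              using fam ji by (auto simp: interval_family_def disjoint_family_on_def)
            moreover have "{a j i<..<b j i} \<subseteq> {x j<..<y j}" "{a j' i'<..<b j' i'} \<subseteq> {x j'<..<y j'}"
              using inner[OF ji(1,2)] inner[OF ji(3,4)] by auto
            ultimately show ?thesis unfolding p fst_conv snd_conv by blast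
          qed
        qed
      qed
      have "(\<Sum>p\<in>I. b (fst p) (snd p) - a (fst p) (snd p)) = (\<Sum>j<N. \<Sum>i<n j. b j i - a j i)"
        unfolding I_def by (subst sum.Sigma) (auto simp: case_prod_beta)
      also have "\<dots> \<le> (\<Sum>j<N. y j - x j)"
        by (intro sum_mono interval_family_length_le nab(1) xy) auto
      finally show "(\<Sum>p\<in>I. b (fst p) (snd p) - a (fst p) (snd p)) < \<delta>" using len by simp
    qed
    moreover have "(\<Sum>j<N. \<Sum>i<n j. F (b j i) - F (a j i)) \<le>
        (\<Sum>p\<in>I. norm (F (b (fst p) (snd p)) - F (a (fst p) (snd p))))"
    proof -
      have "(\<Sum>j<N. \<Sum>i<n j. F (b j i) - F (a j i)) = (\<Sum>p\<in>I. F (b (fst p) (snd p)) - F (a (fst p) (snd p)))"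
        unfolding I_def by (subst sum.Sigma) (auto simp: case_prod_beta)
      also have "\<dots> \<le> (\<Sum>p\<in>I. norm (F (b (fst p) (snd p)) - F (a (fst p) (snd p))))"
        by (rule sum_mono) auto
      finally show ?thesis .
    qed
    moreover have "(\<Sum>j<N. norm (pos_variation F l (y j) - pos_variation F l (x j))) \<le>
        (\<Sum>j<N. (\<Sum>i<n j. F (b j i) - F (a j i)) + \<eta>)"
    proof (rule sum_mono)
      fix j assume "j \<in> {..<N}"
      then have j: "j < N" by simp
      show "norm (pos_variation F l (y j) - pos_variation F l (x j)) \<le> (\<Sum>i<n j. F (b j i) - F (a j i)) + \<eta>"
        using pos_variation_diff_le[OF F xy(1-3)[OF j]] pos_variation_mono[OF F xy(1-3)[OF j]] nab(2)[OF j]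
        by simp
    qed
    ultimately show "(\<Sum>j<N. norm (pos_variation F l (y j) - pos_variation F l (x j))) < \<epsilon>"
      using \<eta>(2) by (simp add: sum.distrib)
  qed (rule \<delta>)
qed

section \<open>Densities of absolutely continuous functions\<close>

text \<open>Constant continuation beyond the end points, needed because a Stieltjes measure requires
  a function on the whole line. Clamping only shrinks intervals and keeps them disjoint.\<close>

lemma abs_cont_on_clamp:
  assumes P: "abs_cont_on l r P" and "l \<le> r"
  shows "abs_cont_on l' r' (\<lambda>x. P (max l (min r x)))"
proof (rule abs_cont_onI)
  fix \<epsilon> :: real assume "\<epsilon> > 0"
  then obtain \<delta> where \<delta>: "\<delta> > 0" "\<And>(I::nat set) a b. interval_family l r I a b \<Longrightarrow>
    (\<Sum>i\<in>I. b i - a i) < \<delta> \<Longrightarrow> (\<Sum>i\<in>I. norm (P (b i) - P (a i))) < \<epsilon>"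
    using abs_cont_onD[OF P] by metis
  define c where "c x = max l (min r x)" for x
  show "\<exists>\<delta>>0. \<forall>(N::nat) a b. interval_family l' r' {..<N} a b \<longrightarrow>
    (\<Sum>i<N. b i - a i) < \<delta> \<longrightarrow> (\<Sum>i<N. norm (P (max l (min r (b i))) - P (max l (min r (a i))))) < \<epsilon>"
    unfolding c_def[symmetric]
  proof (intro exI[of _ \<delta>] conjI allI impI)
    fix N :: nat and a b
    assume fam: "interval_family l' r' {..<N} a b" and len: "(\<Sum>i<N. b i - a i) < \<delta>"
    have le: "a i \<le> b i" if "i < N" for i
      using fam that by (auto simp: interval_family_def)
    show "(\<Sum>i<N. norm (P (c (b i)) - P (c (a i)))) < \<epsilon>"
    proof (rule \<delta>(2))
      show "interval_family l r {..<N} (\<lambda>i. c (a i)) (\<lambda>i. c (b i))"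
        unfolding interval_family_def
      proof (intro conjI ballI)
        show "l \<le> c (a i)" "c (b i) \<le> r" for i
          using \<open>l \<le> r\<close> by (auto simp: c_def)
        show "c (a i) \<le> c (b i)" if "i \<in> {..<N}" for i
          using le[of i] that by (auto simp: c_def)
        have sub: "{c (a i)<..<c (b i)} \<subseteq> {a i<..<b i}" for i
          by (auto simp: c_def)
        show "disjoint_family_on (\<lambda>i. {c (a i)<..<c (b i)}) {..<N}"
          unfolding disjoint_family_on_def
        proof (intro ballI impI)
          fix i j assume "i \<in> {..<N}" "j \<in> {..<N}" "i \<noteq> j"
          then have "{a i<..<b i} \<inter> {a j<..<b j} = {}"
            using fam by (simp add: interval_family_def disjoint_family_on_def)
          then show "{c (a i)<..<c (b i)} \<inter> {c (a j)<..<c (b j)} = {}"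
            using sub[of i] sub[of j] by blast
        qed
      qed simp
      have "(\<Sum>i<N. c (b i) - c (a i)) \<le> (\<Sum>i<N. b i - a i)"
      proof (rule sum_mono)
        fix i assume "i \<in> {..<N}"
        then show "c (b i) - c (a i) \<le> b i - a i" using le[of i] by (auto simp: c_def)
      qed
      then show "(\<Sum>i<N. c (b i) - c (a i)) < \<delta>" using len by linarith
    qed
  qed (rule \<delta>)
qed

lemma abs_cont_imp_continuous_UNIV:
  assumes "\<And>l r. abs_cont_on l r Q"
  shows "continuous_on UNIV Q"
  unfolding continuous_on_eq_continuous_at[OF open_UNIV]
proof
  fix x :: real
  show "isCont Q x"
    using abs_cont_on_imp_continuous_on[OF assms, of "x - 1" "x + 1"]
    by (rule continuous_on_interior) simp
qed

text \<open>A null set lies in an open set of measure below \<open>\<delta>\<close>, which is filled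
  by countably many nonoverlapping intervals covering the null set. Absolute continuity bounds the
  \<open>Q\<close>-measure of every finite subfamily by \<open>\<epsilon>\<close>, and continuity
  from below extends the bound to the union.\<close>

lemma interval_measure_null_sets:
  fixes Q :: "real \<Rightarrow> real"
  assumes ac: "\<And>l r. abs_cont_on l r Q" and mono: "mono Q" and A: "A \<in> null_sets lborel"
  shows "A \<in> null_sets (interval_measure Q)"
proof -
  let ?M = "interval_measure Q"
  have cont: "continuous_on UNIV Q" by (rule abs_cont_imp_continuous_UNIV[OF ac])
  have Icc: "emeasure ?M {a..b} = ennreal (Q b - Q a)" if "a \<le> b" for a b
    by (rule emeasure_interval_measure_Icc) (use that cont mono in \<open>auto simp: mono_def\<close>)
  have As: "A \<in> sets borel" using A by auto
  \<comment> \<open>The \<open>\<delta>\<close> of absolute continuity depends on the interval, so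
    the set is first cut down to bounded pieces.\<close>
  have bounded_part: "emeasure ?M (A \<inter> cbox (- real c) (real c)) = 0" for c :: nat
  proof -
    \<comment> \<open>Widening the window by \<open>1\<close> keeps its open box nonempty also for
      \<open>c = 0\<close>, as \<open>covering_lemma\<close> requires.\<close>
    define S where "S = A \<inter> cbox (- real c - 1) (real c + 1)"
    have S: "S \<in> null_sets lborel" "S \<in> sets borel"
      unfolding S_def using A As by (auto intro: null_set_Int2)
    have le: "emeasure ?M S \<le> ennreal \<epsilon>" if \<epsilon>: "\<epsilon> > 0" for \<epsilon>
    proof -
      obtain \<delta> where \<delta>: "\<delta> > 0" "\<And>(I::real set set) a b. interval_family (- real c - 1) (real c + 1) I a b \<Longrightarrow>
        (\<Sum>i\<in>I. b i - a i) < \<delta> \<Longrightarrow> (\<Sum>i\<in>I. norm (Q (b i) - Q (a i))) < \<epsilon>"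
        using abs_cont_onD[OF ac \<epsilon>] by metis
      obtain U where U: "open U" "S \<subseteq> U" "emeasure lborel (U - S) < ennreal \<delta>"
        using outer_regular_lborel[OF S(2) \<delta>(1)] by blast
      have "U \<in> sets borel" using U(1) by simp
      then have Um: "emeasure lborel U < ennreal \<delta>"
        using U(3) emeasure_Diff_null_set[OF S(1), of U] by simp
      have c1: "box (- real c - 1) (real c + 1) \<noteq> {}" by simp
      \<comment> \<open>Each interval of the covering is contained in the gauge set of one of its
        points in \<open>S\<close>; since \<open>S\<close> lies in \<open>U\<close>, this choice of
        gauge forces the whole covering into \<open>U\<close>.\<close>
      have c2: "gauge (\<lambda>x. if x \<in> U then U else UNIV)"
        using U(1) by (simp add: gauge_def)
      have c3: "S \<subseteq> cbox (- real c - 1) (real c + 1)" by (simp add: S_def)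
      obtain \<D> where \<D>: "countable \<D>" "\<Union>\<D> \<subseteq> cbox (- real c - 1) (real c + 1)"
        "\<And>K. K \<in> \<D> \<Longrightarrow> interior K \<noteq> {} \<and> (\<exists>c d. K = cbox c d)"
        "pairwise (\<lambda>A B. interior A \<inter> interior B = {}) \<D>"
        "\<And>K. K \<in> \<D> \<Longrightarrow> \<exists>x \<in> S \<inter> K. K \<subseteq> (if x \<in> U then U else UNIV)"
        "S \<subseteq> \<Union>\<D>"
        by (rule covering_lemma[OF c3 c1 c2]) (rule that)
      have KU: "K \<subseteq> U" if KD: "K \<in> \<D>" for K
      proof -
        obtain x where "x \<in> S" "K \<subseteq> (if x \<in> U then U else UNIV)" using \<D>(5)[OF KD] by blast
        moreover from this U(2) have "x \<in> U" by blast
        ultimately show ?thesis by simp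
      qed
      have K: "K = {Inf K..Sup K}" "Inf K < Sup K" "- real c - 1 \<le> Inf K" "Sup K \<le> real c + 1" if KD: "K \<in> \<D>" for K
      proof -
        obtain p q where pq: "K = {p..q}" "interior K \<noteq> {}" using \<D>(3)[OF KD] by auto
        then have "p < q" by (simp add: interior_atLeastAtMost_real)
        then have "p \<in> K" "q \<in> K" using pq by auto
        then have "p \<in> cbox (- real c - 1) (real c + 1)" "q \<in> cbox (- real c - 1) (real c + 1)"
          using \<D>(2) KD by blast+
        then show "K = {Inf K..Sup K}" "Inf K < Sup K" "- real c - 1 \<le> Inf K" "Sup K \<le> real c + 1"
          using pq \<open>p < q\<close> by auto
      qed
      have fin: "(\<Sum>K\<in>\<F>. emeasure ?M K) \<le> ennreal \<epsilon>" if \<F>: "finite \<F>" "\<F> \<subseteq> \<D>" for \<F>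
      proof -
        have int: "interior K = {Inf K<..<Sup K}" if "K \<in> \<F>" for K
        proof -
          have "K = {Inf K..Sup K}" using K(1) that \<F>(2) by blast
          then show ?thesis using interior_atLeastAtMost_real[of "Inf K" "Sup K"] by simp
        qed
        have disj: "disjoint_family_on (\<lambda>K. {Inf K<..<Sup K}) \<F>"
          unfolding disjoint_family_on_def
        proof (intro ballI impI)
          fix K L assume "K \<in> \<F>" "L \<in> \<F>" "K \<noteq> L"
          then show "{Inf K<..<Sup K} \<inter> {Inf L<..<Sup L} = {}"
            using pairwiseD[OF \<D>(4), of K L] \<F>(2) int[of K] int[of L] by blast
        qed
        have "(\<Sum>K\<in>\<F>. norm (Q (Sup K) - Q (Inf K))) < \<epsilon>"
        proof (rule \<delta>(2))
          show "interval_family (- real c - 1) (real c + 1) \<F> Inf Sup"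
            unfolding interval_family_def
          proof (intro conjI ballI)
            fix K assume "K \<in> \<F>"
            then have "K \<in> \<D>" using \<F>(2) by blast
            from K(2-4)[OF this] show "- real c - 1 \<le> Inf K" "Inf K \<le> Sup K" "Sup K \<le> real c + 1" by simp_all
          qed (rule \<F>(1) disj)+
          have "ennreal (\<Sum>K\<in>\<F>. Sup K - Inf K) = (\<Sum>K\<in>\<F>. emeasure lborel {Inf K<..<Sup K})"
          proof (subst sum_ennreal[symmetric])
            show "0 \<le> Sup K - Inf K" if "K \<in> \<F>" for K
              using K(2)[of K] that \<F>(2) by (simp add: subset_iff)
            show "(\<Sum>K\<in>\<F>. ennreal (Sup K - Inf K)) = (\<Sum>K\<in>\<F>. emeasure lborel {Inf K<..<Sup K})"
            proof (rule sum.cong[OF refl])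
              fix K assume "K \<in> \<F>"
              then show "ennreal (Sup K - Inf K) = emeasure lborel {Inf K<..<Sup K}"
                using K(2)[of K] \<F>(2) by (simp add: subset_iff)
            qed
          qed
          also have "\<dots> = emeasure lborel (\<Union>K\<in>\<F>. {Inf K<..<Sup K})"
            by (rule sum_emeasure) (use disj \<F> in auto)
          also have "\<dots> \<le> emeasure lborel U"
          proof (rule emeasure_mono)
            show "(\<Union>K\<in>\<F>. {Inf K<..<Sup K}) \<subseteq> U"
              using int interior_subset KU \<F>(2) by blast
          qed (use U in simp)
          also have "\<dots> < ennreal \<delta>" by (rule Um)
          finally show "(\<Sum>K\<in>\<F>. Sup K - Inf K) < \<delta>"
            by (meson ennreal_leI leD not_le_imp_less)
        qed
        then have less: "(\<Sum>K\<in>\<F>. Q (Sup K) - Q (Inf K)) < \<epsilon>"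
          by (rule le_less_trans[rotated]) (rule sum_mono, simp)
        have "(\<Sum>K\<in>\<F>. emeasure ?M K) = (\<Sum>K\<in>\<F>. ennreal (Q (Sup K) - Q (Inf K)))"
        proof (rule sum.cong[OF refl])
          fix K assume "K \<in> \<F>"
          then have "K \<in> \<D>" using \<F> by auto
          then show "emeasure ?M K = ennreal (Q (Sup K) - Q (Inf K))"
            using K(1,2)[of K] Icc[of "Inf K" "Sup K"] by simp
        qed
        also have "\<dots> = ennreal (\<Sum>K\<in>\<F>. Q (Sup K) - Q (Inf K))"
        proof (rule sum_ennreal)
          fix K assume "K \<in> \<F>"
          then have "Inf K \<le> Sup K" using K(2)[of K] \<F> by (simp add: subset_iff)
          then show "0 \<le> Q (Sup K) - Q (Inf K)" using mono by (simp add: mono_def)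
        qed
        also have "\<dots> \<le> ennreal \<epsilon>" using less by (intro ennreal_leI) simp
        finally show ?thesis .
      qed
      have Dset: "K \<in> sets borel" if "K \<in> \<D>" for K using \<D>(3)[OF that] by auto
      show "emeasure ?M S \<le> ennreal \<epsilon>"
      proof (cases "\<D> = {}")
        case True
        then show ?thesis using \<D>(6) by simp
      next
        case False
        \<comment> \<open>Enumerating the covering turns its union into an increasing union of
          finite unions, so the bound for finite subfamilies suffices.\<close>
        define D where "D = from_nat_into \<D>"
        have D: "range D = \<D>" unfolding D_def using False \<D>(1) by (rule range_from_nat_into)
        then have DD: "D k \<in> \<D>" for k by auto
        have "emeasure ?M S \<le> emeasure ?M (\<Union>n. \<Union>k\<le>n. D k)"
        proof (rule emeasure_mono)
          have "(\<Union>n. \<Union>k\<le>n. D k) = \<Union>\<D>" unfolding D[symmetric] by auto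
          then show "S \<subseteq> (\<Union>n. \<Union>k\<le>n. D k)" using \<D>(6) by simp
          show "(\<Union>n. \<Union>k\<le>n. D k) \<in> sets ?M" using Dset[OF DD] by auto
        qed
        also have "\<dots> = (SUP n. emeasure ?M (\<Union>k\<le>n. D k))"
        proof (rule SUP_emeasure_incseq[symmetric])
          show "range (\<lambda>n. \<Union>k\<le>n. D k) \<subseteq> sets ?M" using Dset[OF DD] by auto
          show "incseq (\<lambda>n. \<Union>k\<le>n. D k)" unfolding incseq_def by (intro allI impI UN_mono) auto
        qed
        also have "\<dots> \<le> ennreal \<epsilon>"
        proof (rule SUP_least)
          fix n :: nat
          have "emeasure ?M (\<Union>k\<le>n. D k) = emeasure ?M (\<Union>K\<in>D ` {..n}. K)" by simp
          also have "\<dots> \<le> (\<Sum>K\<in>D ` {..n}. emeasure ?M K)"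
            by (rule emeasure_subadditive_finite) (use Dset[OF DD] in auto)
          also have "\<dots> \<le> ennreal \<epsilon>" by (rule fin) (use DD in auto)
          finally show "emeasure ?M (\<Union>k\<le>n. D k) \<le> ennreal \<epsilon>" .
        qed
        finally show ?thesis .
      qed
    qed
    have "emeasure ?M S \<le> 0"
      by (rule ennreal_le_epsilon) (use le in simp)
    moreover have "emeasure ?M (A \<inter> cbox (- real c) (real c)) \<le> emeasure ?M S"
      by (rule emeasure_mono) (use S in \<open>auto simp: S_def\<close>)
    ultimately show ?thesis by simp
  qed
  have "A = (\<Union>c::nat. A \<inter> cbox (- real c) (real c))"
  proof -
    have "\<exists>c::nat. x \<in> cbox (- real c) (real c)" for x :: real
    proof -
      obtain c :: nat where "\<bar>x\<bar> \<le> real c" using real_arch_simple by blast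
      then have "- real c \<le> x" "x \<le> real c" by linarith+
      then show ?thesis by auto
    qed
    then show ?thesis by blast
  qed
  moreover have "emeasure ?M (\<Union>c::nat. A \<inter> cbox (- real c) (real c)) = 0"
    by (rule emeasure_UN_eq_0) (use bounded_part As in auto)
  ultimately show ?thesis using As by (auto simp: null_sets_def)
qed

text \<open>The density is the Radon-Nikodym derivative of the Stieltjes measure of the clamped
  function with respect to Lebesgue measure.\<close>

lemma mono_abs_cont_density:
  fixes P :: "real \<Rightarrow> real"
  assumes P: "abs_cont_on l r P" and mono: "mono_on {l..r} P" and "l \<le> r"
  shows "\<exists>g. g absolutely_integrable_on {l..r} \<and> (\<forall>t\<in>{l..r}. (g has_integral (P t - P l)) {l..t})"
proof -
  define Q where "Q = (\<lambda>x. P (max l (min r x)))"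
  have Qm: "mono Q"
    unfolding mono_def Q_def
  proof (intro allI impI)
    fix x y :: real assume "x \<le> y"
    then have "max l (min r x) \<le> max l (min r y)" by auto
    then show "P (max l (min r x)) \<le> P (max l (min r y))"
      using mono \<open>l \<le> r\<close> by (auto simp: mono_on_def)
  qed
  have Qac: "abs_cont_on l' r' Q" for l' r'
    unfolding Q_def by (rule abs_cont_on_clamp[OF P \<open>l \<le> r\<close>])
  have Qc: "continuous (at_right a) Q" for a
    using abs_cont_imp_continuous_UNIV[OF Qac]
    by (simp add: continuous_on_eq_continuous_at continuous_at_imp_continuous_within)
  have "absolutely_continuous lborel (interval_measure Q)"
    unfolding absolutely_continuous_def using interval_measure_null_sets[OF Qac Qm] by blast
  then obtain h where h: "h \<in> borel_measurable lborel" "density lborel h = interval_measure Q"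
    using sigma_finite_measure.Radon_Nikodym[OF lborel.sigma_finite_measure_axioms, of "interval_measure Q"] by auto
  define g where "g = (\<lambda>x. enn2real (h x))"
  have gm: "g \<in> borel_measurable borel" using h(1) by (auto simp: g_def)
  have nn: "(\<integral>\<^sup>+x. h x * indicator {l<..t} x \<partial>lborel) = ennreal (P t - P l)" if "t \<in> {l..r}" for t
  proof -
    have "emeasure (density lborel h) {l<..t} = ennreal (Q t - Q l)"
      unfolding h(2) 
      by (rule emeasure_interval_measure_Ioc) (use that Qm in \<open>auto simp: mono_def intro: Qc\<close>)
    moreover have "Q t = P t" "Q l = P l" using that by (auto simp: Q_def)
    moreover have "emeasure (density lborel h) {l<..t} = (\<integral>\<^sup>+x. h x * indicator {l<..t} x \<partial>lborel)"
      using h(1) by (intro emeasure_density) auto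
    ultimately show ?thesis by simp
  qed
  \<comment> \<open>Radon-Nikodym gives a density with values in \<open>ennreal\<close>. Its
    integral over the interval is finite, so it is finite almost everywhere there and
    \<open>enn2real\<close> loses nothing.\<close>
  have "AE x in lborel. h x * indicator {l<..r} x \<noteq> \<infinity>"
    by (rule nn_integral_noteq_infinite) (use h(1) nn[of r] \<open>l \<le> r\<close> in auto)
  then have fin: "AE x in lborel. x \<in> {l<..r} \<longrightarrow> h x = ennreal (g x)"
    by eventually_elim (auto simp: g_def less_top)
  have int: "(g has_integral (P t - P l)) {l..t}" if t: "t \<in> {l..r}" for t
  proof -
    have "((\<lambda>x. g x * indicator {l<..t} x) has_integral (P t - P l)) UNIV"
    proof (rule nn_integral_has_integral)
      show "(\<lambda>x. g x * indicator {l<..t} x) \<in> borel_measurable borel" using gm by simp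
      show "0 \<le> g x * indicator {l<..t} x" for x by (simp add: g_def)
      show "0 \<le> P t - P l" using mono t \<open>l \<le> r\<close> by (auto simp: mono_on_def)
      have "(\<integral>\<^sup>+x. ennreal (g x * indicator {l<..t} x) \<partial>lborel) = (\<integral>\<^sup>+x. h x * indicator {l<..t} x \<partial>lborel)"
      proof (rule nn_integral_cong_AE)
        show "AE x in lborel. ennreal (g x * indicator {l<..t} x) = h x * indicator {l<..t} x"
          using fin by eventually_elim (use t in \<open>auto simp: indicator_def\<close>)
      qed
      then show "(\<integral>\<^sup>+x. ennreal (g x * indicator {l<..t} x) \<partial>lborel) = ennreal (P t - P l)"
        using nn[OF t] by simp
    qed
    moreover have "(\<lambda>x. g x * indicator {l<..t} x) = (\<lambda>x. if x \<in> {l<..t} then g x else 0)"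
      by (auto simp: indicator_def)
    ultimately have "(g has_integral (P t - P l)) {l<..t}"
      by (simp only: has_integral_restrict_UNIV)
    then show ?thesis
      by (subst has_integral_spike_set_eq[of _ "{l<..t}"]) (auto intro: negligible_subset[of "{l}"])
  qed
  have "g absolutely_integrable_on {l..r}"
    by (rule nonnegative_absolutely_integrable_1) (use int[of r] \<open>l \<le> r\<close> in \<open>auto simp: g_def integrable_on_def\<close>)
  then show ?thesis using int by blast
qed

lemma AE_lborel_iff_negligible: "(AE x in lborel. P x) \<longleftrightarrow> negligible {x. \<not> P x}"
  for P :: "'a::euclidean_space \<Rightarrow> bool"
proof -
  have "(AE x in lborel. P x) \<longleftrightarrow> (AE x in lebesgue. P x)" by (simp add: AE_completion_iff)
  also have "\<dots> \<longleftrightarrow> negligible {x. \<not> P x}"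
    unfolding negligible_iff_null_sets by (subst completion.AE_iff_null_sets) simp
  finally show ?thesis .
qed

lemma integral_interval_diff:
  fixes g :: "real \<Rightarrow> 'a::banach"
  assumes "g integrable_on {l..r}" "l \<le> a" "a \<le> b" "b \<le> r"
  shows "integral {l..b} g - integral {l..a} g = integral {a..b} g"
proof -
  have "g integrable_on {l..b}" by (rule integrable_on_subinterval[OF assms(1)]) (use assms in auto)
  then show ?thesis
    using Henstock_Kurzweil_Integration.integral_combine[of l a b g] assms by (simp add: algebra_simps)
qed

text \<open>\<open>integrable_ccontinuous_explicit\<close> yields convergence of the averages over
  \<open>[x, x + h]\<close>, that is, the derivative from the right. Applied to the reflected
  function it yields the derivative from the left; both exceptional sets are null.\<close>

lemma indefinite_integral_has_vector_derivative_AE: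
  fixes g :: "real \<Rightarrow> 'a::euclidean_space"
  assumes g: "g integrable_on {l..r}"
  shows "AE t in lborel. t \<in> {l<..<r} \<longrightarrow> ((\<lambda>x. integral {l..x} g) has_vector_derivative g t) (at t)"
proof -
  \<comment> \<open>Extension by zero, because the differentiation theorem asks for integrability on
    every box.\<close>
  define f where "f x = (if x \<in> {l..r} then g x else 0)" for x
  have "f integrable_on UNIV" using g unfolding f_def by (simp only: integrable_restrict_UNIV)
  then have f: "f integrable_on {a..b}" for a b by (rule integrable_on_subinterval) simp
  have f': "(\<lambda>x. f (- x)) integrable_on {a..b}" for a b
    using f[of "-b" "-a"] Henstock_Kurzweil_Integration.integrable_reflect_real[where f = f and a = "-b" and b = "-a"] by simp
  obtain N1 where N1: "negligible N1"
    "\<And>x e. \<lbrakk>x \<notin> N1; 0 < e\<rbrakk> \<Longrightarrow> \<exists>d>0. \<forall>h. 0 < h \<and> h < d \<longrightarrow>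
       norm (integral (cbox x (x + h *\<^sub>R One)) f /\<^sub>R h ^ DIM(real) - f x) < e"
    by (rule integrable_ccontinuous_explicit[of f]) (simp add: f, rule that)
  obtain N2 where N2: "negligible N2"
    "\<And>x e. \<lbrakk>x \<notin> N2; 0 < e\<rbrakk> \<Longrightarrow> \<exists>d>0. \<forall>h. 0 < h \<and> h < d \<longrightarrow>
       norm (integral (cbox x (x + h *\<^sub>R One)) (\<lambda>x. f (- x)) /\<^sub>R h ^ DIM(real) - f (- x)) < e"
    by (rule integrable_ccontinuous_explicit[of "\<lambda>x. f (- x)"]) (simp add: f', rule that)
  have *: "((\<lambda>x. integral {l..x} g) has_vector_derivative g t) (at t)"
    if t: "t \<in> {l<..<r}" "t \<notin> N1" "- t \<notin> N2" for t
    unfolding has_vector_derivative_def has_derivative_at'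
  proof (intro conjI allI impI)
    show "bounded_linear (\<lambda>x. x *\<^sub>R g t)" by (rule bounded_linear_scaleR_left)
    fix e :: real assume e: "e > 0"
    obtain d1 where d1: "d1 > 0" "\<And>h. 0 < h \<Longrightarrow> h < d1 \<Longrightarrow> norm (integral {t..t + h} f /\<^sub>R h - f t) < e"
      using N1(2)[OF t(2) e] by auto
    obtain d2 where d2: "d2 > 0" "\<And>h. 0 < h \<Longrightarrow> h < d2 \<Longrightarrow> norm (integral {- t..- t + h} (\<lambda>x. f (- x)) /\<^sub>R h - f t) < e"
      using N2(2)[OF t(3) e] by auto
    have ft: "f t = g t" using t by (simp add: f_def)
    have fg: "integral {a..b} f = integral {l..b} g - integral {l..a} g" if "l \<le> a" "a \<le> b" "b \<le> r" for a b
    proof -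
      have "integral {a..b} f = integral {a..b} g"
        by (rule integral_cong) (use that in \<open>auto simp: f_def\<close>)
      then show ?thesis using integral_interval_diff[OF g that] by simp
    qed
    \<comment> \<open>Besides the two one-sided tolerances, \<open>d\<close> keeps all points within
      \<open>{l..r}\<close>, where \<open>f\<close> agrees with \<open>g\<close>.\<close>
    define d where "d = Min {d1, d2, t - l, r - t}"
    have d: "d > 0" "d \<le> d1" "d \<le> d2" "d \<le> t - l" "d \<le> r - t" using d1(1) d2(1) t(1) by (auto simp: d_def)
    show "\<exists>d>0. \<forall>x'. 0 < norm (x' - t) \<and> norm (x' - t) < d \<longrightarrow>
        norm (integral {l..x'} g - integral {l..t} g - (x' - t) *\<^sub>R g t) / norm (x' - t) < e"
    proof (intro exI[of _ d] conjI allI impI d(1))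
      fix x' assume x': "0 < norm (x' - t) \<and> norm (x' - t) < d"
      have quot: "norm (A - h *\<^sub>R g t) / h = norm (A /\<^sub>R h - f t)" if "h > 0" for A h
      proof -
        have "A /\<^sub>R h - f t = (A - h *\<^sub>R g t) /\<^sub>R h" using that by (simp add: ft scaleR_diff_right)
        then show ?thesis using that by (simp add: divide_inverse mult.commute)
      qed
      show "norm (integral {l..x'} g - integral {l..t} g - (x' - t) *\<^sub>R g t) / norm (x' - t) < e"
      proof (cases "t < x'")
        case True
        have "norm (integral {t..t + (x' - t)} f /\<^sub>R (x' - t) - f t) < e"
          by (rule d1(2)) (use True x' d in auto)
        moreover have "integral {t..t + (x' - t)} f = integral {l..x'} g - integral {l..t} g"
          using fg[of t x'] True x' d t by auto
        ultimately show ?thesis using quot[of "x' - t" "integral {l..x'} g - integral {l..t} g"] True by simp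
      next
        case False
        then have "x' < t" using x' by auto
        have "norm (integral {- t..- t + (t - x')} (\<lambda>x. f (- x)) /\<^sub>R (t - x') - f t) < e"
          by (rule d2(2)) (use \<open>x' < t\<close> x' d in auto)
        moreover have "integral {- t..- t + (t - x')} (\<lambda>x. f (- x)) = integral {l..t} g - integral {l..x'} g"
          using fg[of x' t] Henstock_Kurzweil_Integration.integral_reflect_real[where f = f and a = x' and b = t] \<open>x' < t\<close> x' d t by simp
        ultimately have "norm (integral {l..t} g - integral {l..x'} g - (t - x') *\<^sub>R g t) / (t - x') < e"
          using quot[of "t - x'" "integral {l..t} g - integral {l..x'} g"] \<open>x' < t\<close> by simp
        moreover have "integral {l..x'} g - integral {l..t} g - (x' - t) *\<^sub>R g t =
            - (integral {l..t} g - integral {l..x'} g - (t - x') *\<^sub>R g t)"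
          by (simp add: algebra_simps)
        ultimately show ?thesis using \<open>x' < t\<close> by (simp only: norm_minus_cancel) simp
      qed
    qed
  qed
  have neg: "negligible (N1 \<union> uminus ` N2)"
    by (intro negligible_Un N1(1) negligible_differentiable_image_negligible[OF order_refl N2(1)])
      (simp add: differentiable_on_minus)
  have "{t. \<not> (t \<in> {l<..<r} \<longrightarrow> ((\<lambda>x. integral {l..x} g) has_vector_derivative g t) (at t))} \<subseteq> N1 \<union> uminus ` N2"
  proof (rule subsetI, rule ccontr)
    fix t assume "t \<in> {t. \<not> (t \<in> {l<..<r} \<longrightarrow> ((\<lambda>x. integral {l..x} g) has_vector_derivative g t) (at t))}"
      and nt: "t \<notin> N1 \<union> uminus ` N2"
    moreover have "- t \<notin> N2"
    proof
      assume "- t \<in> N2"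
      then have "- (- t) \<in> uminus ` N2" by (rule imageI)
      then show False using nt by simp
    qed
    ultimately show False using * by blast
  qed
  then show ?thesis unfolding AE_lborel_iff_negligible using neg negligible_subset by blast
qed

text \<open>\<open>F\<close> is the difference of its positive variation and of that variation minus
  \<open>F\<close>, both increasing and absolutely continuous; the densities subtract.\<close>

lemma abs_cont_density_real:
  fixes F :: "real \<Rightarrow> real"
  assumes F: "abs_cont_on l r F" and "l \<le> r"
  shows "\<exists>g. g absolutely_integrable_on {l..r} \<and> (\<forall>t\<in>{l..r}. (g has_integral (F t - F l)) {l..t})"
proof -
  let ?P = "pos_variation F l"
  have P: "abs_cont_on l r ?P" by (rule abs_cont_on_pos_variation[OF F])
  have "mono_on {l..r} ?P"
    using pos_variation_mono[OF F] by (auto simp: mono_on_def)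
  then obtain g where g: "g absolutely_integrable_on {l..r}" "\<And>t. t \<in> {l..r} \<Longrightarrow> (g has_integral (?P t - ?P l)) {l..t}"
    using mono_abs_cont_density[OF P _ \<open>l \<le> r\<close>] by blast
  have "mono_on {l..r} (\<lambda>x. ?P x - F x)"
    unfolding mono_on_def
  proof (intro allI impI)
    fix x y assume "x \<in> {l..r} \<and> y \<in> {l..r} \<and> x \<le> y"
    then show "?P x - F x \<le> ?P y - F y" using pos_variation_increment[OF F, of x y] by simp
  qed
  then obtain h where h: "h absolutely_integrable_on {l..r}"
    "\<And>t. t \<in> {l..r} \<Longrightarrow> (h has_integral ((?P t - F t) - (?P l - F l))) {l..t}"
    using mono_abs_cont_density[OF abs_cont_on_diff[OF P F] _ \<open>l \<le> r\<close>] by blast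
  have "(\<lambda>x. g x - h x) absolutely_integrable_on {l..r}"
    using g(1) h(1) by (rule set_integral_diff(1))
  moreover have "((\<lambda>x. g x - h x) has_integral (F t - F l)) {l..t}" if "t \<in> {l..r}" for t
    using has_integral_diff[OF g(2)[OF that] h(2)[OF that]] by simp
  ultimately show ?thesis by blast
qed

lemma abs_cont_density:
  fixes F :: "real \<Rightarrow> complex"
  assumes F: "abs_cont_on l r F" and "l \<le> r"
  shows "\<exists>g. g absolutely_integrable_on {l..r} \<and> (\<forall>t\<in>{l..r}. (g has_integral (F t - F l)) {l..t}) \<and>
    (AE t in lborel. t \<in> {l<..<r} \<longrightarrow> (F has_vector_derivative g t) (at t))"
proof -
  have "abs_cont_on l r (\<lambda>x. Re (F x))" "abs_cont_on l r (\<lambda>x. Im (F x))"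
    using F by (auto intro: abs_cont_on_bounded_linear bounded_linear_Re bounded_linear_Im)
  then obtain u v where u: "u absolutely_integrable_on {l..r}" "\<And>t. t \<in> {l..r} \<Longrightarrow> (u has_integral (Re (F t) - Re (F l))) {l..t}"
    and v: "v absolutely_integrable_on {l..r}" "\<And>t. t \<in> {l..r} \<Longrightarrow> (v has_integral (Im (F t) - Im (F l))) {l..t}"
    using abs_cont_density_real[OF _ \<open>l \<le> r\<close>] by metis
  have bl: "bounded_linear (\<lambda>x::real. \<i> * complex_of_real x)"
    by (rule bounded_linear_compose[OF bounded_linear_mult_right bounded_linear_of_real])
  define g where "g x = complex_of_real (u x) + \<i> * complex_of_real (v x)" for x
  have ai: "g absolutely_integrable_on {l..r}"
    unfolding g_def
    using set_integral_add(1)[OF absolutely_integrable_linear[OF u(1) bounded_linear_of_real]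
      absolutely_integrable_linear[OF v(1) bl]] by (simp add: o_def)
  have int: "(g has_integral (F t - F l)) {l..t}" if t: "t \<in> {l..r}" for t
  proof -
    have "F t - F l = complex_of_real (Re (F t) - Re (F l)) + \<i> * complex_of_real (Im (F t) - Im (F l))"
      by (simp add: complex_eq_iff)
    then show ?thesis
      unfolding g_def
      using has_integral_add[OF has_integral_linear[OF u(2)[OF t] bounded_linear_of_real]
        has_integral_linear[OF v(2)[OF t] bl]] by (simp add: o_def)
  qed
  have "AE t in lborel. t \<in> {l<..<r} \<longrightarrow> ((\<lambda>x. integral {l..x} g) has_vector_derivative g t) (at t)"
    using ai by (intro indefinite_integral_has_vector_derivative_AE) (simp add: absolutely_integrable_on_def)
  then have "AE t in lborel. t \<in> {l<..<r} \<longrightarrow> (F has_vector_derivative g t) (at t)"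
  proof eventually_elim
    case (elim t)
    show ?case
    proof
      assume t: "t \<in> {l<..<r}"
      have "((\<lambda>x. integral {l..x} g + F l) has_vector_derivative g t) (at t)"
        using elim t by (auto intro!: derivative_eq_intros)
      then show "(F has_vector_derivative g t) (at t)"
      proof (rule has_vector_derivative_transform_within_open[OF _ open_greaterThanLessThan t])
        fix x assume "x \<in> {l<..<r}"
        then show "integral {l..x} g + F l = F x"
          using integral_unique[OF int[of x]] by simp
      qed
    qed
  qed
  then show ?thesis using ai int by blast
qed

text \<open>Derivatives are unique, so any pointwise derivative agrees almost everywhere with the
  Radon-Nikodym density. Integrability and measurability of \<open>g\<close> are thus conclusions,
  as fits a derivative defined by a description operator.\<close>

theorem abs_cont_fundamental_theorem:
  fixes F :: "real \<Rightarrow> complex"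
  assumes F: "abs_cont_on l r F" and "l \<le> r"
    and g: "AE t in lborel. t \<in> {l<..<r} \<longrightarrow> (F has_vector_derivative g t) (at t)"
  shows "g absolutely_integrable_on {l..r}"
    and "\<And>t. t \<in> {l..r} \<Longrightarrow> (g has_integral (F t - F l)) {l..t}"
proof -
  obtain h where h: "h absolutely_integrable_on {l..r}" "\<And>t. t \<in> {l..r} \<Longrightarrow> (h has_integral (F t - F l)) {l..t}"
    "AE t in lborel. t \<in> {l<..<r} \<longrightarrow> (F has_vector_derivative h t) (at t)"
    using abs_cont_density[OF F \<open>l \<le> r\<close>] by blast
  have "AE t in lborel. t \<in> {l<..<r} \<longrightarrow> g t = h t"
    using g h(3) by eventually_elim (use vector_derivative_unique_at in blast)
  then have "negligible {t. \<not> (t \<in> {l<..<r} \<longrightarrow> g t = h t)}" by (simp add: AE_lborel_iff_negligible)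
  then have neg: "negligible ({t. \<not> (t \<in> {l<..<r} \<longrightarrow> g t = h t)} \<union> {l, r})"
    by (intro negligible_Un) auto
  show "g absolutely_integrable_on {l..r}"
    by (rule absolutely_integrable_spike[OF h(1) neg]) force
  show "(g has_integral (F t - F l)) {l..t}" if "t \<in> {l..r}" for t
    by (rule has_integral_spike[OF neg _ h(2)[OF that]]) (use that in force)
qed

lemma abs_cont_differentiable_AE:
  fixes F :: "real \<Rightarrow> complex"
  assumes F: "abs_cont_on l r F" and "l \<le> r"
  shows "AE t in lborel. t \<in> {l<..<r} \<longrightarrow> (\<exists>d. (F has_vector_derivative d) (at t))"
proof -
  obtain h where "AE t in lborel. t \<in> {l<..<r} \<longrightarrow> (F has_vector_derivative h t) (at t)"
    using abs_cont_density[OF F \<open>l \<le> r\<close>] by blast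
  then show ?thesis by eventually_elim blast
qed

text \<open>AM-GM in place of Cauchy-Schwarz: the parameter \<open>K\<close> is chosen large to make the last term small.\<close>

lemma integral_norm_le_AM_GM:
  fixes g :: "real \<Rightarrow> 'a::euclidean_space"
  assumes g: "g absolutely_integrable_on {a..b}" and g2: "(\<lambda>t. (norm (g t))\<^sup>2) integrable_on {a..b}"
    and "K > 0" "a \<le> b"
  shows "integral {a..b} (\<lambda>t. norm (g t)) \<le> (K * (b - a) + integral {a..b} (\<lambda>t. (norm (g t))\<^sup>2) / K) / 2"
proof -
  have "((\<lambda>t. (norm (g t))\<^sup>2) has_integral integral {a..b} (\<lambda>t. (norm (g t))\<^sup>2)) {a..b}"
    using g2 by blast
  then have "((\<lambda>t. (norm (g t))\<^sup>2 / (2 * K)) has_integral integral {a..b} (\<lambda>t. (norm (g t))\<^sup>2) / (2 * K)) {a..b}"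
    by (rule has_integral_divide)
  moreover have "((\<lambda>t. K / 2) has_integral K / 2 * (b - a)) {a..b}"
    using has_integral_const_real[of "K / 2" a b] \<open>a \<le> b\<close> by (simp add: mult.commute)
  ultimately have h: "((\<lambda>t. K / 2 + (norm (g t))\<^sup>2 / (2 * K)) has_integral
      K / 2 * (b - a) + integral {a..b} (\<lambda>t. (norm (g t))\<^sup>2) / (2 * K)) {a..b}"
    by (rule has_integral_add[rotated])
  have i: "(\<lambda>t. norm (g t)) integrable_on {a..b}" using g by (simp add: absolutely_integrable_on_def)
  have "x \<le> K / 2 + x\<^sup>2 / (2 * K)" for x
  proof -
    have "0 \<le> (x - K)\<^sup>2" by simp
    then show ?thesis using \<open>K > 0\<close> by (simp add: field_simps power2_eq_square)
  qed
  then have "integral {a..b} (\<lambda>t. norm (g t)) \<le> K / 2 * (b - a) + integral {a..b} (\<lambda>t. (norm (g t))\<^sup>2) / (2 * K)"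
    by (rule has_integral_le[OF integrable_integral[OF i] h])
  then show ?thesis by (simp add: add_divide_distrib)
qed

text \<open>The AM-GM bound is used with the same \<open>K\<close> on all intervals: the first terms
  add up to \<open>K / 2\<close> times the total length, and the second ones telescope at most to
  the full square integral divided by \<open>2 * K\<close>.\<close>

lemma abs_cont_on_indefinite_integral:
  fixes g :: "real \<Rightarrow> 'a::euclidean_space"
  assumes g: "g absolutely_integrable_on {l..r}" and g2: "(\<lambda>t. (norm (g t))\<^sup>2) integrable_on {l..r}"
    and "l \<le> r"
  shows "abs_cont_on l r (\<lambda>t. integral {l..t} g)"
proof (rule abs_cont_onI)
  fix \<epsilon> :: real assume \<epsilon>: "\<epsilon> > 0"
  define S where "S t = integral {l..t} (\<lambda>t. (norm (g t))\<^sup>2)" for t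
  have Sm: "mono_on {l..r} S"
    unfolding mono_on_def S_def
  proof (intro allI impI)
    fix x y assume xy: "x \<in> {l..r} \<and> y \<in> {l..r} \<and> x \<le> y"
    show "integral {l..x} (\<lambda>t. (norm (g t))\<^sup>2) \<le> integral {l..y} (\<lambda>t. (norm (g t))\<^sup>2)"
      by (rule integral_subset_le) (use xy g2 in \<open>auto intro: integrable_on_subinterval\<close>)
  qed
  have S0: "S l = 0" by (simp add: S_def)
  have Sr: "S r \<ge> 0" using Sm S0 \<open>l \<le> r\<close> by (force simp: mono_on_def)
  \<comment> \<open>With this \<open>K\<close> the square-integral part is at most
    \<open>\<epsilon> / 2\<close>, and a total length below \<open>\<epsilon> / K\<close> makes the
    other part less than \<open>\<epsilon> / 2\<close>.\<close>
  define K where "K = (S r + 1) / \<epsilon>"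
  have K: "K > 0" "S r / K \<le> \<epsilon>" using Sr \<epsilon> by (auto simp: K_def field_simps)
  show "\<exists>\<delta>>0. \<forall>(N::nat) a b. interval_family l r {..<N} a b \<longrightarrow>
    (\<Sum>i<N. b i - a i) < \<delta> \<longrightarrow> (\<Sum>i<N. norm (integral {l..b i} g - integral {l..a i} g)) < \<epsilon>"
  proof (intro exI[of _ "\<epsilon> / K"] conjI allI impI)
    show "\<epsilon> / K > 0" using K \<epsilon> by simp
    fix N :: nat and a b
    assume fam: "interval_family l r {..<N} a b" and len: "(\<Sum>i<N. b i - a i) < \<epsilon> / K"
    have "(\<Sum>i<N. norm (integral {l..b i} g - integral {l..a i} g)) \<le>
        (\<Sum>i<N. (K / 2) * (b i - a i) + (1 / (2 * K)) * (S (b i) - S (a i)))"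
    proof (rule sum_mono)
      fix i assume "i \<in> {..<N}"
      then have i: "l \<le> a i" "a i \<le> b i" "b i \<le> r" using fam by (auto simp: interval_family_def)
      have gi: "g absolutely_integrable_on {a i..b i}"
        by (rule absolutely_integrable_on_subinterval[OF g]) (use i in auto)
      have g2i: "(\<lambda>t. (norm (g t))\<^sup>2) integrable_on {a i..b i}"
        by (rule integrable_on_subinterval[OF g2]) (use i in auto)
      have "norm (integral {l..b i} g - integral {l..a i} g) = norm (integral {a i..b i} g)"
        using integral_interval_diff[of g l r "a i" "b i"] g i by (simp add: absolutely_integrable_on_def)
      also have "\<dots> \<le> integral {a i..b i} (\<lambda>t. norm (g t))"
        by (rule integral_norm_bound_integral) (use gi in \<open>auto simp: absolutely_integrable_on_def\<close>)
      also have "\<dots> \<le> (K * (b i - a i) + integral {a i..b i} (\<lambda>t. (norm (g t))\<^sup>2) / K) / 2"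
        by (rule integral_norm_le_AM_GM[OF gi g2i K(1) i(2)])
      also have "integral {a i..b i} (\<lambda>t. (norm (g t))\<^sup>2) = S (b i) - S (a i)"
        unfolding S_def using integral_interval_diff[OF g2 i] by simp
      finally show "norm (integral {l..b i} g - integral {l..a i} g) \<le>
          (K / 2) * (b i - a i) + (1 / (2 * K)) * (S (b i) - S (a i))"
        by (simp add: add_divide_distrib)
    qed
    also have "\<dots> = (K / 2) * (\<Sum>i<N. b i - a i) + (1 / (2 * K)) * (\<Sum>i<N. S (b i) - S (a i))"
      by (simp add: sum.distrib sum_distrib_left)
    also have "\<dots> < (K / 2) * (\<epsilon> / K) + (1 / (2 * K)) * S r"
    proof (rule add_less_le_mono)
      show "(K / 2) * (\<Sum>i<N. b i - a i) < (K / 2) * (\<epsilon> / K)"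
        using len K(1) by (intro mult_strict_left_mono) auto
      show "(1 / (2 * K)) * (\<Sum>i<N. S (b i) - S (a i)) \<le> (1 / (2 * K)) * S r"
        using interval_family_mono_sum_le[OF fam Sm \<open>l \<le> r\<close>] S0 K(1) by (intro mult_left_mono) auto
    qed
    also have "\<dots> = \<epsilon> / 2 + (S r / K) / 2" using K(1) by (simp add: field_simps)
    also have "\<dots> \<le> \<epsilon>" using K(2) by simp
    finally show "(\<Sum>i<N. norm (integral {l..b i} g - integral {l..a i} g)) < \<epsilon>" .
  qed
qed

section \<open>The measure on the circle\<close>

abbreviation circle_borel :: "complex measure" where
  "circle_borel \<equiv> restrict_space borel circle"

lemma cis_Arg2pi: "z \<in> circle \<Longrightarrow> cis (Arg2pi z) = z"
  using complex_norm_eq_1_exp[of z] by (simp add: cis_conv_exp)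

lemma Arg2pi_bounds: "0 \<le> Arg2pi z" "Arg2pi z < 2 * pi"
  using Arg2pi[of z] by auto

lemma Arg2pi_cis: "0 \<le> \<theta> \<Longrightarrow> \<theta> < 2 * pi \<Longrightarrow> Arg2pi (cis \<theta>) = \<theta>"
  using Arg2pi_unique[of 1 \<theta> "cis \<theta>"] by (simp add: cis_conv_exp)

lemma borel_measurable_Arg2pi: "Arg2pi \<in> borel_measurable borel"
proof (rule borel_measurableI_le)
  show "{x \<in> space borel. Arg2pi x \<le> y} \<in> sets borel" for y
    using closed_Arg2pi2pi_le[of y] by simp
qed

lemma measurable_cis_circle: "(\<lambda>t. cis (2 * pi * t)) \<in> borel \<rightarrow>\<^sub>M circle_borel"
  by (intro measurable_restrict_space2 borel_measurable_continuous_onI continuous_intros) auto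

lemma uniform_measure_01: "uniform_measure lborel {0..<1::real} = density lborel (\<lambda>t. ennreal (indicator {0..<1} t))"
  unfolding uniform_measure_def by (simp add: ennreal_indicator divide_ennreal_def)

lemma two_pi_mult_mem_iff: "2 * pi * t \<in> {0..<2 * pi} \<longleftrightarrow> t \<in> {0..<1}"
proof -
  have "0 \<le> 2 * pi * t \<longleftrightarrow> 0 \<le> t" "2 * pi * t < 2 * pi * 1 \<longleftrightarrow> t < 1"
    by (simp_all add: zero_le_mult_iff pi_gt_zero[folded not_le])
  then show ?thesis by simp
qed

lemma AE_mult_iff:
  fixes c :: real
  assumes "c \<noteq> 0"
  shows "(AE t in lborel. P (c * t)) \<longleftrightarrow> (AE t in lborel. P t)"
proof -
  have *: "AE t in lborel. P (c * t)" if "AE t in lborel. P t" "c \<noteq> 0" for P and c :: real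
  proof -
    have "negligible ((\<lambda>t. t / c) ` {t. \<not> P t})"
      by (rule negligible_differentiable_image_negligible)
        (use that(1) in \<open>auto simp: AE_lborel_iff_negligible
          intro: linear_imp_differentiable_on bounded_linear.linear bounded_linear_divide\<close>)
    then show ?thesis
      unfolding AE_lborel_iff_negligible
      by (rule negligible_subset) (use that(2) in \<open>force simp: image_iff\<close>)
  qed
  show ?thesis
  proof
    show "AE t in lborel. P t" if "AE t in lborel. P (c * t)"
      using *[OF that, of "1 / c"] assms by simp
  qed (rule *[OF _ assms])
qed

text \<open>\<open>P\<close> need not be measurable, so the rule for image measures cannot be
  applied to it from right to left. Its exceptional set of angles is enclosed in a measurable null
  set, which the measurable function \<open>Arg2pi\<close> pulls back to the circle.\<close>

lemma AE_circle_measure_iff: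
  "(AE z in circle_measure. P z) \<longleftrightarrow> (AE \<theta> in lborel. \<theta> \<in> {0<..<2 * pi} \<longrightarrow> P (cis \<theta>))"
proof -
  let ?U = "uniform_measure lborel {0..<1::real}"
  let ?m = "distr ?U circle_borel (\<lambda>t. cis (2 * pi * t))"
  have X: "(\<lambda>t. cis (2 * pi * t)) \<in> ?U \<rightarrow>\<^sub>M circle_borel"
    using measurable_cis_circle by (simp cong: measurable_cong_sets)
  have U: "(AE t in ?U. Q (2 * pi * t)) \<longleftrightarrow> (AE \<theta> in lborel. \<theta> \<in> {0..<2 * pi} \<longrightarrow> Q \<theta>)" for Q
  proof -
    have "(AE t in ?U. Q (2 * pi * t)) \<longleftrightarrow> (AE t in lborel. t \<in> {0..<1} \<longrightarrow> Q (2 * pi * t))"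
      by (rule AE_uniform_measure) auto
    also have "\<dots> \<longleftrightarrow> (AE t in lborel. 2 * pi * t \<in> {0..<2 * pi} \<longrightarrow> Q (2 * pi * t))"
      by (simp only: two_pi_mult_mem_iff)
    also have "\<dots> \<longleftrightarrow> (AE \<theta> in lborel. \<theta> \<in> {0..<2 * pi} \<longrightarrow> Q \<theta>)"
      by (rule AE_mult_iff[of "2 * pi" "\<lambda>\<theta>. \<theta> \<in> {0..<2 * pi} \<longrightarrow> Q \<theta>"]) simp
    finally show ?thesis .
  qed
  have open_closed: "(AE \<theta> in lborel. \<theta> \<in> {0..<2 * pi} \<longrightarrow> Q \<theta>) \<longleftrightarrow> (AE \<theta> in lborel. \<theta> \<in> {0<..<2 * pi} \<longrightarrow> Q \<theta>)" for Q
  proof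
    assume "AE \<theta> in lborel. \<theta> \<in> {0<..<2 * pi} \<longrightarrow> Q \<theta>"
    moreover have "AE \<theta> in lborel. \<theta> \<noteq> (0::real)" by (rule AE_lborel_singleton)
    ultimately show "AE \<theta> in lborel. \<theta> \<in> {0..<2 * pi} \<longrightarrow> Q \<theta>" by eventually_elim auto
  next
    assume "AE \<theta> in lborel. \<theta> \<in> {0..<2 * pi} \<longrightarrow> Q \<theta>"
    then show "AE \<theta> in lborel. \<theta> \<in> {0<..<2 * pi} \<longrightarrow> Q \<theta>" by eventually_elim auto
  qed
  have "(AE z in circle_measure. P z) \<longleftrightarrow> (AE z in ?m. P z)"
    unfolding circle_measure_def by (rule AE_completion_iff)
  also have "\<dots> \<longleftrightarrow> (AE \<theta> in lborel. \<theta> \<in> {0..<2 * pi} \<longrightarrow> P (cis \<theta>))"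
  proof
    assume "AE z in ?m. P z"
    then have "AE t in ?U. P (cis (2 * pi * t))" by (rule AE_distrD[OF X])
    then show "AE \<theta> in lborel. \<theta> \<in> {0..<2 * pi} \<longrightarrow> P (cis \<theta>)"
      by (rule U[of "\<lambda>\<theta>. P (cis \<theta>)", THEN iffD1])
  next
    assume "AE \<theta> in lborel. \<theta> \<in> {0..<2 * pi} \<longrightarrow> P (cis \<theta>)"
    \<comment> \<open>From here on the statement concerns the measurable set \<open>N\<close>
      instead of \<open>P\<close>.\<close>
    then obtain N where N: "{\<theta> \<in> space lborel. \<not> (\<theta> \<in> {0..<2 * pi} \<longrightarrow> P (cis \<theta>))} \<subseteq> N"
      "emeasure lborel N = 0" "N \<in> sets lborel" by (rule AE_E)
    have "AE z in ?m. Arg2pi z \<notin> N"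
    proof (subst AE_distr_iff[OF X])
      have "Arg2pi \<in> borel_measurable circle_borel"
        by (rule measurable_restrict_space1[OF borel_measurable_Arg2pi])
      then have "Arg2pi -` (- N) \<inter> space circle_borel \<in> sets circle_borel"
        by (rule measurable_sets) (use N(3) in auto)
      moreover have "{z \<in> space circle_borel. Arg2pi z \<notin> N} = Arg2pi -` (- N) \<inter> space circle_borel"
        by blast
      ultimately show "{z \<in> space circle_borel. Arg2pi z \<notin> N} \<in> sets circle_borel" by simp
      have "AE \<theta> in lborel. \<theta> \<notin> N" using N(2,3) by (intro AE_not_in) auto
      then have "AE \<theta> in lborel. \<theta> \<in> {0..<2 * pi} \<longrightarrow> Arg2pi (cis \<theta>) \<notin> N"
        by eventually_elim (auto simp: Arg2pi_cis)
      then show "AE t in ?U. Arg2pi (cis (2 * pi * t)) \<notin> N"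
        by (rule U[of "\<lambda>\<theta>. Arg2pi (cis \<theta>) \<notin> N", THEN iffD2])
    qed
    moreover have "AE z in ?m. z \<in> space ?m" by (rule AE_space)
    ultimately show "AE z in ?m. P z"
    proof eventually_elim
      case (elim z)
      then have z: "cis (Arg2pi z) = z" by (intro cis_Arg2pi) (simp add: space_restrict_space)
      have "Arg2pi z \<in> {0..<2 * pi} \<longrightarrow> P (cis (Arg2pi z))" using elim(1) N(1) by auto
      then show "P z" using z Arg2pi_bounds[of z] by simp
    qed
  qed
  also have "\<dots> \<longleftrightarrow> (AE \<theta> in lborel. \<theta> \<in> {0<..<2 * pi} \<longrightarrow> P (cis \<theta>))" by (rule open_closed)
  finally show ?thesis .
qed

lemma space_circle_measure [simp]: "space circle_measure = circle"
  by (simp add: circle_measure_def space_restrict_space)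

lemma AE_circle_space: "AE z in circle_measure. z \<in> circle"
  using AE_space[of circle_measure] by simp

lemma AE_circle_measureE:
  assumes "AE z in circle_measure. P z"
  obtains N where "negligible N" "\<And>\<theta>. \<theta> \<in> {0..2 * pi} - N \<Longrightarrow> P (cis \<theta>)"
proof
  have "negligible {\<theta>. \<not> (\<theta> \<in> {0<..<2 * pi} \<longrightarrow> P (cis \<theta>))}"
    using assms by (simp add: AE_circle_measure_iff AE_lborel_iff_negligible)
  then show "negligible ({\<theta>. \<not> (\<theta> \<in> {0<..<2 * pi} \<longrightarrow> P (cis \<theta>))} \<union> {0, 2 * pi})"
    by (intro negligible_Un) auto
  show "P (cis \<theta>)" if "\<theta> \<in> {0..2 * pi} - ({\<theta>. \<not> (\<theta> \<in> {0<..<2 * pi} \<longrightarrow> P (cis \<theta>))} \<union> {0, 2 * pi})" for \<theta>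
    using that by force
qed

lemma borel_measurable_circle_measure: "f \<in> borel_measurable circle_borel \<Longrightarrow> f \<in> borel_measurable circle_measure"
  unfolding circle_measure_def by (rule measurable_completion) (simp cong: measurable_cong_sets)

text \<open>Holds because \<open>circle_measure\<close> is complete. This is how
  \<open>circle_deriv u\<close>, known only almost everywhere, is seen to be measurable.\<close>

lemma borel_measurable_circle_cong_AE:
  assumes f: "f \<in> borel_measurable circle_measure" and ae: "AE z in circle_measure. f z = g z"
  shows "g \<in> borel_measurable circle_measure"
proof (rule measurableI)
  fix A :: "'a set" assume A: "A \<in> sets borel"
  have c: "complete_measure circle_measure" unfolding circle_measure_def by (rule completion.complete_measure_axioms)
  have A': "f -` A \<inter> space circle_measure \<in> sets circle_measure" using measurable_sets[OF f A] .
  show "g -` A \<inter> space circle_measure \<in> sets circle_measure"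
  proof (rule complete_measure.in_sets_AE[OF c _ A'])
    show "AE z in circle_measure. (z \<in> f -` A \<inter> space circle_measure) = (z \<in> g -` A \<inter> space circle_measure)"
      using ae by eventually_elim simp
  qed simp
qed simp

lemma borel_measurable_circleE:
  fixes f :: "complex \<Rightarrow> complex"
  assumes "f \<in> borel_measurable circle_measure"
  obtains f' where "f' \<in> borel_measurable circle_borel" "AE z in circle_measure. f z = f' z"
proof -
  let ?m = "distr (uniform_measure lborel {0..<1::real}) circle_borel (\<lambda>t. cis (2 * pi * t))"
  have f: "f \<in> borel_measurable (completion ?m)" using assms by (simp add: circle_measure_def)
  have "(\<lambda>z. Re (f z)) \<in> borel_measurable (completion ?m)" "(\<lambda>z. Im (f z)) \<in> borel_measurable (completion ?m)"
    using f by (auto simp: borel_measurable_complex_iff)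
  from completion_ex_borel_measurable_real[OF this(1)] completion_ex_borel_measurable_real[OF this(2)]
  obtain u v where u: "u \<in> borel_measurable ?m" "AE z in ?m. Re (f z) = u z"
    and v: "v \<in> borel_measurable ?m" "AE z in ?m. Im (f z) = v z" by blast
  have "AE z in ?m. f z = Complex (u z) (v z)"
    using u(2) v(2) by eventually_elim (simp add: complex_eq_iff)
  then have "AE z in circle_measure. f z = Complex (u z) (v z)"
    unfolding circle_measure_def by (rule AE_completion)
  moreover have "(\<lambda>z. Complex (u z) (v z)) \<in> borel_measurable circle_borel"
    using u(1) v(1) by (simp add: borel_measurable_complex_iff cong: measurable_cong_sets)
  ultimately show ?thesis using that by blast
qed

text \<open>The substitution \<open>\<theta> = 2 pi t\<close>, followed by the passage from Lebesgue
  to gauge integrals. The factor \<open>2 pi\<close> is the normalisation of the measure. Borel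
  measurability is assumed so that composition with \<open>cis\<close> stays measurable.\<close>

lemma
  fixes h :: "complex \<Rightarrow> 'b::euclidean_space"
  assumes h: "h \<in> borel_measurable circle_borel"
  shows integrable_circle_borel: "integrable circle_measure h \<longleftrightarrow> (\<lambda>\<theta>. h (cis \<theta>)) absolutely_integrable_on {0..2 * pi}"
    and integral_circle_borel: "integrable circle_measure h \<Longrightarrow>
      integral\<^sup>L circle_measure h = integral {0..2 * pi} (\<lambda>\<theta>. h (cis \<theta>)) /\<^sub>R (2 * pi)"
proof -
  let ?U = "uniform_measure lborel {0..<1::real}"
  let ?m = "distr ?U circle_borel (\<lambda>t. cis (2 * pi * t))"
  define k where "k \<theta> = indicator {0..<2 * pi} \<theta> *\<^sub>R h (cis \<theta>)" for \<theta> :: real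
  have X: "(\<lambda>t. cis (2 * pi * t)) \<in> ?U \<rightarrow>\<^sub>M circle_borel"
    using measurable_cis_circle by (simp cong: measurable_cong_sets)
  have hm: "h \<in> borel_measurable ?m" using h by (simp cong: measurable_cong_sets)
  have hX: "(\<lambda>t. h (cis (2 * pi * t))) \<in> borel_measurable borel"
    by (rule measurable_compose[OF measurable_cis_circle h])
  have "(\<lambda>\<theta>. h (cis (2 * pi * (\<theta> / (2 * pi))))) \<in> borel_measurable borel"
    by (rule measurable_compose[OF _ hX]) simp
  then have km: "k \<in> borel_measurable borel" unfolding k_def by simp
  have kt: "indicator {0..<1} t *\<^sub>R h (cis (2 * pi * t)) = k (0 + 2 * pi * t)" for t
    by (simp add: k_def indicator_def two_pi_mult_mem_iff del: atLeastLessThan_iff)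
  have i1: "integrable circle_measure h \<longleftrightarrow> integrable lborel k"
  proof -
    have "integrable circle_measure h \<longleftrightarrow> integrable ?m h"
      unfolding circle_measure_def by (rule integrable_completion) (rule hm)
    also have "\<dots> \<longleftrightarrow> integrable ?U (\<lambda>t. h (cis (2 * pi * t)))"
      by (rule integrable_distr_eq[OF X h])
    also have "\<dots> \<longleftrightarrow> integrable lborel (\<lambda>t. indicator {0..<1} t *\<^sub>R h (cis (2 * pi * t)))"
      unfolding uniform_measure_01 by (rule integrable_density) (use hX in auto)
    also have "\<dots> \<longleftrightarrow> integrable lborel k"
      unfolding kt by (rule lborel_integrable_real_affine_iff) simp
    finally show ?thesis .
  qed
  have i2: "integrable lborel k \<longleftrightarrow> (\<lambda>\<theta>. h (cis \<theta>)) absolutely_integrable_on {0..<2 * pi}"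
    unfolding set_integrable_def k_def[symmetric]
    by (rule integrable_completion[symmetric]) (use km in simp)
  have neg: "negligible {x \<in> {0..<2 * pi} - {0..2 * pi}. f x \<noteq> 0}"
    "negligible {x \<in> {0..2 * pi} - {0..<2 * pi}. f x \<noteq> 0}" for f :: "real \<Rightarrow> 'b"
    by (rule negligible_subset[of "{2 * pi}"]; auto)+
  have i3: "(\<lambda>\<theta>. h (cis \<theta>)) absolutely_integrable_on {0..<2 * pi} \<longleftrightarrow>
      (\<lambda>\<theta>. h (cis \<theta>)) absolutely_integrable_on {0..2 * pi}"
    by (rule absolutely_integrable_spike_set_eq[OF neg])
  show i: "integrable circle_measure h \<longleftrightarrow> (\<lambda>\<theta>. h (cis \<theta>)) absolutely_integrable_on {0..2 * pi}"
    using i1 i2 i3 by simp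
  assume int: "integrable circle_measure h"
  have "integral\<^sup>L circle_measure h = integral\<^sup>L ?m h"
    unfolding circle_measure_def by (rule integral_completion) (rule hm)
  also have "\<dots> = integral\<^sup>L ?U (\<lambda>t. h (cis (2 * pi * t)))"
    by (rule integral_distr[OF X h])
  also have "\<dots> = integral\<^sup>L lborel (\<lambda>t. indicator {0..<1} t *\<^sub>R h (cis (2 * pi * t)))"
    unfolding uniform_measure_01 by (rule integral_density) (use hX in auto)
  also have "\<dots> = integral\<^sup>L lborel k /\<^sub>R (2 * pi)"
    unfolding kt by (subst lborel_integral_real_affine[of "2 * pi" k 0]) simp_all
  also have "integral\<^sup>L lborel k = integral\<^sup>L lebesgue k"
    by (rule integral_completion[symmetric]) (use km in simp)
  also have "integral\<^sup>L lebesgue k = integral {0..<2 * pi} (\<lambda>\<theta>. h (cis \<theta>))"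
    using set_lebesgue_integral_eq_integral(2)[of "{0..<2 * pi}" "\<lambda>\<theta>. h (cis \<theta>)"] int i1 i2
    unfolding set_lebesgue_integral_def k_def by simp
  also have "\<dots> = integral {0..2 * pi} (\<lambda>\<theta>. h (cis \<theta>))"
    by (rule integral_spike_set[OF neg])
  finally show "integral\<^sup>L circle_measure h = integral {0..2 * pi} (\<lambda>\<theta>. h (cis \<theta>)) /\<^sub>R (2 * pi)" .
qed

text \<open>A function measurable for the completed measure agrees almost everywhere with a Borel
  one. Null sets on the circle become negligible sets of angles, on which gauge integrals do not
  depend.\<close>

lemma
  fixes f :: "complex \<Rightarrow> complex"
  assumes f: "f \<in> borel_measurable circle_measure"
  shows integrable_circle_iff: "integrable circle_measure f \<longleftrightarrow> (\<lambda>\<theta>. f (cis \<theta>)) absolutely_integrable_on {0..2 * pi}"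
    and integral_circle_eq: "integrable circle_measure f \<Longrightarrow>
      integral\<^sup>L circle_measure f = integral {0..2 * pi} (\<lambda>\<theta>. f (cis \<theta>)) /\<^sub>R (2 * pi)"
    and square_integrable_iff: "square_integrable f \<longleftrightarrow> (\<lambda>\<theta>. (cmod (f (cis \<theta>)))\<^sup>2) integrable_on {0..2 * pi}"
    and integral_circle_square_eq: "square_integrable f \<Longrightarrow>
      integral\<^sup>L circle_measure (\<lambda>z. (cmod (f z))\<^sup>2) = integral {0..2 * pi} (\<lambda>\<theta>. (cmod (f (cis \<theta>)))\<^sup>2) / (2 * pi)"
proof -
  obtain f' where f': "f' \<in> borel_measurable circle_borel" and ae: "AE z in circle_measure. f z = f' z"
    using borel_measurable_circleE[OF f] by blast
  obtain N where N: "negligible N" "\<And>\<theta>. \<theta> \<in> {0..2 * pi} - N \<Longrightarrow> f (cis \<theta>) = f' (cis \<theta>)"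
    using AE_circle_measureE[OF ae] by blast
  have f'm: "f' \<in> borel_measurable circle_measure" by (rule borel_measurable_circle_measure[OF f'])
  have int: "integrable circle_measure f \<longleftrightarrow> integrable circle_measure f'"
    by (rule integrable_cong_AE[OF f f'm ae])
  have "(\<lambda>\<theta>. f' (cis \<theta>)) absolutely_integrable_on {0..2 * pi} \<longleftrightarrow> (\<lambda>\<theta>. f (cis \<theta>)) absolutely_integrable_on {0..2 * pi}"
    by (rule absolutely_integrable_spike_eq[OF N])
  then show "integrable circle_measure f \<longleftrightarrow> (\<lambda>\<theta>. f (cis \<theta>)) absolutely_integrable_on {0..2 * pi}"
    using int integrable_circle_borel[OF f'] by simp
  show "integral\<^sup>L circle_measure f = integral {0..2 * pi} (\<lambda>\<theta>. f (cis \<theta>)) /\<^sub>R (2 * pi)"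
    if "integrable circle_measure f"
  proof -
    have "integral {0..2 * pi} (\<lambda>\<theta>. f' (cis \<theta>)) = integral {0..2 * pi} (\<lambda>\<theta>. f (cis \<theta>))"
      by (rule integral_spike[OF N])
    then show ?thesis
      using integral_circle_borel[OF f'] that int integral_cong_AE[OF f f'm ae] by simp
  qed
  define h where "h z = (cmod (f' z))\<^sup>2" for z
  have h: "h \<in> borel_measurable circle_borel" unfolding h_def using f' by simp
  have hm: "h \<in> borel_measurable circle_measure" by (rule borel_measurable_circle_measure[OF h])
  have fm: "(\<lambda>z. (cmod (f z))\<^sup>2) \<in> borel_measurable circle_measure" using f by simp
  have aeh: "AE z in circle_measure. (cmod (f z))\<^sup>2 = h z" using ae by eventually_elim (simp add: h_def)
  have inth: "integrable circle_measure (\<lambda>z. (cmod (f z))\<^sup>2) \<longleftrightarrow> integrable circle_measure h"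
    by (rule integrable_cong_AE[OF fm hm aeh])
  have Nh: "(cmod (f (cis \<theta>)))\<^sup>2 = h (cis \<theta>)" if "\<theta> \<in> {0..2 * pi} - N" for \<theta>
    using N(2)[OF that] by (simp add: h_def)
  have "(\<lambda>\<theta>. h (cis \<theta>)) absolutely_integrable_on {0..2 * pi} \<longleftrightarrow>
      (\<lambda>\<theta>. (cmod (f (cis \<theta>)))\<^sup>2) absolutely_integrable_on {0..2 * pi}"
    by (rule absolutely_integrable_spike_eq[OF N(1) Nh])
  also have "\<dots> \<longleftrightarrow> (\<lambda>\<theta>. (cmod (f (cis \<theta>)))\<^sup>2) integrable_on {0..2 * pi}"
    by (rule absolutely_integrable_on_iff_nonneg) simp
  finally show sq: "square_integrable f \<longleftrightarrow> (\<lambda>\<theta>. (cmod (f (cis \<theta>)))\<^sup>2) integrable_on {0..2 * pi}"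
    unfolding square_integrable_def using inth integrable_circle_borel[OF h] f by simp
  show "integral\<^sup>L circle_measure (\<lambda>z. (cmod (f z))\<^sup>2) = integral {0..2 * pi} (\<lambda>\<theta>. (cmod (f (cis \<theta>)))\<^sup>2) / (2 * pi)"
    if "square_integrable f"
  proof -
    have ih: "integrable circle_measure h" using that inth by (simp add: square_integrable_def)
    have eq: "integral {0..2 * pi} (\<lambda>\<theta>. h (cis \<theta>)) = integral {0..2 * pi} (\<lambda>\<theta>. (cmod (f (cis \<theta>)))\<^sup>2)"
      by (rule integral_spike[OF N(1) Nh])
    show ?thesis
      unfolding integral_cong_AE[OF fm hm aeh] integral_circle_borel[OF h ih] eq
      by (simp only: real_scaleR_def divide_inverse_commute)
  qed
qed

lemma square_integrable_const: "square_integrable (\<lambda>_. c)"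
  by (subst square_integrable_iff) auto

lemma square_integrable_imp_integrable:
  assumes "square_integrable f" shows "integrable circle_measure f"
  using square_integrable_inner[OF assms, of "\<lambda>_. 1"] by (simp add: square_integrable_const)

section \<open>Completeness of \<open>L\<^sup>2\<close> of the circle\<close>

lemma square_integrable_cong_AE:
  assumes f: "square_integrable f" and ae: "AE z in circle_measure. f z = g z"
  shows "square_integrable g"
proof -
  have fm: "f \<in> borel_measurable circle_measure" using f by (simp add: square_integrable_def)
  have gm: "g \<in> borel_measurable circle_measure" by (rule borel_measurable_circle_cong_AE[OF fm ae])
  have "integrable circle_measure (\<lambda>z. (cmod (g z))\<^sup>2)"
  proof (rule integrable_cong_AE_imp)
    show "integrable circle_measure (\<lambda>z. (cmod (f z))\<^sup>2)" using f by (simp add: square_integrable_def)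
    show "AE z in circle_measure. (cmod (f z))\<^sup>2 = (cmod (g z))\<^sup>2" using ae by eventually_elim simp
  qed (use gm in simp)
  then show ?thesis using gm by (simp add: square_integrable_def)
qed

lemma square_integrable_bounded_mult:
  assumes \<phi>: "\<phi> \<in> borel_measurable circle_measure" and b: "\<And>z. z \<in> circle \<Longrightarrow> cmod (\<phi> z) \<le> C"
    and g: "square_integrable g"
  shows "square_integrable (\<lambda>z. \<phi> z * g z)"
  unfolding square_integrable_def
proof
  have gm: "g \<in> borel_measurable circle_measure" using g by (simp add: square_integrable_def)
  show m: "(\<lambda>z. \<phi> z * g z) \<in> borel_measurable circle_measure" using \<phi> gm by simp
  show "integrable circle_measure (\<lambda>z. (cmod (\<phi> z * g z))\<^sup>2)"
  proof (rule Bochner_Integration.integrable_bound)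
    show "integrable circle_measure (\<lambda>z. C\<^sup>2 * (cmod (g z))\<^sup>2)" using g by (simp add: square_integrable_def)
    show "AE z in circle_measure. norm ((cmod (\<phi> z * g z))\<^sup>2) \<le> norm (C\<^sup>2 * (cmod (g z))\<^sup>2)"
      using AE_circle_space
    proof eventually_elim
      case (elim z)
      then have "(cmod (\<phi> z))\<^sup>2 \<le> C\<^sup>2" using b[OF elim] by (intro power_mono) auto
      then show ?case by (simp add: norm_mult power_mult_distrib mult_right_mono)
    qed
  qed (use m in simp)
qed

lemma square_integrable_diff:
  "square_integrable f \<Longrightarrow> square_integrable g \<Longrightarrow> square_integrable (\<lambda>z. f z - g z)"
  using square_integrable_add[of f "\<lambda>z. (-1) * g z"] square_integrable_scale[of g "-1"] by simp

lemma class_L2_eq_iff: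
  "square_integrable f \<Longrightarrow> square_integrable g \<Longrightarrow>
    class_L2 f = class_L2 g \<longleftrightarrow> (AE z in circle_measure. f z = g z)"
  using Quotient3_rel[OF Quotient3_circle_L2, of f g] by simp

lemma class_L2_rep [simp]: "class_L2 (rep_L2 x) = x"
  by (rule Quotient3_abs_rep[OF Quotient3_circle_L2])

lemma square_integrable_rep [simp]: "square_integrable (rep_L2 x)"
  using Quotient3_rep_reflp[OF Quotient3_circle_L2, of x] by simp

lemma rep_class_AE: "square_integrable f \<Longrightarrow> AE z in circle_measure. rep_L2 (class_L2 f) z = f z"
  by (subst class_L2_eq_iff[symmetric]) simp_all

lemma class_L2_add:
  "square_integrable f \<Longrightarrow> square_integrable g \<Longrightarrow> class_L2 (\<lambda>z. f z + g z) = class_L2 f + class_L2 g"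
  by (rule plus_circle_L2.abs_eq[symmetric]) simp_all

lemma class_L2_scaleC: "square_integrable f \<Longrightarrow> class_L2 (\<lambda>z. c * f z) = scaleC c (class_L2 f)"
  by (rule scaleC_circle_L2.abs_eq[symmetric]) simp

lemma class_L2_scaleR: "square_integrable f \<Longrightarrow> class_L2 (\<lambda>z. complex_of_real c * f z) = c *\<^sub>R class_L2 f"
  by (simp add: scaleR_circle_L2_def class_L2_scaleC)

lemma scaleC_minus1: "scaleC (-1) x = - x" for x :: "'a::complex_inner_space"
  using scaleC_of_real[of "-1" x] by simp

lemma class_L2_uminus: "square_integrable f \<Longrightarrow> class_L2 (\<lambda>z. - f z) = - class_L2 f"
  using class_L2_scaleC[of f "-1"] by (simp add: scaleC_minus1)

lemma class_L2_diff:
  "square_integrable f \<Longrightarrow> square_integrable g \<Longrightarrow> class_L2 (\<lambda>z. f z - g z) = class_L2 f - class_L2 g"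
  using class_L2_add[of f "\<lambda>z. - g z"] class_L2_uminus[of g] square_integrable_scale[of g "-1"] by simp

lemma inner_class_L2:
  "square_integrable f \<Longrightarrow> square_integrable g \<Longrightarrow>
    inner (class_L2 f) (class_L2 g) = Re (integral\<^sup>L circle_measure (\<lambda>z. f z * cnj (g z)))"
  by (rule inner_circle_L2.abs_eq) simp_all

lemma norm_class_L2:
  assumes "square_integrable f"
  shows "(norm (class_L2 f))\<^sup>2 = integral\<^sup>L circle_measure (\<lambda>z. (cmod (f z))\<^sup>2)"
proof -
  have "(norm (class_L2 f))\<^sup>2 = Re (integral\<^sup>L circle_measure (\<lambda>z. f z * cnj (f z)))"
    by (simp add: power2_norm_eq_inner inner_class_L2 assms)
  also have "\<dots> = integral\<^sup>L circle_measure (\<lambda>z. (cmod (f z))\<^sup>2)"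
    by (simp flip: complex_norm_square of_real_power)
  finally show ?thesis .
qed

lemma nn_integral_norm_class_L2:
  assumes "square_integrable f"
  shows "(\<integral>\<^sup>+z. ennreal ((cmod (f z))\<^sup>2) \<partial>circle_measure) = ennreal ((norm (class_L2 f))\<^sup>2)"
  unfolding norm_class_L2[OF assms]
  by (rule nn_integral_eq_integral) (use assms in \<open>auto simp: square_integrable_def\<close>)

lemma prob_space_circle: "emeasure circle_measure (space circle_measure) = 1"
proof -
  have X: "(\<lambda>t. cis (2 * pi * t)) \<in> uniform_measure lborel {0..<1::real} \<rightarrow>\<^sub>M circle_borel"
    using measurable_cis_circle by (simp cong: measurable_cong_sets)
  have s: "circle \<in> sets circle_borel" by (metis sets.top space_borel space_restrict_space Int_UNIV_right)
  have "(\<lambda>t. cis (2 * pi * t)) -` circle = UNIV" by auto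
  then show ?thesis
    unfolding circle_measure_def using s X
    by (simp add: space_restrict_space emeasure_distr emeasure_uniform_measure)
qed

text \<open>The Riesz-Fischer argument: the increments have summable \<open>L1\<close> norms, so
  representatives converge almost everywhere, and Fatou's lemma transfers the norm bounds to the
  limit.\<close>

lemma rapidly_Cauchy_converges:
  fixes Y :: "nat \<Rightarrow> circle_L2"
  assumes Y: "\<And>m n. n \<le> m \<Longrightarrow> norm (Y m - Y n) \<le> (1/2) ^ n"
  shows "\<exists>x. \<forall>n. norm (x - Y n) \<le> (1/2) ^ n"
proof -
  define f where "f n = rep_L2 (Y n)" for n
  have f: "square_integrable (f n)" "class_L2 (f n) = Y n" for n by (auto simp: f_def)
  have fm [measurable]: "f n \<in> borel_measurable circle_measure" for n using f(1) by (simp add: square_integrable_def)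
  have fd: "square_integrable (\<lambda>z. f m z - f n z)" "class_L2 (\<lambda>z. f m z - f n z) = Y m - Y n" for m n
    using f by (simp_all add: square_integrable_diff class_L2_diff)
  have nn: "(\<integral>\<^sup>+z. ennreal ((cmod (f m z - f n z))\<^sup>2) \<partial>circle_measure) \<le> ennreal (((1/2) ^ n)\<^sup>2)" if "n \<le> m" for m n
    unfolding nn_integral_norm_class_L2[OF fd(1)] fd(2)
    using Y[OF that] by (intro ennreal_leI power_mono) auto
  have n1: "(\<integral>\<^sup>+z. ennreal (cmod (f (Suc n) z - f n z)) \<partial>circle_measure) \<le> ennreal ((1/2) ^ n)" for n
  proof -
    let ?K = "(1/2) ^ n :: real"
    have K: "?K > 0" by simp
    have "(\<integral>\<^sup>+z. ennreal (cmod (f (Suc n) z - f n z)) \<partial>circle_measure) \<le>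
        (\<integral>\<^sup>+z. ennreal (?K / 2) + ennreal (1 / (2 * ?K)) * ennreal ((cmod (f (Suc n) z - f n z))\<^sup>2) \<partial>circle_measure)"
    proof (rule nn_integral_mono)
      fix z
      \<comment> \<open>On a probability space this inequality with \<open>K = (1/2) ^ n\<close>
        converts the bound \<open>K ^ 2\<close> for the square integral into the bound
        \<open>K\<close> for the integral of the modulus.\<close>
      have "x \<le> K / 2 + 1 / (2 * K) * x\<^sup>2" if "K > 0" for x K :: real
      proof -
        have "0 \<le> (x - K)\<^sup>2" by simp
        then show ?thesis using that by (simp add: field_simps power2_eq_square)
      qed
      from ennreal_leI[OF this[OF K]]
      show "ennreal (cmod (f (Suc n) z - f n z)) \<le> ennreal (?K / 2) + ennreal (1 / (2 * ?K)) * ennreal ((cmod (f (Suc n) z - f n z))\<^sup>2)"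
        using K by (simp flip: ennreal_mult' ennreal_plus)
    qed
    also have "\<dots> = ennreal (?K / 2) + ennreal (1 / (2 * ?K)) * (\<integral>\<^sup>+z. ennreal ((cmod (f (Suc n) z - f n z))\<^sup>2) \<partial>circle_measure)"
      using prob_space_circle by (simp add: nn_integral_add nn_integral_cmult)
    also have "\<dots> \<le> ennreal (?K / 2) + ennreal (1 / (2 * ?K)) * ennreal (?K\<^sup>2)"
      by (intro add_left_mono mult_left_mono nn) auto
    also have "\<dots> = ennreal (?K / 2 + 1 / (2 * ?K) * ?K\<^sup>2)"
      using K by (simp flip: ennreal_mult' ennreal_plus)
    also have "?K / 2 + 1 / (2 * ?K) * ?K\<^sup>2 = ?K" using K by (simp add: power2_eq_square field_simps)
    finally show ?thesis .
  qed
  have "(\<integral>\<^sup>+z. (\<Sum>n. ennreal (cmod (f (Suc n) z - f n z))) \<partial>circle_measure) =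
      (\<Sum>n. \<integral>\<^sup>+z. ennreal (cmod (f (Suc n) z - f n z)) \<partial>circle_measure)"
    by (rule nn_integral_suminf) measurable
  also have "\<dots> \<le> (\<Sum>n. ennreal ((1/2) ^ n))" by (intro suminf_le n1) auto
  also have "\<dots> = ennreal (\<Sum>n. (1/2) ^ n)" by (rule suminf_ennreal2) (auto intro: summable_geometric)
  also have "\<dots> < \<infinity>" by simp
  finally have "(\<integral>\<^sup>+z. (\<Sum>n. ennreal (cmod (f (Suc n) z - f n z))) \<partial>circle_measure) \<noteq> \<infinity>" by simp
  then have "AE z in circle_measure. (\<Sum>n. ennreal (cmod (f (Suc n) z - f n z))) \<noteq> \<infinity>"
    by (intro nn_integral_noteq_infinite) auto
  then have conv: "AE z in circle_measure. (\<lambda>n. f n z) \<longlonglongrightarrow> lim (\<lambda>n. f n z)"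
  proof eventually_elim
    case (elim z)
    then have "summable (\<lambda>n. cmod (f (Suc n) z - f n z))"
      by (intro summable_suminf_not_top) auto
    then have "summable (\<lambda>n. f (Suc n) z - f n z)" by (rule summable_norm_cancel)
    then have "convergent (\<lambda>n. \<Sum>i<n. f (Suc i) z - f i z)" by (simp add: summable_iff_convergent)
    then have "convergent (\<lambda>n. f n z - f 0 z)" using sum_lessThan_telescope[of "\<lambda>n. f n z"] by simp
    then have "convergent (\<lambda>n. (f n z - f 0 z) + f 0 z)" by (intro convergent_add convergent_const)
    then show ?case by (simp add: convergent_LIMSEQ_iff)
  qed
  define h where "h z = lim (\<lambda>n. f n z)" for z
  have hm [measurable]: "h \<in> borel_measurable circle_measure"
    unfolding h_def by (rule borel_measurable_lim_metric) (rule fm)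
  \<comment> \<open>Fatou's lemma in \<open>m\<close> for fixed \<open>n\<close>; the bound for the
    differences holds for all \<open>m \<ge> n\<close>.\<close>
  have hn: "(\<integral>\<^sup>+z. ennreal ((cmod (h z - f n z))\<^sup>2) \<partial>circle_measure) \<le> ennreal (((1/2) ^ n)\<^sup>2)" for n
  proof -
    have "(\<integral>\<^sup>+z. ennreal ((cmod (h z - f n z))\<^sup>2) \<partial>circle_measure) \<le>
        (\<integral>\<^sup>+z. liminf (\<lambda>m. ennreal ((cmod (f m z - f n z))\<^sup>2)) \<partial>circle_measure)"
    proof (rule nn_integral_mono_AE)
      show "AE z in circle_measure. ennreal ((cmod (h z - f n z))\<^sup>2) \<le> liminf (\<lambda>m. ennreal ((cmod (f m z - f n z))\<^sup>2))"
        using conv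
      proof eventually_elim
        case (elim z)
        have "(\<lambda>m. ennreal ((cmod (f m z - f n z))\<^sup>2)) \<longlonglongrightarrow> ennreal ((cmod (h z - f n z))\<^sup>2)"
          unfolding h_def by (intro tendsto_ennrealI tendsto_intros elim)
        from lim_imp_Liminf[OF _ this] show ?case by (metis order_refl sequentially_bot)
      qed
    qed
    also have "\<dots> \<le> liminf (\<lambda>m. \<integral>\<^sup>+z. ennreal ((cmod (f m z - f n z))\<^sup>2) \<partial>circle_measure)"
      by (rule nn_integral_liminf) measurable
    also have "\<dots> \<le> ennreal (((1/2) ^ n)\<^sup>2)"
    proof (rule Liminf_le)
      show "\<forall>\<^sub>F m in sequentially. (\<integral>\<^sup>+z. ennreal ((cmod (f m z - f n z))\<^sup>2) \<partial>circle_measure) \<le> ennreal (((1/2) ^ n)\<^sup>2)"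
        using eventually_ge_at_top[of n] by eventually_elim (rule nn)
    qed simp
    finally show ?thesis .
  qed
  have hf: "square_integrable (\<lambda>z. h z - f n z)" for n
    unfolding square_integrable_def
  proof
    show "(\<lambda>z. h z - f n z) \<in> borel_measurable circle_measure" by measurable
    show "integrable circle_measure (\<lambda>z. (cmod (h z - f n z))\<^sup>2)"
      by (rule integrableI_nonneg) (use hn[of n] in \<open>auto intro: le_less_trans\<close>)
  qed
  then have h: "square_integrable h" using square_integrable_add[OF hf[of 0] f(1)[of 0]] by simp
  have "norm (class_L2 h - Y n) \<le> (1/2) ^ n" for n
  proof -
    have "class_L2 (\<lambda>z. h z - f n z) = class_L2 h - Y n" using h f by (simp add: class_L2_diff)
    then have "ennreal ((norm (class_L2 h - Y n))\<^sup>2) \<le> ennreal (((1/2) ^ n)\<^sup>2)"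
      using hn[of n] nn_integral_norm_class_L2[OF hf[of n]] by simp
    then have "(norm (class_L2 h - Y n))\<^sup>2 \<le> ((1/2) ^ n)\<^sup>2" by simp
    then show ?thesis by (rule power2_le_imp_le) simp
  qed
  then show ?thesis by blast
qed

text \<open>A Cauchy sequence converges as soon as one subsequence does, and a subsequence can be
  chosen with geometrically decreasing distances.\<close>

lemma complete_if_rapidly_Cauchy_converges:
  fixes X :: "nat \<Rightarrow> 'a::real_normed_vector"
  assumes rapid: "\<And>Y :: nat \<Rightarrow> 'a. (\<And>m n. n \<le> m \<Longrightarrow> norm (Y m - Y n) \<le> (1/2) ^ n) \<Longrightarrow> \<exists>x. \<forall>n. norm (x - Y n) \<le> (1/2) ^ n"
    and X: "Cauchy X"
  shows "convergent X"
proof -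
  have "\<forall>k. \<exists>M. \<forall>m\<ge>M. \<forall>n\<ge>M. norm (X m - X n) < (1/2) ^ k"
    using CauchyD[OF X] by simp
  then obtain N where N: "\<And>k m n. N k \<le> m \<Longrightarrow> N k \<le> n \<Longrightarrow> norm (X m - X n) < (1/2) ^ k" by metis
  \<comment> \<open>The partial sums of \<open>N\<close> form a nondecreasing index sequence that
    dominates every \<open>N n\<close>.\<close>
  define r where "r n = (\<Sum>k\<le>n. N k)" for n
  have rN: "N n \<le> r m" if "n \<le> m" for n m
    unfolding r_def by (rule member_le_sum) (use that in auto)
  have "\<exists>x. \<forall>n. norm (x - X (r n)) \<le> (1/2) ^ n"
  proof (rule rapid)
    show "norm (X (r m) - X (r n)) \<le> (1/2) ^ n" if "n \<le> m" for m n
      using N[OF rN[OF that] rN[OF order_refl]] by (rule less_imp_le)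
  qed
  then obtain x where x: "\<And>n. norm (x - X (r n)) \<le> (1/2) ^ n" by blast
  have "X \<longlonglongrightarrow> x"
  proof (rule LIMSEQ_I)
    fix e :: real assume "e > 0"
    then obtain k where k: "(1/2) ^ k < e / 2" using real_arch_pow_inv[of "e / 2" "1/2"] by auto
    show "\<exists>n0. \<forall>n\<ge>n0. norm (X n - x) < e"
    proof (intro exI allI impI)
      fix n assume n: "N k \<le> n"
      have "norm (X n - x) \<le> norm (X n - X (r k)) + norm (x - X (r k))"
        using norm_triangle_ineq[of "X n - X (r k)" "X (r k) - x"] by (simp add: norm_minus_commute)
      also have "\<dots> < e" using N[OF n rN[OF order_refl]] x[of k] k by linarith
      finally show "norm (X n - x) < e" .
    qed
  qed
  then show ?thesis by (rule convergentI)
qed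

instance circle_L2 :: complete_space
  by intro_classes (rule complete_if_rapidly_Cauchy_converges[OF rapidly_Cauchy_converges])

instance circle_L2 :: banach ..

section \<open>Derivatives and \<open>H\<^sup>1\<close> on the circle\<close>

text \<open>Makes derivatives along the circle unique: a connected set with more than one point has
  no isolated points.\<close>

lemma at_within_circle_neq_bot:
  assumes "z \<in> circle" shows "at z within circle \<noteq> bot"
proof -
  have "- z \<in> circle" "- z \<noteq> z" using assms by auto
  then have "\<nexists>a. circle = {a}" using assms by (metis singletonD)
  then have "z islimpt circle"
    using connected_imp_perfect[of circle z] assms connected_sphere[of "0::complex" 1] by simp
  then show ?thesis by (simp add: trivial_limit_within)
qed

lemma circle_deriv_eq:
  assumes "z \<in> circle" "(f has_field_derivative d) (at z within circle)"
  shows "circle_deriv f z = d"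
  unfolding circle_deriv_def
proof (rule the_equality)
  show "(f has_field_derivative d) (at z within circle)" by (rule assms(2))
  fix d' assume "(f has_field_derivative d') (at z within circle)"
  then show "d' = d"
    using assms(2) at_within_circle_neq_bot[OF assms(1)] unfolding has_field_derivative_iff
    by (metis tendsto_unique)
qed

lemma has_field_derivative_circle_deriv:
  assumes "z \<in> circle" "f field_differentiable (at z within circle)"
  shows "(f has_field_derivative circle_deriv f z) (at z within circle)"
  using assms circle_deriv_eq unfolding field_differentiable_def by metis

lemma has_field_derivative_circle_cong:
  assumes "z \<in> circle" "\<And>w. w \<in> circle \<Longrightarrow> f w = g w"
  shows "(f has_field_derivative d) (at z within circle) \<longleftrightarrow> (g has_field_derivative d) (at z within circle)"
  using has_field_derivative_transform_within[of f d z circle 1 g]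
    has_field_derivative_transform_within[of g d z circle 1 f] assms by auto

lemma circle_deriv_cong:
  assumes "z \<in> circle" "\<And>w. w \<in> circle \<Longrightarrow> f w = g w"
  shows "circle_deriv f z = circle_deriv g z"
  unfolding circle_deriv_def using has_field_derivative_circle_cong[OF assms] by simp

lemma has_vector_derivative_cis: "(cis has_vector_derivative \<i> * cis \<theta>) (at \<theta> within S)"
  unfolding has_vector_derivative_complex_iff by (auto intro!: derivative_eq_intros)

lemma has_vector_derivative_circle:
  assumes "(u has_field_derivative d) (at (cis \<theta>) within circle)"
  shows "((\<lambda>\<theta>. u (cis \<theta>)) has_vector_derivative \<i> * cis \<theta> * d) (at \<theta>)"
proof -
  have "(u has_field_derivative d) (at (cis \<theta>) within range cis)"
    by (rule DERIV_subset[OF assms]) auto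
  from field_vector_diff_chain_within[OF has_vector_derivative_cis this]
  show ?thesis by (simp add: o_def)
qed

lemma has_vector_derivative_tendsto:
  fixes U :: "real \<Rightarrow> complex"
  assumes "(U has_vector_derivative d) (at \<theta>)"
  shows "((\<lambda>t. (U t - U \<theta>) / complex_of_real (t - \<theta>)) \<longlongrightarrow> d) (at \<theta>)"
proof -
  have "((\<lambda>t. Re (U t)) has_real_derivative Re d) (at \<theta>)" "((\<lambda>t. Im (U t)) has_real_derivative Im d) (at \<theta>)"
    using assms by (simp_all add: has_vector_derivative_complex_iff)
  then show ?thesis
    unfolding has_field_derivative_iff tendsto_complex_iff by simp
qed

text \<open>The quotient along the circle is the difference quotient of \<open>u\<close> in the
  angle divided by that of \<open>cis\<close>. The angle \<open>0\<close> is excluded because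
  \<open>Arg2pi\<close> jumps at \<open>1\<close>.\<close>

lemma has_field_derivative_circle:
  assumes \<theta>: "\<theta> \<in> {0<..<2 * pi}" and d: "((\<lambda>\<theta>. u (cis \<theta>)) has_vector_derivative \<i> * cis \<theta> * d) (at \<theta>)"
  shows "(u has_field_derivative d) (at (cis \<theta>) within circle)"
  unfolding has_field_derivative_iff
proof -
  define z0 where "z0 = cis \<theta>"
  have z0: "Arg2pi z0 = \<theta>" using \<theta> by (simp add: z0_def Arg2pi_cis)
  have "z0 \<notin> \<real>\<^sub>\<ge>\<^sub>0"
    using Arg2pi_eq_0[of z0] z0 \<theta> by (auto simp: complex_nonneg_Reals_iff complex_is_Real_iff)
  then have "isCont Arg2pi z0" by (rule continuous_at_Arg2pi)
  then have "(Arg2pi \<longlongrightarrow> \<theta>) (at z0 within circle)"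
    using z0 by (auto simp: isCont_def intro: tendsto_within_subset)
  moreover have "\<forall>\<^sub>F z in at z0 within circle. Arg2pi z \<noteq> \<theta>"
    unfolding eventually_at_filter
    by (rule always_eventually) (metis cis_Arg2pi z0_def)
  \<comment> \<open>\<open>Arg2pi\<close> tends to \<open>\<theta>\<close> without taking this
    value, so limits of difference quotients may be composed with it.\<close>
  ultimately have lim: "filterlim Arg2pi (at \<theta>) (at z0 within circle)"
    by (simp add: filterlim_at)
  have "((\<lambda>t. (u (cis t) - u (cis \<theta>)) / complex_of_real (t - \<theta>)) \<longlongrightarrow> \<i> * cis \<theta> * d) (at \<theta>)"
    by (rule has_vector_derivative_tendsto[OF d])
  moreover have "((\<lambda>t. (cis t - cis \<theta>) / complex_of_real (t - \<theta>)) \<longlongrightarrow> \<i> * cis \<theta>) (at \<theta>)"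
    by (rule has_vector_derivative_tendsto[OF has_vector_derivative_cis])
  ultimately have "((\<lambda>t. ((u (cis t) - u (cis \<theta>)) / complex_of_real (t - \<theta>)) / ((cis t - cis \<theta>) / complex_of_real (t - \<theta>)))
      \<longlongrightarrow> \<i> * cis \<theta> * d / (\<i> * cis \<theta>)) (at \<theta>)"
    by (rule tendsto_divide) simp
  from filterlim_compose[OF this lim]
  have "((\<lambda>z. ((u (cis (Arg2pi z)) - u (cis \<theta>)) / complex_of_real (Arg2pi z - \<theta>)) /
      ((cis (Arg2pi z) - cis \<theta>) / complex_of_real (Arg2pi z - \<theta>))) \<longlongrightarrow> d) (at z0 within circle)"
    by simp
  then have "((\<lambda>z. (u z - u z0) / (z - z0)) \<longlongrightarrow> d) (at z0 within circle)"
  proof (rule Lim_transform_eventually)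
    have ev: "\<forall>\<^sub>F z in at z0 within circle. z \<in> circle"
      by (simp add: eventually_at_filter)
    show "\<forall>\<^sub>F z in at z0 within circle. ((u (cis (Arg2pi z)) - u (cis \<theta>)) / complex_of_real (Arg2pi z - \<theta>)) /
      ((cis (Arg2pi z) - cis \<theta>) / complex_of_real (Arg2pi z - \<theta>)) = (u z - u z0) / (z - z0)"
      using ev \<open>\<forall>\<^sub>F z in at z0 within circle. Arg2pi z \<noteq> \<theta>\<close>
    proof eventually_elim
      case (elim z)
      then show ?case using cis_Arg2pi[OF elim(1)] by (simp add: z0_def)
    qed
  qed
  then show "((\<lambda>y. (u y - u (cis \<theta>)) / (y - cis \<theta>)) \<longlongrightarrow> d) (at (cis \<theta>) within circle)"
    by (simp add: z0_def)
qed

lemma circle_absolutely_continuous_iff: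
  "circle_absolutely_continuous u \<longleftrightarrow> abs_cont_on 0 (2 * pi) (\<lambda>\<theta>. u (cis \<theta>))"
  unfolding circle_absolutely_continuous_def abs_cont_on_def ..

lemma borel_measurable_circle_Arg2pi:
  fixes F :: "real \<Rightarrow> 'a::topological_space"
  assumes "continuous_on {0..2 * pi} F"
  shows "(\<lambda>z. F (Arg2pi z)) \<in> borel_measurable circle_borel"
proof -
  \<comment> \<open>Clamping extends \<open>F\<close> continuously to the line, so that composition
    with the Borel function \<open>Arg2pi\<close> is measurable.\<close>
  define E where "E t = F (max 0 (min (2 * pi) t))" for t
  have "continuous_on UNIV (F \<circ> (\<lambda>t. max 0 (min (2 * pi) t)))"
    by (rule continuous_on_compose) (auto intro!: continuous_intros continuous_on_subset[OF assms])
  then have "E \<in> borel_measurable borel"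
    by (intro borel_measurable_continuous_onI) (simp add: E_def o_def)
  then have "(\<lambda>z. E (Arg2pi z)) \<in> borel_measurable circle_borel"
    by (intro measurable_restrict_space1 measurable_compose[OF borel_measurable_Arg2pi])
  moreover have "E (Arg2pi z) = F (Arg2pi z)" for z
    using Arg2pi_bounds[of z] by (simp add: E_def)
  ultimately show ?thesis by simp
qed

lemma borel_measurable_circle_continuous:
  fixes u :: "complex \<Rightarrow> 'a::topological_space"
  assumes "continuous_on {0..2 * pi} (\<lambda>\<theta>. u (cis \<theta>))"
  shows "u \<in> borel_measurable circle_borel"
  using borel_measurable_circle_Arg2pi[OF assms]
  by (rule measurable_cong[THEN iffD1, rotated]) (simp add: cis_Arg2pi space_restrict_space)

lemma square_integrable_continuous:
  assumes "continuous_on {0..2 * pi} (\<lambda>\<theta>. u (cis \<theta>))"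
  shows "square_integrable u"
proof -
  have "u \<in> borel_measurable circle_measure"
    by (rule borel_measurable_circle_measure[OF borel_measurable_circle_continuous[OF assms]])
  then show ?thesis
    using assms by (subst square_integrable_iff) (auto intro!: integrable_continuous_real continuous_intros)
qed

text \<open>\<open>circle_deriv\<close> is a description and has no known value where
  \<open>u\<close> is not differentiable. It equals \<open>h\<close> almost everywhere, and this
  already fixes its measurability and square integral.\<close>

lemma circle_H1I:
  assumes ac: "abs_cont_on 0 (2 * pi) (\<lambda>\<theta>. u (cis \<theta>))" and h: "square_integrable h"
    and d: "AE \<theta> in lborel. \<theta> \<in> {0<..<2 * pi} \<longrightarrow>
      ((\<lambda>\<theta>. u (cis \<theta>)) has_vector_derivative \<i> * cis \<theta> * h (cis \<theta>)) (at \<theta>)"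
  shows "u \<in> circle_H1" "AE z in circle_measure. circle_deriv u z = h z"
proof -
  show ae: "AE z in circle_measure. circle_deriv u z = h z"
    unfolding AE_circle_measure_iff using d
  proof eventually_elim
    case (elim \<theta>)
    then show ?case using circle_deriv_eq[OF _ has_field_derivative_circle] by simp
  qed
  have "AE z in circle_measure. h z = circle_deriv u z" using ae by eventually_elim simp
  then have "square_integrable (circle_deriv u)" by (rule square_integrable_cong_AE[OF h])
  then show "u \<in> circle_H1" using ac by (simp add: circle_H1_def circle_absolutely_continuous_iff)
qed

text \<open>Conversely, absolute continuity gives differentiability at almost every angle, and there
  \<open>circle_deriv\<close> is the genuine derivative.\<close>

lemma
  assumes u: "u \<in> circle_H1"
  shows circle_H1_abs_cont: "abs_cont_on 0 (2 * pi) (\<lambda>\<theta>. u (cis \<theta>))"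
    and circle_H1_square_integrable_deriv: "square_integrable (circle_deriv u)"
    and circle_H1_square_integrable: "square_integrable u"
    and circle_H1_has_vector_derivative: "AE \<theta> in lborel. \<theta> \<in> {0<..<2 * pi} \<longrightarrow>
      ((\<lambda>\<theta>. u (cis \<theta>)) has_vector_derivative \<i> * cis \<theta> * circle_deriv u (cis \<theta>)) (at \<theta>)"
proof -
  show ac: "abs_cont_on 0 (2 * pi) (\<lambda>\<theta>. u (cis \<theta>))"
    using u by (simp add: circle_H1_def circle_absolutely_continuous_iff)
  have c: "continuous_on {0..2 * pi} (\<lambda>\<theta>. u (cis \<theta>))" by (rule abs_cont_on_imp_continuous_on[OF ac])
  show "square_integrable u" by (rule square_integrable_continuous[OF c])
  show "square_integrable (circle_deriv u)" using u by (simp add: circle_H1_def)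
  have "AE \<theta> in lborel. \<theta> \<in> {0<..<2 * pi} \<longrightarrow> (\<exists>d. ((\<lambda>\<theta>. u (cis \<theta>)) has_vector_derivative d) (at \<theta>))"
    by (rule abs_cont_differentiable_AE[OF ac]) simp
  then show "AE \<theta> in lborel. \<theta> \<in> {0<..<2 * pi} \<longrightarrow>
      ((\<lambda>\<theta>. u (cis \<theta>)) has_vector_derivative \<i> * cis \<theta> * circle_deriv u (cis \<theta>)) (at \<theta>)"
  proof eventually_elim
    case (elim \<theta>)
    show ?case
    proof
      assume \<theta>: "\<theta> \<in> {0<..<2 * pi}"
      then obtain d where d: "((\<lambda>\<theta>. u (cis \<theta>)) has_vector_derivative d) (at \<theta>)" using elim by blast
      then have "((\<lambda>\<theta>. u (cis \<theta>)) has_vector_derivative \<i> * cis \<theta> * (d / (\<i> * cis \<theta>))) (at \<theta>)" by simp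
      from has_field_derivative_circle[OF \<theta> this]
      have "circle_deriv u (cis \<theta>) = d / (\<i> * cis \<theta>)" by (intro circle_deriv_eq) auto
      then show "((\<lambda>\<theta>. u (cis \<theta>)) has_vector_derivative \<i> * cis \<theta> * circle_deriv u (cis \<theta>)) (at \<theta>)"
        using d by simp
    qed
  qed
qed

section \<open>Continuously differentiable multipliers on \<open>circle_H1\<close>\<close>

definition circle_C1 :: "(complex \<Rightarrow> complex) \<Rightarrow> bool" where
  "circle_C1 \<phi> \<longleftrightarrow> (\<forall>z\<in>circle. \<phi> field_differentiable (at z within circle)) \<and> continuous_on circle (circle_deriv \<phi>)"

lemma circle_differentiable_imp_continuous:
  "(\<And>z. z \<in> circle \<Longrightarrow> \<phi> field_differentiable (at z within circle)) \<Longrightarrow> continuous_on circle \<phi>"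
  by (simp add: continuous_on_eq_continuous_within field_differentiable_imp_continuous_at)

lemma circle_C1_continuous: "circle_C1 \<phi> \<Longrightarrow> continuous_on circle \<phi>"
  by (rule circle_differentiable_imp_continuous) (simp add: circle_C1_def)

lemma continuous_on_circle_bounded:
  fixes \<phi> :: "complex \<Rightarrow> complex"
  assumes "continuous_on circle \<phi>"
  obtains C where "\<And>z. z \<in> circle \<Longrightarrow> cmod (\<phi> z) \<le> C"
proof -
  have "bounded (\<phi> ` circle)"
    by (rule compact_imp_bounded[OF compact_continuous_image[OF assms compact_sphere]])
  then show ?thesis using that unfolding bounded_iff by blast
qed

lemma borel_measurable_continuous_circle:
  fixes \<phi> :: "complex \<Rightarrow> complex"
  assumes "continuous_on circle \<phi>"
  shows "\<phi> \<in> borel_measurable circle_measure"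
  by (rule borel_measurable_circle_measure[OF borel_measurable_continuous_on_restrict[OF assms]])

lemma circle_C1_has_vector_derivative:
  assumes "circle_C1 \<phi>"
  shows "((\<lambda>\<theta>. \<phi> (cis \<theta>)) has_vector_derivative \<i> * cis \<theta> * circle_deriv \<phi> (cis \<theta>)) (at \<theta>)"
  by (rule has_vector_derivative_circle[OF has_field_derivative_circle_deriv])
    (use assms in \<open>auto simp: circle_C1_def\<close>)

lemma abs_cont_on_bounded_derivative:
  fixes F :: "real \<Rightarrow> 'a::real_normed_vector"
  assumes F: "\<And>\<theta>. (F has_vector_derivative F' \<theta>) (at \<theta>)" and C: "\<And>\<theta>. \<theta> \<in> {l..r} \<Longrightarrow> norm (F' \<theta>) \<le> C"
  shows "abs_cont_on l r F"
proof (rule abs_cont_on_Lipschitz)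
  fix s t assume st: "s \<in> {l..r}" "t \<in> {l..r}"
  have "norm (F t - F s) \<le> C * norm (t - s)"
  proof (rule differentiable_bound[OF convex_box(1) _ _ st(2,1)[folded box_real(2)]])
    show "(F has_derivative (\<lambda>h. h *\<^sub>R F' \<theta>)) (at \<theta> within cbox l r)" for \<theta>
      using has_vector_derivative_at_within[OF F[of \<theta>], of "cbox l r"] by (simp add: has_vector_derivative_def)
    show "onorm (\<lambda>h. h *\<^sub>R F' \<theta>) \<le> C" if "\<theta> \<in> cbox l r" for \<theta>
    proof (rule onorm_le)
      show "norm (h *\<^sub>R F' \<theta>) \<le> C * norm h" for h
        using mult_left_mono[OF C, of \<theta> "\<bar>h\<bar>"] that by (simp add: mult.commute)
    qed
  qed
  then show "norm (F t - F s) \<le> C * \<bar>t - s\<bar>" by simp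
qed

lemma circle_C1_abs_cont:
  assumes "circle_C1 \<phi>"
  shows "abs_cont_on 0 (2 * pi) (\<lambda>\<theta>. \<phi> (cis \<theta>))"
proof -
  obtain C where C: "\<And>z. z \<in> circle \<Longrightarrow> cmod (circle_deriv \<phi> z) \<le> C"
    using continuous_on_circle_bounded assms unfolding circle_C1_def by metis
  show ?thesis
    by (rule abs_cont_on_bounded_derivative[OF circle_C1_has_vector_derivative[OF assms], where C = C])
      (use C in \<open>simp add: norm_mult\<close>)
qed

lemma circle_H1_mult_C1:
  assumes \<phi>: "circle_C1 \<phi>" and u: "u \<in> circle_H1"
  shows "(\<lambda>z. \<phi> z * u z) \<in> circle_H1"
    and "AE z in circle_measure. circle_deriv (\<lambda>z. \<phi> z * u z) z = circle_deriv \<phi> z * u z + \<phi> z * circle_deriv u z"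
proof -
  let ?h = "\<lambda>z. circle_deriv \<phi> z * u z + \<phi> z * circle_deriv u z"
  have ac: "abs_cont_on 0 (2 * pi) (\<lambda>\<theta>. \<phi> (cis \<theta>) * u (cis \<theta>))"
    by (rule abs_cont_on_mult[OF circle_C1_abs_cont[OF \<phi>] circle_H1_abs_cont[OF u]])
  have c: "continuous_on circle \<phi>" "continuous_on circle (circle_deriv \<phi>)"
    using circle_C1_continuous[OF \<phi>] \<phi> by (auto simp: circle_C1_def)
  obtain C where C: "\<And>z. z \<in> circle \<Longrightarrow> cmod (\<phi> z) \<le> C"
    using continuous_on_circle_bounded[OF c(1)] by blast
  obtain C' where C': "\<And>z. z \<in> circle \<Longrightarrow> cmod (circle_deriv \<phi> z) \<le> C'"
    using continuous_on_circle_bounded[OF c(2)] by blast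
  have h: "square_integrable ?h"
    by (intro square_integrable_add
        square_integrable_bounded_mult[OF borel_measurable_continuous_circle[OF c(2)] C' circle_H1_square_integrable[OF u]]
        square_integrable_bounded_mult[OF borel_measurable_continuous_circle[OF c(1)] C circle_H1_square_integrable_deriv[OF u]])
  have d: "AE \<theta> in lborel. \<theta> \<in> {0<..<2 * pi} \<longrightarrow>
      ((\<lambda>\<theta>. \<phi> (cis \<theta>) * u (cis \<theta>)) has_vector_derivative \<i> * cis \<theta> * ?h (cis \<theta>)) (at \<theta>)"
    using circle_H1_has_vector_derivative[OF u]
  proof eventually_elim
    case (elim \<theta>)
    show ?case
    proof
      assume "\<theta> \<in> {0<..<2 * pi}"
      from has_vector_derivative_mult[OF circle_C1_has_vector_derivative[OF \<phi>] elim[rule_format, OF this]]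
      show "((\<lambda>\<theta>. \<phi> (cis \<theta>) * u (cis \<theta>)) has_vector_derivative \<i> * cis \<theta> * ?h (cis \<theta>)) (at \<theta>)"
        by (simp add: algebra_simps)
    qed
  qed
  show "(\<lambda>z. \<phi> z * u z) \<in> circle_H1" "AE z in circle_measure. circle_deriv (\<lambda>z. \<phi> z * u z) z = ?h z"
    by (rule circle_H1I[OF ac h d])+
qed

lemma circle_H1_add:
  assumes u: "u \<in> circle_H1" and v: "v \<in> circle_H1"
  shows "(\<lambda>z. u z + v z) \<in> circle_H1"
    and "AE z in circle_measure. circle_deriv (\<lambda>z. u z + v z) z = circle_deriv u z + circle_deriv v z"
proof -
  let ?h = "\<lambda>z. circle_deriv u z + circle_deriv v z"
  have ac: "abs_cont_on 0 (2 * pi) (\<lambda>\<theta>. u (cis \<theta>) + v (cis \<theta>))"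
    by (rule abs_cont_on_add[OF circle_H1_abs_cont[OF u] circle_H1_abs_cont[OF v]])
  have h: "square_integrable ?h"
    by (intro square_integrable_add circle_H1_square_integrable_deriv u v)
  have d: "AE \<theta> in lborel. \<theta> \<in> {0<..<2 * pi} \<longrightarrow>
      ((\<lambda>\<theta>. u (cis \<theta>) + v (cis \<theta>)) has_vector_derivative \<i> * cis \<theta> * ?h (cis \<theta>)) (at \<theta>)"
    using circle_H1_has_vector_derivative[OF u] circle_H1_has_vector_derivative[OF v]
  proof eventually_elim
    case (elim \<theta>)
    then show ?case using has_vector_derivative_add by (fastforce simp: distrib_left)
  qed
  show "(\<lambda>z. u z + v z) \<in> circle_H1" "AE z in circle_measure. circle_deriv (\<lambda>z. u z + v z) z = ?h z"
    by (rule circle_H1I[OF ac h d])+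
qed

lemma circle_deriv_const: "z \<in> circle \<Longrightarrow> circle_deriv (\<lambda>_. c) z = 0"
  by (rule circle_deriv_eq) auto

lemma circle_C1_const: "circle_C1 (\<lambda>_. c)"
  unfolding circle_C1_def
proof
  show "continuous_on circle (circle_deriv (\<lambda>_. c))"
    by (rule continuous_on_eq[OF continuous_on_const[of _ 0]]) (simp add: circle_deriv_const)
qed simp

lemma circle_H1_scale:
  assumes u: "u \<in> circle_H1"
  shows "(\<lambda>z. c * u z) \<in> circle_H1"
    and "AE z in circle_measure. circle_deriv (\<lambda>z. c * u z) z = c * circle_deriv u z"
proof -
  show "(\<lambda>z. c * u z) \<in> circle_H1" by (rule circle_H1_mult_C1(1)[OF circle_C1_const u])
  show "AE z in circle_measure. circle_deriv (\<lambda>z. c * u z) z = c * circle_deriv u z"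
    using circle_H1_mult_C1(2)[OF circle_C1_const u] AE_circle_space
    by eventually_elim (simp add: circle_deriv_const)
qed

section \<open>First-order operators on the circle\<close>

text \<open>In the angle this is \<open>F' - c F\<close> with periodic boundary condition. The
  parameter is complex because the resolvent of the component \<open>n = 0\<close> needs imaginary
  values.\<close>

definition first_order_graph :: "complex \<Rightarrow> (circle_L2 \<times> circle_L2) set" where
  "first_order_graph c = {(class_L2 v, class_L2 (\<lambda>z. \<i> * z * circle_deriv v z - c * v z)) | v. v \<in> circle_H1}"

lemma borel_measurable_ident_circle: "(\<lambda>z. \<i> * z) \<in> borel_measurable circle_measure"
  by (rule borel_measurable_continuous_circle) (intro continuous_intros)

lemma square_integrable_first_order:
  assumes v: "v \<in> circle_H1"
  shows "square_integrable (\<lambda>z. \<i> * z * circle_deriv v z - c * v z)"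
  by (intro square_integrable_diff square_integrable_scale circle_H1_square_integrable[OF v]
      square_integrable_bounded_mult[OF borel_measurable_ident_circle, of 1] circle_H1_square_integrable_deriv[OF v])
    (simp add: norm_mult)

lemma first_order_graph_add:
  assumes "(x, y) \<in> first_order_graph c" "(x', y') \<in> first_order_graph c"
  shows "(x + x', y + y') \<in> first_order_graph c"
proof -
  obtain v v' where v: "v \<in> circle_H1" "x = class_L2 v" "y = class_L2 (\<lambda>z. \<i> * z * circle_deriv v z - c * v z)"
    and v': "v' \<in> circle_H1" "x' = class_L2 v'" "y' = class_L2 (\<lambda>z. \<i> * z * circle_deriv v' z - c * v' z)"
    using assms unfolding first_order_graph_def by blast
  let ?w = "\<lambda>z. v z + v' z"
  have w: "?w \<in> circle_H1" by (rule circle_H1_add(1)[OF v(1) v'(1)])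
  have 1: "x + x' = class_L2 ?w"
    using v v' by (simp add: class_L2_add circle_H1_square_integrable)
  have "y + y' = class_L2 (\<lambda>z. (\<i> * z * circle_deriv v z - c * v z) + (\<i> * z * circle_deriv v' z - c * v' z))"
    unfolding v(3) v'(3) by (rule class_L2_add[symmetric]; rule square_integrable_first_order; fact)
  also have "\<dots> = class_L2 (\<lambda>z. \<i> * z * circle_deriv ?w z - c * ?w z)"
  proof (subst class_L2_eq_iff)
    show "AE z in circle_measure. (\<i> * z * circle_deriv v z - c * v z) + (\<i> * z * circle_deriv v' z - c * v' z) =
        \<i> * z * circle_deriv ?w z - c * ?w z"
      using circle_H1_add(2)[OF v(1) v'(1)] by eventually_elim (simp add: algebra_simps)
  qed (intro square_integrable_add square_integrable_first_order v v' w)+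
  finally show ?thesis using 1 w unfolding first_order_graph_def by blast
qed

lemma first_order_graph_scaleC:
  assumes "(x, y) \<in> first_order_graph c"
  shows "(scaleC k x, scaleC k y) \<in> first_order_graph c"
proof -
  obtain v where v: "v \<in> circle_H1" "x = class_L2 v" "y = class_L2 (\<lambda>z. \<i> * z * circle_deriv v z - c * v z)"
    using assms unfolding first_order_graph_def by blast
  let ?w = "\<lambda>z. k * v z"
  have w: "?w \<in> circle_H1" by (rule circle_H1_scale(1)[OF v(1)])
  have 1: "scaleC k x = class_L2 ?w"
    using v by (simp add: class_L2_scaleC circle_H1_square_integrable)
  have "scaleC k y = class_L2 (\<lambda>z. k * (\<i> * z * circle_deriv v z - c * v z))"
    unfolding v(3) by (rule class_L2_scaleC[symmetric], rule square_integrable_first_order, fact)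
  also have "\<dots> = class_L2 (\<lambda>z. \<i> * z * circle_deriv ?w z - c * ?w z)"
  proof (subst class_L2_eq_iff)
    show "AE z in circle_measure. k * (\<i> * z * circle_deriv v z - c * v z) = \<i> * z * circle_deriv ?w z - c * ?w z"
      using circle_H1_scale(2)[OF v(1), of k] by eventually_elim (simp add: algebra_simps)
  qed (intro square_integrable_scale square_integrable_first_order v w)+
  finally show ?thesis using 1 w unfolding first_order_graph_def by blast
qed

text \<open>Moves a spectral parameter between operator and right-hand side; the converse inclusion
  is the direct one for \<open>- d\<close>.\<close>

lemma first_order_graph_shift:
  "(x, y) \<in> first_order_graph (c + d) \<longleftrightarrow> (x, y + scaleC d x) \<in> first_order_graph c"
proof -
  have *: "(x, y + scaleC d x) \<in> first_order_graph c" if A: "(x, y) \<in> first_order_graph (c + d)" for x y c d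
  proof -
    obtain v where v: "v \<in> circle_H1" "x = class_L2 v" "y = class_L2 (\<lambda>z. \<i> * z * circle_deriv v z - (c + d) * v z)"
      using A unfolding first_order_graph_def by blast
    have "y + scaleC d x = class_L2 (\<lambda>z. (\<i> * z * circle_deriv v z - (c + d) * v z) + d * v z)"
      using v by (simp add: class_L2_add class_L2_scaleC square_integrable_scale circle_H1_square_integrable
          square_integrable_first_order)
    also have "\<dots> = class_L2 (\<lambda>z. \<i> * z * circle_deriv v z - c * v z)"
      by (simp add: algebra_simps)
    finally show ?thesis using v unfolding first_order_graph_def by blast
  qed
  have "(x, (y + scaleC d x) + scaleC (- d) x) \<in> first_order_graph (c + d)" if "(x, y + scaleC d x) \<in> first_order_graph c"
    by (rule *) (use that in simp)
  moreover have "(y + scaleC d x) + scaleC (- d) x = y"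
    using scaleC_add_left[of d "- d" x] scaleC_of_real[of 0 x] by (simp add: add.assoc)
  ultimately show ?thesis using * by metis
qed

text \<open>The derivative of the periodic function \<open>v * cnj v\<close> integrates to zero. For
  real \<open>c\<close> this reads \<open>c * (norm x)^2 = - inner y x\<close>, and Cauchy-Schwarz
  gives the bound without using invertibility.\<close>

lemma first_order_graph_bound:
  assumes "(x, y) \<in> first_order_graph (complex_of_real c)"
  shows "\<bar>c\<bar> * norm x \<le> norm y"
proof -
  obtain v where v: "v \<in> circle_H1" "x = class_L2 v"
    and y: "y = class_L2 (\<lambda>z. \<i> * z * circle_deriv v z - complex_of_real c * v z)"
    using assms unfolding first_order_graph_def by blast
  define g where "g z = \<i> * z * circle_deriv v z - complex_of_real c * v z" for z
  have sv: "square_integrable v" and sg: "square_integrable g"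
    using circle_H1_square_integrable[OF v(1)] square_integrable_first_order[OF v(1)] by (auto simp: g_def[abs_def])
  \<comment> \<open>The derivative of \<open>v * cnj v\<close> in the angle, with the derivative of
    \<open>v\<close> replaced by \<open>g + c * v\<close>.\<close>
  define h where "h z = complex_of_real (2 * c) * (v z * cnj (v z)) + (g z * cnj (v z) + v z * cnj (g z))" for z
  have int: "integrable circle_measure (\<lambda>z. v z * cnj (v z))" "integrable circle_measure (\<lambda>z. g z * cnj (v z))"
    "integrable circle_measure (\<lambda>z. v z * cnj (g z))"
    by (rule square_integrable_inner; fact)+
  have hi: "integrable circle_measure h" unfolding h_def using int by simp
  have "AE \<theta> in lborel. \<theta> \<in> {0<..<2 * pi} \<longrightarrow>
      ((\<lambda>\<theta>. v (cis \<theta>) * cnj (v (cis \<theta>))) has_vector_derivative h (cis \<theta>)) (at \<theta>)"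
    using circle_H1_has_vector_derivative[OF v(1)]
  proof eventually_elim
    case (elim \<theta>)
    show ?case
    proof
      assume "\<theta> \<in> {0<..<2 * pi}"
      then have d: "((\<lambda>\<theta>. v (cis \<theta>)) has_vector_derivative \<i> * cis \<theta> * circle_deriv v (cis \<theta>)) (at \<theta>)"
        using elim by blast
      from has_vector_derivative_mult[OF d has_vector_derivative_cnj[OF d]]
      show "((\<lambda>\<theta>. v (cis \<theta>) * cnj (v (cis \<theta>))) has_vector_derivative h (cis \<theta>)) (at \<theta>)"
        by (rule has_vector_derivative_eq_rhs) (simp add: h_def g_def algebra_simps)
    qed
  qed
  moreover have "abs_cont_on 0 (2 * pi) (\<lambda>\<theta>. v (cis \<theta>) * cnj (v (cis \<theta>)))"
    using circle_H1_abs_cont[OF v(1)]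
    by (intro abs_cont_on_mult abs_cont_on_bounded_linear[OF bounded_linear_cnj])
  ultimately have "((\<lambda>\<theta>. h (cis \<theta>)) has_integral
      (v (cis (2 * pi)) * cnj (v (cis (2 * pi))) - v (cis 0) * cnj (v (cis 0)))) {0..2 * pi}"
    by (intro abs_cont_fundamental_theorem(2)) auto
  then have "integral {0..2 * pi} (\<lambda>\<theta>. h (cis \<theta>)) = 0" by (simp add: integral_unique)
  then have "integral\<^sup>L circle_measure h = 0"
    using integral_circle_eq[OF _ hi] borel_measurable_integrable[OF hi] by simp
  moreover have "Re (integral\<^sup>L circle_measure h) = 2 * c * (norm x)\<^sup>2 + 2 * inner y x"
  proof -
    have "Re (integral\<^sup>L circle_measure h) = 2 * c * inner x x + (inner y x + inner x y)"
      unfolding h_def v(2) y using int sv sg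
      by (simp add: inner_class_L2 g_def[symmetric] del: of_real_mult)
    then show ?thesis by (simp add: inner_commute power2_norm_eq_inner)
  qed
  ultimately have "c * (norm x)\<^sup>2 = - inner y x" by simp
  then have "\<bar>c\<bar> * (norm x)\<^sup>2 = \<bar>inner y x\<bar>" by (metis abs_minus_cancel abs_mult abs_power2 abs_norm_cancel power2_abs)
  also have "\<dots> \<le> norm y * norm x" by (rule Cauchy_Schwarz_ineq2)
  finally have "(\<bar>c\<bar> * norm x) * norm x \<le> norm y * norm x" by (simp add: power2_eq_square mult.assoc)
  then show ?thesis
    by (cases "x = 0") simp_all
qed

text \<open>Variation of constants for \<open>F' = c F + G\<close>. The first summand in the bracket
  is the initial value, obtained by solving \<open>F 0 = F (2 * pi)\<close>; this is possible when
  \<open>exp (2 * pi * c)\<close> differs from \<open>1\<close>.\<close>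

definition periodic_solution :: "complex \<Rightarrow> (real \<Rightarrow> complex) \<Rightarrow> real \<Rightarrow> complex" where
  "periodic_solution c G \<theta> = exp (c * complex_of_real \<theta>) *
     (exp (2 * complex_of_real pi * c) / (1 - exp (2 * complex_of_real pi * c)) *
        integral {0..2 * pi} (\<lambda>s. exp (- c * complex_of_real s) * G s) +
      integral {0..\<theta>} (\<lambda>s. exp (- c * complex_of_real s) * G s))"

lemma has_vector_derivative_exp: "((\<lambda>\<theta>. exp (c * complex_of_real \<theta>)) has_vector_derivative c * exp (c * complex_of_real \<theta>)) (at \<theta> within S)"
proof -
  have "((\<lambda>z. exp (c * z)) has_field_derivative c * exp (c * complex_of_real \<theta>)) (at (complex_of_real \<theta>) within complex_of_real ` S)"
    by (auto intro!: derivative_eq_intros)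
  moreover have "(complex_of_real has_vector_derivative 1) (at \<theta> within S)"
    unfolding has_vector_derivative_complex_iff by simp
  ultimately show ?thesis
    using field_vector_diff_chain_within[of complex_of_real 1 \<theta> S] by (simp add: o_def)
qed

lemma norm_exp_le: "\<theta> \<in> {0..2 * pi} \<Longrightarrow> cmod (exp (c * complex_of_real \<theta>)) \<le> exp (2 * pi * cmod c)"
proof -
  assume \<theta>: "\<theta> \<in> {0..2 * pi}"
  have "Re c * \<theta> \<le> cmod c * \<theta>" using \<theta> by (intro mult_right_mono complex_Re_le_cmod) auto
  also have "\<dots> \<le> cmod c * (2 * pi)" using \<theta> by (intro mult_left_mono) auto
  finally show ?thesis by (simp add: mult.commute)
qed

lemma abs_cont_on_exp: "abs_cont_on 0 (2 * pi) (\<lambda>\<theta>. exp (c * complex_of_real \<theta>))"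
proof (rule abs_cont_on_bounded_derivative[OF has_vector_derivative_exp])
  show "cmod (c * exp (c * complex_of_real \<theta>)) \<le> cmod c * exp (2 * pi * cmod c)" if "\<theta> \<in> {0..2 * pi}" for \<theta>
    unfolding norm_mult using norm_exp_le[OF that] by (intro mult_left_mono) auto
qed

text \<open>The exponential is not periodic in general, hence no function on the circle. Written
  through \<open>Arg2pi\<close> it becomes a bounded measurable one that differs only at the angle
  \<open>2 * pi\<close>.\<close>

lemma
  assumes g: "square_integrable g"
  shows exp_mult_absolutely_integrable: "(\<lambda>s. exp (- c * complex_of_real s) * g (cis s)) absolutely_integrable_on {0..2 * pi}"
    and exp_mult_square_integrable: "(\<lambda>s. (norm (exp (- c * complex_of_real s) * g (cis s)))\<^sup>2) integrable_on {0..2 * pi}"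
proof -
  define h where "h z = exp (- c * complex_of_real (Arg2pi z)) * g z" for z
  have "(\<lambda>z. exp (- c * complex_of_real (Arg2pi z))) \<in> borel_measurable circle_measure"
    by (intro borel_measurable_circle_measure borel_measurable_circle_Arg2pi) (intro continuous_intros)
  moreover have "cmod (exp (- c * complex_of_real (Arg2pi z))) \<le> exp (2 * pi * cmod c)" for z
    using norm_exp_le[of "Arg2pi z" "- c"] Arg2pi_bounds[of z] by simp
  ultimately have h: "square_integrable h"
    unfolding h_def by (rule square_integrable_bounded_mult[OF _ _ g])
  then have hm: "h \<in> borel_measurable circle_measure" by (simp add: square_integrable_def)
  have eq: "exp (- c * complex_of_real s) * g (cis s) = h (cis s)" if "s \<in> {0..2 * pi} - {2 * pi}" for s
    using that by (simp add: h_def Arg2pi_cis)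
  have n: "negligible {2 * pi}" by simp
  have "(\<lambda>s. h (cis s)) absolutely_integrable_on {0..2 * pi}"
    using square_integrable_imp_integrable[OF h] integrable_circle_iff[OF hm] by simp
  then show "(\<lambda>s. exp (- c * complex_of_real s) * g (cis s)) absolutely_integrable_on {0..2 * pi}"
    by (rule absolutely_integrable_spike[OF _ n eq])
  have "(\<lambda>s. (cmod (h (cis s)))\<^sup>2) integrable_on {0..2 * pi}"
    using h square_integrable_iff[OF hm] by simp
  then show "(\<lambda>s. (norm (exp (- c * complex_of_real s) * g (cis s)))\<^sup>2) integrable_on {0..2 * pi}"
    by (rule integrable_spike[OF _ n]) (simp only: eq)
qed

context
  fixes c :: complex and g :: "complex \<Rightarrow> complex"
  assumes c: "exp (2 * complex_of_real pi * c) \<noteq> 1" and g: "square_integrable g"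
begin

lemma periodic_solution_abs_cont: "abs_cont_on 0 (2 * pi) (periodic_solution c (\<lambda>s. g (cis s)))"
  unfolding periodic_solution_def
  by (intro abs_cont_on_mult abs_cont_on_add abs_cont_on_exp abs_cont_on_indefinite_integral exp_mult_absolutely_integrable
      exp_mult_square_integrable g
      abs_cont_on_Lipschitz[where C = 0]) auto

lemma periodic_solution_periodic:
  "periodic_solution c (\<lambda>s. g (cis s)) 0 = periodic_solution c (\<lambda>s. g (cis s)) (2 * pi)"
proof -
  have "k = e * (k + w)" if "e \<noteq> 1" "k = e / (1 - e) * w" for k e w :: complex
    using that by (simp add: field_simps)
  note eq = this
  define e where "e = exp (2 * complex_of_real pi * c)"
  define w where "w = integral {0..2 * pi} (\<lambda>s. exp (- c * complex_of_real s) * g (cis s))"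
  have e: "exp (c * complex_of_real (2 * pi)) = e" by (simp add: e_def mult_ac)
  have "e \<noteq> 1" using c by (simp add: e_def)
  have "periodic_solution c (\<lambda>s. g (cis s)) 0 = e / (1 - e) * w"
    unfolding periodic_solution_def e_def[symmetric] w_def[symmetric] by simp
  also have "\<dots> = e * (e / (1 - e) * w + w)" by (rule eq[OF \<open>e \<noteq> 1\<close> refl])
  also have "\<dots> = periodic_solution c (\<lambda>s. g (cis s)) (2 * pi)"
    unfolding periodic_solution_def e e_def[symmetric] w_def[symmetric] ..
  finally show ?thesis .
qed

lemma periodic_solution_has_derivative:
  "AE \<theta> in lborel. \<theta> \<in> {0<..<2 * pi} \<longrightarrow>
    (periodic_solution c (\<lambda>s. g (cis s)) has_vector_derivative c * periodic_solution c (\<lambda>s. g (cis s)) \<theta> + g (cis \<theta>)) (at \<theta>)"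
proof -
  have "AE \<theta> in lborel. \<theta> \<in> {0<..<2 * pi} \<longrightarrow>
      ((\<lambda>\<theta>. integral {0..\<theta>} (\<lambda>s. exp (- c * complex_of_real s) * g (cis s))) has_vector_derivative exp (- c * complex_of_real \<theta>) * g (cis \<theta>)) (at \<theta>)"
    by (rule indefinite_integral_has_vector_derivative_AE)
      (use exp_mult_absolutely_integrable[OF g] in \<open>simp add: absolutely_integrable_on_def\<close>)
  then show ?thesis
  proof eventually_elim
    case (elim \<theta>)
    show ?case
    proof
      assume "\<theta> \<in> {0<..<2 * pi}"
      with elim have d: "((\<lambda>\<theta>. integral {0..\<theta>} (\<lambda>s. exp (- c * complex_of_real s) * g (cis s))) has_vector_derivative exp (- c * complex_of_real \<theta>) * g (cis \<theta>)) (at \<theta>)"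
        by blast
      define k where "k = exp (2 * complex_of_real pi * c) / (1 - exp (2 * complex_of_real pi * c)) * integral {0..2 * pi} (\<lambda>s. exp (- c * complex_of_real s) * g (cis s))"
      have "((\<lambda>\<theta>. k + integral {0..\<theta>} (\<lambda>s. exp (- c * complex_of_real s) * g (cis s))) has_vector_derivative 0 + exp (- c * complex_of_real \<theta>) * g (cis \<theta>)) (at \<theta>)"
        by (intro has_vector_derivative_add has_vector_derivative_const d)
      from has_vector_derivative_mult[OF has_vector_derivative_exp this, of c]
      show "(periodic_solution c (\<lambda>s. g (cis s)) has_vector_derivative c * periodic_solution c (\<lambda>s. g (cis s)) \<theta> + g (cis \<theta>)) (at \<theta>)"
        unfolding periodic_solution_def[abs_def] k_def[symmetric]
        by (rule has_vector_derivative_eq_rhs) (simp add: algebra_simps exp_minus)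
    qed
  qed
qed

text \<open>The integrating factor \<open>exp (- c \<theta>)\<close> turns the equation into a known
  derivative. The fundamental theorem determines \<open>F\<close> from \<open>F 0\<close>, and
  periodicity determines \<open>F 0\<close>.\<close>

lemma periodic_solution_unique:
  assumes ac: "abs_cont_on 0 (2 * pi) F" and per: "F 0 = F (2 * pi)"
    and d: "AE \<theta> in lborel. \<theta> \<in> {0<..<2 * pi} \<longrightarrow> (F has_vector_derivative c * F \<theta> + g (cis \<theta>)) (at \<theta>)"
    and \<theta>: "\<theta> \<in> {0..2 * pi}"
  shows "F \<theta> = periodic_solution c (\<lambda>s. g (cis s)) \<theta>"
proof -
  define W where "W \<theta> = integral {0..\<theta>} (\<lambda>s. exp (- c * complex_of_real s) * g (cis s))" for \<theta> :: real
  have "abs_cont_on 0 (2 * pi) (\<lambda>\<theta>. exp (- c * complex_of_real \<theta>) * F \<theta>)"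
    by (rule abs_cont_on_mult[OF abs_cont_on_exp ac])
  moreover have "AE \<theta> in lborel. \<theta> \<in> {0<..<2 * pi} \<longrightarrow>
      ((\<lambda>\<theta>. exp (- c * complex_of_real \<theta>) * F \<theta>) has_vector_derivative exp (- c * complex_of_real \<theta>) * g (cis \<theta>)) (at \<theta>)"
    using d
  proof eventually_elim
    case (elim \<theta>)
    show ?case
    proof
      assume "\<theta> \<in> {0<..<2 * pi}"
      from has_vector_derivative_mult[OF has_vector_derivative_exp elim[rule_format, OF this], of "- c"]
      show "((\<lambda>\<theta>. exp (- c * complex_of_real \<theta>) * F \<theta>) has_vector_derivative exp (- c * complex_of_real \<theta>) * g (cis \<theta>)) (at \<theta>)"
        by (rule has_vector_derivative_eq_rhs) (simp add: algebra_simps)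
    qed
  qed
  ultimately have "((\<lambda>\<theta>. exp (- c * complex_of_real \<theta>) * g (cis \<theta>)) has_integral
      (exp (- c * complex_of_real t) * F t - exp (- c * complex_of_real 0) * F 0)) {0..t}" if "t \<in> {0..2 * pi}" for t
    using that by (intro abs_cont_fundamental_theorem(2)[of 0 "2 * pi"]) auto
  then have "W t = exp (- c * complex_of_real t) * F t - F 0" if "t \<in> {0..2 * pi}" for t
    unfolding W_def using that by (simp add: integral_unique)
  then have F: "F t = exp (c * complex_of_real t) * (F 0 + W t)" if "t \<in> {0..2 * pi}" for t
    using that by (simp add: exp_minus field_simps)
  have "k = e / (1 - e) * w" if "e \<noteq> 1" "k = e * (k + w)" for k e w :: complex
    using that by (simp add: field_simps)
  moreover have "exp (c * complex_of_real (2 * pi)) = exp (2 * complex_of_real pi * c)" by (simp add: mult_ac)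
  ultimately have "F 0 = exp (2 * complex_of_real pi * c) / (1 - exp (2 * complex_of_real pi * c)) * W (2 * pi)"
    using F[of "2 * pi"] per c by simp
  then show ?thesis
    using F[OF \<theta>] unfolding periodic_solution_def W_def[symmetric] by simp
qed

end

lemma norm_class_L2_le:
  assumes f: "square_integrable f" and B: "\<And>z. z \<in> circle \<Longrightarrow> cmod (f z) \<le> B" "0 \<le> B"
  shows "norm (class_L2 f) \<le> B"
proof -
  have "ennreal ((norm (class_L2 f))\<^sup>2) = (\<integral>\<^sup>+z. ennreal ((cmod (f z))\<^sup>2) \<partial>circle_measure)"
    by (rule nn_integral_norm_class_L2[OF f, symmetric])
  also have "\<dots> \<le> (\<integral>\<^sup>+z. ennreal (B\<^sup>2) \<partial>circle_measure)"
    by (rule nn_integral_mono) (use B in \<open>auto intro!: ennreal_leI power_mono\<close>)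
  also have "\<dots> = ennreal (B\<^sup>2)" using prob_space_circle by simp
  finally have "(norm (class_L2 f))\<^sup>2 \<le> B\<^sup>2" by simp
  then show ?thesis using B(2) by (rule power2_le_imp_le)
qed

text \<open>Points of the closure are replaced by points of \<open>X\<close> at distance below
  \<open>1 / (n + 1)\<close>, which does not change limits of subsequences.\<close>

lemma compact_closure_sequentialI:
  fixes X :: "'a::metric_space set"
  assumes sub: "\<And>s :: nat \<Rightarrow> 'a. (\<And>n. s n \<in> X) \<Longrightarrow> \<exists>l r. strict_mono r \<and> (s \<circ> r) \<longlonglongrightarrow> l"
  shows "compact (closure X)"
  unfolding compact_eq_seq_compact_metric
proof (rule seq_compactI)
  fix y :: "nat \<Rightarrow> 'a" assume y: "\<forall>n. y n \<in> closure X"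
  have "\<exists>x\<in>X. dist x (y n) < inverse (real (Suc n))" for n
    using y by (simp add: closure_approachable)
  then obtain x where x: "\<And>n. x n \<in> X" "\<And>n. dist (x n) (y n) < inverse (real (Suc n))" by metis
  from sub[of x, OF x(1)] obtain l r where r: "strict_mono r" "(x \<circ> r) \<longlonglongrightarrow> l" by blast
  have "(\<lambda>n. inverse (real (Suc (r n)))) \<longlonglongrightarrow> 0"
    using LIMSEQ_subseq_LIMSEQ[OF LIMSEQ_inverse_real_of_nat r(1)] by (simp add: o_def)
  moreover have "(\<lambda>n. dist (x (r n)) l) \<longlonglongrightarrow> 0"
    using r(2)[THEN tendsto_dist_iff[THEN iffD1]] by (simp add: o_def)
  ultimately have lim: "(\<lambda>n. inverse (real (Suc (r n))) + dist (x (r n)) l) \<longlonglongrightarrow> 0"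
    by (rule tendsto_add_zero)
  have le: "norm (dist ((y \<circ> r) n) l) \<le> inverse (real (Suc (r n))) + dist (x (r n)) l" for n
    using dist_triangle3[of "y (r n)" l "x (r n)"] x(2)[of "r n"] by simp
  have "(\<lambda>n. dist ((y \<circ> r) n) l) \<longlonglongrightarrow> 0"
    by (rule Lim_null_comparison[OF _ lim]) (intro always_eventually allI le)
  then have "(y \<circ> r) \<longlonglongrightarrow> l" by (rule tendsto_dist_iff[THEN iffD2])
  moreover have "l \<in> closure X"
    using r(2) x(1) by (auto simp: closure_sequential intro!: exI[of _ "x \<circ> r"])
  ultimately show "\<exists>l\<in>closure X. \<exists>r. strict_mono r \<and> (y \<circ> r) \<longlonglongrightarrow> l" using r(1) by blast
qed

text \<open>The constant \<open>2 * pi\<close> undoes the normalisation of the measure: a unit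
  vector has square integral at most \<open>2 * pi\<close> in the angle. \<open>K\<close> stays free
  for later optimisation.\<close>

lemma
  assumes g: "square_integrable g" and n: "norm (class_L2 g) \<le> 1"
  shows circle_unit_ball_abs_integrable: "(\<lambda>s. g (cis s)) absolutely_integrable_on {0..2 * pi}"
    and circle_unit_ball_L1: "\<And>s t K. 0 \<le> s \<Longrightarrow> s \<le> t \<Longrightarrow> t \<le> 2 * pi \<Longrightarrow> K > 0 \<Longrightarrow>
      integral {s..t} (\<lambda>x. cmod (g (cis x))) \<le> (K * (t - s) + 2 * pi / K) / 2"
proof -
  have gm: "g \<in> borel_measurable circle_measure" using g by (simp add: square_integrable_def)
  show ai: "(\<lambda>s. g (cis s)) absolutely_integrable_on {0..2 * pi}"
    using square_integrable_imp_integrable[OF g] integrable_circle_iff[OF gm] by simp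
  fix s t K :: real assume st: "0 \<le> s" "s \<le> t" "t \<le> 2 * pi" "K > 0"
  have sq: "(\<lambda>x. (cmod (g (cis x)))\<^sup>2) integrable_on {0..2 * pi}" using g square_integrable_iff[OF gm] by simp
  have "(norm (class_L2 g))\<^sup>2 \<le> 1" using n by (simp add: power_le_one)
  then have I: "integral {0..2 * pi} (\<lambda>x. (cmod (g (cis x)))\<^sup>2) \<le> 2 * pi"
    unfolding norm_class_L2[OF g] integral_circle_square_eq[OF gm g] by simp
  have sqst: "(\<lambda>x. (cmod (g (cis x)))\<^sup>2) integrable_on {s..t}"
    by (rule integrable_on_subinterval[OF sq]) (use st in auto)
  have "integral {s..t} (\<lambda>x. cmod (g (cis x))) \<le> (K * (t - s) + integral {s..t} (\<lambda>x. (cmod (g (cis x)))\<^sup>2) / K) / 2"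
    by (rule integral_norm_le_AM_GM[OF absolutely_integrable_on_subinterval[OF ai] sqst]) (use st in auto)
  moreover have "integral {s..t} (\<lambda>x. (cmod (g (cis x)))\<^sup>2) \<le> integral {0..2 * pi} (\<lambda>x. (cmod (g (cis x)))\<^sup>2)"
    by (rule integral_subset_le) (use st sq sqst in auto)
  ultimately show "integral {s..t} (\<lambda>x. cmod (g (cis x))) \<le> (K * (t - s) + 2 * pi / K) / 2"
    using I \<open>K > 0\<close> by (smt (verit) divide_right_mono)
qed

text \<open>Uniformity over the unit ball is the point: it is the boundedness hypothesis of
  Arzela-Ascoli.\<close>

lemma periodic_solution_bound:
  obtains B where "B \<ge> 0" "\<And>g \<theta>. square_integrable g \<Longrightarrow> norm (class_L2 g) \<le> 1 \<Longrightarrow> \<theta> \<in> {0..2 * pi} \<Longrightarrow>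
    cmod (periodic_solution c (\<lambda>s. g (cis s)) \<theta>) \<le> B"
proof
  let ?M = "exp (2 * pi * cmod c)"
  let ?q = "cmod (exp (2 * complex_of_real pi * c) / (1 - exp (2 * complex_of_real pi * c)))"
  show "0 \<le> ?M * (?q * (?M * (2 * pi)) + ?M * (2 * pi))"
    by (intro mult_nonneg_nonneg add_nonneg_nonneg) auto
  fix g \<theta> assume g: "square_integrable g" "norm (class_L2 g) \<le> 1" and \<theta>: "\<theta> \<in> {0..2 * pi}"
  have W: "cmod (integral {0..t} (\<lambda>s. exp (- c * complex_of_real s) * g (cis s))) \<le> ?M * (2 * pi)"
    if t: "t \<in> {0..2 * pi}" for t
  proof -
    have ai: "(\<lambda>s. g (cis s)) absolutely_integrable_on {0..t}"
      by (rule absolutely_integrable_on_subinterval[OF circle_unit_ball_abs_integrable[OF g]]) (use t in auto)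
    have ei: "(\<lambda>s. exp (- c * complex_of_real s) * g (cis s)) absolutely_integrable_on {0..t}"
      by (rule absolutely_integrable_on_subinterval[OF exp_mult_absolutely_integrable[OF g(1)]]) (use t in auto)
    have "cmod (integral {0..t} (\<lambda>s. exp (- c * complex_of_real s) * g (cis s))) \<le>
        integral {0..t} (\<lambda>s. ?M * cmod (g (cis s)))"
    proof (rule integral_norm_bound_integral)
      show "(\<lambda>s. exp (- c * complex_of_real s) * g (cis s)) integrable_on {0..t}"
        using ei by (simp add: absolutely_integrable_on_def)
      show "(\<lambda>s. ?M * cmod (g (cis s))) integrable_on {0..t}"
        using ai by (simp add: absolutely_integrable_on_def)
      show "cmod (exp (- c * complex_of_real s) * g (cis s)) \<le> ?M * cmod (g (cis s))" if "s \<in> {0..t}" for s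
        unfolding norm_mult using norm_exp_le[of s "- c"] that t by (intro mult_right_mono) auto
    qed
    also have "\<dots> = ?M * integral {0..t} (\<lambda>s. cmod (g (cis s)))" by simp
    also have "\<dots> \<le> ?M * (2 * pi)"
      using circle_unit_ball_L1[OF g, of 0 t 1] t by (intro mult_left_mono) auto
    finally show ?thesis .
  qed
  have gen: "cmod (e * (q * I + w)) \<le> M * (cmod q * cmod I + cmod w)" if "cmod e \<le> M" for e q I w M
  proof -
    have "cmod (q * I + w) \<le> cmod q * cmod I + cmod w"
      using norm_triangle_ineq[of "q * I" w] by (simp add: norm_mult)
    moreover have "0 \<le> M" using that norm_ge_zero[of e] by linarith
    ultimately show ?thesis unfolding norm_mult[of e] using that by (intro mult_mono) auto
  qed
  have "cmod (periodic_solution c (\<lambda>s. g (cis s)) \<theta>) \<le> ?M *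
      (?q * cmod (integral {0..2 * pi} (\<lambda>s. exp (- c * complex_of_real s) * g (cis s))) +
       cmod (integral {0..\<theta>} (\<lambda>s. exp (- c * complex_of_real s) * g (cis s))))"
    unfolding periodic_solution_def by (rule gen[OF norm_exp_le[OF \<theta>]])
  also have "\<dots> \<le> ?M * (?q * (?M * (2 * pi)) + ?M * (2 * pi))"
    by (intro mult_left_mono add_mono W \<theta>) auto
  finally show "cmod (periodic_solution c (\<lambda>s. g (cis s)) \<theta>) \<le> ?M * (?q * (?M * (2 * pi)) + ?M * (2 * pi))" .
qed

text \<open>Integrating \<open>F' = c F + g\<close> over \<open>{s..t}\<close>. A large
  \<open>K\<close> makes the last term small uniformly in \<open>g\<close>, after which
  \<open>t - s\<close> can be chosen small; this is the equicontinuity.\<close>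

lemma periodic_solution_modulus:
  assumes c: "exp (2 * complex_of_real pi * c) \<noteq> 1"
    and B: "B \<ge> 0" "\<And>g \<theta>. square_integrable g \<Longrightarrow> norm (class_L2 g) \<le> 1 \<Longrightarrow> \<theta> \<in> {0..2 * pi} \<Longrightarrow>
      cmod (periodic_solution c (\<lambda>s. g (cis s)) \<theta>) \<le> B"
    and g: "square_integrable g" "norm (class_L2 g) \<le> 1"
    and st: "0 \<le> s" "s \<le> t" "t \<le> 2 * pi" and K: "K > 0"
  shows "cmod (periodic_solution c (\<lambda>s. g (cis s)) t - periodic_solution c (\<lambda>s. g (cis s)) s) \<le>
    cmod c * B * (t - s) + (K * (t - s) + 2 * pi / K) / 2"
proof -
  let ?F = "periodic_solution c (\<lambda>s. g (cis s))"
  let ?h = "\<lambda>\<theta>. c * ?F \<theta> + g (cis \<theta>)"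
  have ac: "abs_cont_on 0 (2 * pi) ?F" by (rule periodic_solution_abs_cont[OF c g(1)])
  have hint: "(?h has_integral (?F x - ?F 0)) {0..x}" if "x \<in> {0..2 * pi}" for x
    by (rule abs_cont_fundamental_theorem(2)[OF ac _ periodic_solution_has_derivative[OF c g(1)] that]) simp
  have hi: "?h integrable_on {0..2 * pi}" using hint[of "2 * pi"] by auto
  have "?F t - ?F s = integral {0..t} ?h - integral {0..s} ?h"
    using hint[of t] hint[of s] st by (simp add: integral_unique)
  also have "\<dots> = integral {s..t} ?h" by (rule integral_interval_diff[OF hi st])
  finally have "cmod (?F t - ?F s) = cmod (integral {s..t} ?h)" by simp
  also have "\<dots> \<le> integral {s..t} (\<lambda>\<theta>. cmod c * B + cmod (g (cis \<theta>)))"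
  proof (rule integral_norm_bound_integral)
    show "?h integrable_on {s..t}" by (rule integrable_on_subinterval[OF hi]) (use st in auto)
    have "(\<lambda>s. g (cis s)) absolutely_integrable_on {s..t}"
      by (rule absolutely_integrable_on_subinterval[OF circle_unit_ball_abs_integrable[OF g]]) (use st in auto)
    then have gi: "(\<lambda>\<theta>. cmod (g (cis \<theta>))) integrable_on {s..t}" by (simp add: absolutely_integrable_on_def)
    then show "(\<lambda>\<theta>. cmod c * B + cmod (g (cis \<theta>))) integrable_on {s..t}"
      by (intro integrable_add) auto
    show "cmod (?h \<theta>) \<le> cmod c * B + cmod (g (cis \<theta>))" if "\<theta> \<in> {s..t}" for \<theta>
    proof -
      have "cmod (?F \<theta>) \<le> B" by (rule B(2)[OF g]) (use that st in auto)
      then have "cmod (c * ?F \<theta>) \<le> cmod c * B" unfolding norm_mult by (intro mult_left_mono) auto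
      then show ?thesis using norm_triangle_ineq[of "c * ?F \<theta>" "g (cis \<theta>)"] by linarith
    qed
  qed
  also have "\<dots> = cmod c * B * (t - s) + integral {s..t} (\<lambda>\<theta>. cmod (g (cis \<theta>)))"
  proof -
    have "(\<lambda>s. g (cis s)) absolutely_integrable_on {s..t}"
      by (rule absolutely_integrable_on_subinterval[OF circle_unit_ball_abs_integrable[OF g]]) (use st in auto)
    then have gi: "(\<lambda>\<theta>. cmod (g (cis \<theta>))) integrable_on {s..t}" by (simp add: absolutely_integrable_on_def)
    show ?thesis
      by (subst integral_add[OF _ gi]) (use st in \<open>auto simp: mult.commute\<close>)
  qed
  also have "\<dots> \<le> cmod c * B * (t - s) + (K * (t - s) + 2 * pi / K) / 2"
    using circle_unit_ball_L1[OF g st K] by simp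
  finally show ?thesis .
qed

lemma abs_cont_on_cong:
  assumes "abs_cont_on l r F" "\<And>x. x \<in> {l..r} \<Longrightarrow> F x = G x"
  shows "abs_cont_on l r G"
  by (rule abs_cont_on_dominated[OF assms(1,1), where C = 1]) (use assms(2) in simp)

lemma Arg2pi_1: "Arg2pi 1 = 0"
  using Arg2pi_cis[of 0] by simp

text \<open>The formula is evaluated at a chosen representative. Linearity is not visible here; it
  follows from \<open>first_order_graph_iff\<close>, because the graph is a linear subspace.\<close>

definition periodic_solution_L2 :: "complex \<Rightarrow> circle_L2 \<Rightarrow> circle_L2" where
  "periodic_solution_L2 c y = class_L2 (\<lambda>z. periodic_solution c (\<lambda>s. rep_L2 y (cis s)) (Arg2pi z))"

lemma square_integrable_Arg2pi:
  fixes F :: "real \<Rightarrow> complex"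
  assumes F: "continuous_on {0..2 * pi} F"
  shows "square_integrable (\<lambda>z. F (Arg2pi z))"
proof -
  have m: "(\<lambda>z. F (Arg2pi z)) \<in> borel_measurable circle_measure"
    by (rule borel_measurable_circle_measure[OF borel_measurable_circle_Arg2pi[OF F]])
  have "bounded (F ` {0..2 * pi})"
    by (rule compact_imp_bounded[OF compact_continuous_image[OF F compact_Icc]])
  then obtain C where C: "\<And>x. x \<in> {0..2 * pi} \<Longrightarrow> cmod (F x) \<le> C" unfolding bounded_iff by blast
  have "cmod (F (Arg2pi z)) \<le> C" for z using C[of "Arg2pi z"] Arg2pi_bounds[of z] by simp
  then have "square_integrable (\<lambda>z. F (Arg2pi z) * 1)"
    by (rule square_integrable_bounded_mult[OF m _ square_integrable_const])
  then show ?thesis by simp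
qed

text \<open>Existence: the periodic solution, carried to the circle, belongs to
  \<open>circle_H1\<close> and solves the equation. Uniqueness: every solution in
  \<open>circle_H1\<close> is absolutely continuous in the angle and satisfies the same equation
  almost everywhere.\<close>

lemma first_order_graph_iff:
  assumes c: "exp (2 * complex_of_real pi * c) \<noteq> 1"
  shows "(x, y) \<in> first_order_graph c \<longleftrightarrow> x = periodic_solution_L2 c y"
proof -
  define g where "g = rep_L2 y"
  have g: "square_integrable g" "class_L2 g = y" by (simp_all add: g_def)
  define F where "F = periodic_solution c (\<lambda>s. g (cis s))"
  define u where "u z = F (Arg2pi z)" for z
  have Fac: "abs_cont_on 0 (2 * pi) F" unfolding F_def by (rule periodic_solution_abs_cont[OF c g(1)])
  have Fper: "F 0 = F (2 * pi)" unfolding F_def by (rule periodic_solution_periodic[OF c g(1)])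
  have Fd: "AE \<theta> in lborel. \<theta> \<in> {0<..<2 * pi} \<longrightarrow> (F has_vector_derivative c * F \<theta> + g (cis \<theta>)) (at \<theta>)"
    unfolding F_def by (rule periodic_solution_has_derivative[OF c g(1)])
  have uF: "F \<theta> = u (cis \<theta>)" if "\<theta> \<in> {0..2 * pi}" for \<theta>
  proof (cases "\<theta> = 2 * pi")
    case True
    then show ?thesis using Fper by (simp add: u_def Arg2pi_1)
  qed (use that in \<open>simp add: u_def Arg2pi_cis\<close>)
  have uS: "periodic_solution_L2 c y = class_L2 u"
    unfolding periodic_solution_L2_def u_def F_def g_def ..
  have su: "square_integrable u"
    unfolding u_def by (rule square_integrable_Arg2pi[OF abs_cont_on_imp_continuous_on[OF Fac]])
  \<comment> \<open>The candidate for the derivative along the circle, found by solving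
    \<open>\<i> * z * h z = c * u z + g z\<close>.\<close>
  define h where "h z = inverse (\<i> * z) * (c * u z + g z)" for z
  have h: "square_integrable h"
    unfolding h_def
  proof (rule square_integrable_bounded_mult[of _ 1])
    show "(\<lambda>z. inverse (\<i> * z)) \<in> borel_measurable circle_measure"
      by (rule borel_measurable_continuous_circle) (auto intro!: continuous_intros)
    show "square_integrable (\<lambda>z. c * u z + g z)" by (intro square_integrable_add square_integrable_scale su g)
  qed (simp add: norm_inverse norm_mult)
  have hz: "\<i> * z * h z = c * u z + g z" if "z \<in> circle" for z
  proof -
    have "z \<noteq> 0" using that by auto
    then have "\<i> * z * inverse (\<i> * z) = 1" by (intro right_inverse) simp
    then show ?thesis by (simp only: h_def mult.assoc[symmetric] mult_1_left)
  qed
  have ud: "AE \<theta> in lborel. \<theta> \<in> {0<..<2 * pi} \<longrightarrow>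
      ((\<lambda>\<theta>. u (cis \<theta>)) has_vector_derivative \<i> * cis \<theta> * h (cis \<theta>)) (at \<theta>)"
    using Fd
  proof eventually_elim
    case (elim \<theta>)
    show ?case
    proof
      assume \<theta>: "\<theta> \<in> {0<..<2 * pi}"
      have "((\<lambda>\<theta>. u (cis \<theta>)) has_vector_derivative c * F \<theta> + g (cis \<theta>)) (at \<theta>)"
        by (rule has_vector_derivative_transform_within_open[OF elim[rule_format, OF \<theta>] open_greaterThanLessThan \<theta>])
          (simp add: uF)
      then show "((\<lambda>\<theta>. u (cis \<theta>)) has_vector_derivative \<i> * cis \<theta> * h (cis \<theta>)) (at \<theta>)"
        using hz[of "cis \<theta>"] uF[of \<theta>] \<theta> by simp
    qed
  qed
  have uac: "abs_cont_on 0 (2 * pi) (\<lambda>\<theta>. u (cis \<theta>))" by (rule abs_cont_on_cong[OF Fac uF])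
  note uH = circle_H1I[OF uac h ud]
  have "y = class_L2 (\<lambda>z. \<i> * z * circle_deriv u z - c * u z)"
    unfolding g(2)[symmetric]
  proof (subst class_L2_eq_iff[OF g(1) square_integrable_first_order[OF uH(1)]])
    show "AE z in circle_measure. g z = \<i> * z * circle_deriv u z - c * u z"
      using uH(2) AE_circle_space by eventually_elim (simp add: hz)
  qed
  then have 1: "(class_L2 u, y) \<in> first_order_graph c" using uH(1) unfolding first_order_graph_def by blast
  have 2: "x = class_L2 u" if xy: "(x, y) \<in> first_order_graph c"
  proof -
    obtain v where v: "v \<in> circle_H1" "x = class_L2 v" "y = class_L2 (\<lambda>z. \<i> * z * circle_deriv v z - c * v z)"
      using xy unfolding first_order_graph_def by blast
    have "AE z in circle_measure. g z = \<i> * z * circle_deriv v z - c * v z"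
      using v(3) g class_L2_eq_iff[OF g(1) square_integrable_first_order[OF v(1)]] by simp
    then have "AE \<theta> in lborel. \<theta> \<in> {0<..<2 * pi} \<longrightarrow> g (cis \<theta>) = \<i> * cis \<theta> * circle_deriv v (cis \<theta>) - c * v (cis \<theta>)"
      by (simp only: AE_circle_measure_iff)
    then have "AE \<theta> in lborel. \<theta> \<in> {0<..<2 * pi} \<longrightarrow>
        ((\<lambda>\<theta>. v (cis \<theta>)) has_vector_derivative c * v (cis \<theta>) + g (cis \<theta>)) (at \<theta>)"
      using circle_H1_has_vector_derivative[OF v(1)] by eventually_elim auto
    from periodic_solution_unique[OF c g(1) circle_H1_abs_cont[OF v(1)] _ this]
    have vF: "v (cis \<theta>) = F \<theta>" if "\<theta> \<in> {0..2 * pi}" for \<theta>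
      unfolding F_def using that by simp
    have vu: "v z = u z" if "z \<in> circle" for z
      using vF[of "Arg2pi z"] Arg2pi_bounds[of z] cis_Arg2pi[OF that] by (simp add: u_def)
    have "AE z in circle_measure. v z = u z" using AE_circle_space by eventually_elim (rule vu)
    then show ?thesis
      using class_L2_eq_iff[OF circle_H1_square_integrable[OF v(1)] su] v(2) by simp
  qed
  show ?thesis using 1 2 uS by auto
qed

text \<open>Arzela-Ascoli on \<open>{0..2 * pi}\<close>: the solutions for the unit ball are
  uniformly bounded and equicontinuous, and uniform convergence implies convergence in norm on a
  probability space.\<close>

theorem periodic_solution_compact:
  assumes c: "exp (2 * complex_of_real pi * c) \<noteq> 1"
  shows "compact_operator (periodic_solution_L2 c)"
proof -
  let ?S = "periodic_solution_L2 c"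
  note iff = first_order_graph_iff[OF c]
  \<comment> \<open>The sum of two graph elements is a graph element, hence equals the one
    determined by the sum of the right-hand sides.\<close>
  have add: "?S (x + y) = ?S x + ?S y" for x y
    using first_order_graph_add[of "?S x" x c "?S y" y] iff by simp
  have scale: "?S (r *\<^sub>R x) = r *\<^sub>R ?S x" for r x
    using first_order_graph_scaleC[of "?S x" x c "complex_of_real r"] iff by (simp add: scaleC_of_real)
  obtain B where B: "B \<ge> 0" "\<And>g \<theta>. square_integrable g \<Longrightarrow> norm (class_L2 g) \<le> 1 \<Longrightarrow> \<theta> \<in> {0..2 * pi} \<Longrightarrow>
      cmod (periodic_solution c (\<lambda>s. g (cis s)) \<theta>) \<le> B"
    using periodic_solution_bound[of c] by blast
  define F where "F y = periodic_solution c (\<lambda>s. rep_L2 y (cis s))" for y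
  have Fc: "continuous_on {0..2 * pi} (F y)" for y
    unfolding F_def by (rule abs_cont_on_imp_continuous_on[OF periodic_solution_abs_cont[OF c]]) simp
  have FB: "cmod (F y \<theta>) \<le> B" if "norm y \<le> 1" "\<theta> \<in> {0..2 * pi}" for y \<theta>
    unfolding F_def by (rule B(2)) (use that in auto)
  have SF: "?S y = class_L2 (\<lambda>z. F y (Arg2pi z))" for y
    by (simp add: periodic_solution_L2_def F_def)
  have ball: "norm (?S y) \<le> B" if "norm y \<le> 1" for y
    unfolding SF
    by (rule norm_class_L2_le[OF square_integrable_Arg2pi[OF Fc]])
      (use FB[OF that] Arg2pi_bounds B(1) in \<open>auto intro: less_imp_le\<close>)
  have "norm (?S y) \<le> norm y * B" for y
  proof (cases "y = 0")
    case True
    then show ?thesis using scale[of 0 0] by simp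
  next
    case False
    have "norm (?S ((1 / norm y) *\<^sub>R y)) \<le> B" by (rule ball) simp
    then show ?thesis using False by (simp add: scale field_simps)
  qed
  then have bl: "bounded_linear ?S" by (intro bounded_linear_intro[of _ B] add scale)
  have "compact (closure (?S ` cball 0 1))"
  proof (rule compact_closure_sequentialI)
    fix s :: "nat \<Rightarrow> circle_L2" assume s: "\<And>n. s n \<in> ?S ` cball 0 1"
    have "\<forall>n. \<exists>y. norm y \<le> 1 \<and> s n = ?S y"
    proof
      fix n
      show "\<exists>y. norm y \<le> 1 \<and> s n = ?S y" using s[of n] by auto
    qed
    then obtain y where y: "\<And>n. norm (y n) \<le> 1" "\<And>n. s n = ?S (y n)" by metis
    have equi: "\<exists>d. 0 < d \<and> (\<forall>n t. t \<in> {0..2 * pi} \<and> norm (x - t) < d \<longrightarrow> norm (F (y n) x - F (y n) t) < e)"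
      if x: "x \<in> {0..2 * pi}" and e: "0 < e" for x e :: real
    proof -
      \<comment> \<open>Chosen so that the term \<open>(2 * pi / K) / 2\<close> of the modulus
        estimate equals \<open>e / 2\<close>; the remainder is \<open>A\<close> times the
        distance.\<close>
      define K where "K = 2 * pi / e"
      define A where "A = cmod c * B + K / 2"
      have K: "K > 0" "2 * pi / K = e" using e by (auto simp: K_def)
      have A: "A > 0" unfolding A_def using K B(1) by (intro add_nonneg_pos mult_nonneg_nonneg) auto
      have mod: "cmod (F (y n) b - F (y n) a) \<le> A * (b - a) + e / 2" if "0 \<le> a" "a \<le> b" "b \<le> 2 * pi" for n a b
      proof -
        have eq: "A * (b - a) + e / 2 = cmod c * B * (b - a) + (K * (b - a) + 2 * pi / K) / 2"
          unfolding A_def K(2) by (simp add: field_simps)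
        show ?thesis
          unfolding eq F_def by (rule periodic_solution_modulus[OF c B]) (use that K(1) y(1)[of n] in simp_all)
      qed
      have "cmod (F (y n) x - F (y n) t) < e" if t: "t \<in> {0..2 * pi}" "norm (x - t) < e / (2 * A)" for n t
      proof -
        have "cmod (F (y n) x - F (y n) t) \<le> A * \<bar>x - t\<bar> + e / 2"
        proof (cases "x \<le> t")
          case True
          then show ?thesis using mod[of x t n] x t by (simp add: norm_minus_commute)
        next
          case False
          then show ?thesis using mod[of t x n] x t by simp
        qed
        also have "A * \<bar>x - t\<bar> < A * (e / (2 * A))" using t(2) A by (intro mult_strict_left_mono) auto
        also have "A * (e / (2 * A)) = e / 2" using A by simp
        finally show ?thesis by simp
      qed
      then show ?thesis using e A by (intro exI[of _ "e / (2 * A)"]) auto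
    qed
    obtain f r where fr: "continuous_on {0..2 * pi} f" "strict_mono (r :: nat \<Rightarrow> nat)"
      "\<And>e. 0 < e \<Longrightarrow> \<exists>N. \<forall>n x. n \<ge> N \<and> x \<in> {0..2 * pi} \<longrightarrow> norm (F (y (r n)) x - f x) < e"
      by (rule Arzela_Ascoli[of "{0..2 * pi}" "\<lambda>n. F (y n)" B, OF compact_Icc FB[OF y(1)] equi]) (assumption, assumption, assumption, rule that)
    have "(s \<circ> r) \<longlonglongrightarrow> class_L2 (\<lambda>z. f (Arg2pi z))"
    proof (rule LIMSEQ_I)
      fix e :: real assume e: "e > 0"
      then obtain N where N: "\<And>n x. n \<ge> N \<Longrightarrow> x \<in> {0..2 * pi} \<Longrightarrow> norm (F (y (r n)) x - f x) < e / 2"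
        using fr(3)[of "e / 2"] by auto
      show "\<exists>N. \<forall>n\<ge>N. norm ((s \<circ> r) n - class_L2 (\<lambda>z. f (Arg2pi z))) < e"
      proof (intro exI allI impI)
        fix n assume n: "N \<le> n"
        have "(s \<circ> r) n - class_L2 (\<lambda>z. f (Arg2pi z)) = class_L2 (\<lambda>z. F (y (r n)) (Arg2pi z) - f (Arg2pi z))"
          unfolding o_def y(2) SF
          by (rule class_L2_diff[symmetric]; rule square_integrable_Arg2pi; rule Fc fr(1))
        also have "norm \<dots> \<le> e / 2"
        proof (rule norm_class_L2_le)
          show "square_integrable (\<lambda>z. F (y (r n)) (Arg2pi z) - f (Arg2pi z))"
            by (rule square_integrable_Arg2pi) (intro continuous_intros Fc fr(1))
          show "cmod (F (y (r n)) (Arg2pi z) - f (Arg2pi z)) \<le> e / 2" for z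
            using N[OF n, of "Arg2pi z"] Arg2pi_bounds[of z] by simp
        qed (use e in simp)
        also have "\<dots> < e" using e by simp
        finally show "norm ((s \<circ> r) n - class_L2 (\<lambda>z. f (Arg2pi z))) < e" .
      qed
    qed
    then show "\<exists>l r. strict_mono r \<and> (s \<circ> r) \<longlonglongrightarrow> l" using fr(2) by blast
  qed
  then show ?thesis using bl by (simp add: compact_operator_def)
qed

section \<open>Compact operators and Hilbert sums\<close>

lemma compact_closure_subsetI:
  fixes X :: "'a::metric_space set"
  assumes "X \<subseteq> C" "compact C"
  shows "compact (closure X)"
proof -
  have "closure X \<subseteq> C" using assms by (intro closure_minimal compact_imp_closed)
  then have "closure X = C \<inter> closure X" by blast
  then show ?thesis using assms(2) compact_Int_closed[of C "closure X"] by simp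
qed

text \<open>\<open>compact_operator\<close> with different source and target, since the entries of
  an inverse map the pair space to one factor.\<close>

definition compact_linear :: "('a::real_normed_vector \<Rightarrow> 'b::real_normed_vector) \<Rightarrow> bool" where
  "compact_linear T \<longleftrightarrow> bounded_linear T \<and> compact (closure (T ` cball 0 1))"

lemma compact_operator_iff: "compact_operator T \<longleftrightarrow> compact_linear T"
  by (simp add: compact_operator_def compact_linear_def)

lemma compact_linear_bounded_linear: "compact_linear T \<Longrightarrow> bounded_linear T"
  by (simp add: compact_linear_def)

lemma compact_linear_cball:
  fixes T :: "'a::real_normed_vector \<Rightarrow> 'b::real_normed_vector"
  assumes T: "compact_linear T"
  shows "compact (closure (T ` cball 0 K))"
proof (cases "K \<le> 0")
  case True
  have "T ` cball 0 K \<subseteq> {T 0}"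
  proof (rule image_subsetI)
    fix x :: 'a assume "x \<in> cball 0 K"
    then have "norm x \<le> K" by simp
    also note True
    finally show "T x \<in> {T 0}" by simp
  qed
  then show ?thesis by (rule compact_closure_subsetI) simp
next
  case False
  interpret T: bounded_linear T by (rule compact_linear_bounded_linear[OF T])
  show ?thesis
  proof (rule compact_closure_subsetI)
    show "T ` cball 0 K \<subseteq> (\<lambda>x. K *\<^sub>R x) ` closure (T ` cball 0 1)"
    proof
      fix z assume "z \<in> T ` cball 0 K"
      then obtain x where x: "norm x \<le> K" "z = T x" by auto
      have "norm (x /\<^sub>R K) \<le> 1" using x(1) False by (simp add: field_simps)
      then have "T (x /\<^sub>R K) \<in> closure (T ` cball 0 1)" using closure_subset by fastforce
      moreover have "z = K *\<^sub>R T (x /\<^sub>R K)" using False x(2) by (simp add: T.scaleR)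
      ultimately show "z \<in> (\<lambda>x. K *\<^sub>R x) ` closure (T ` cball 0 1)" by blast
    qed
    show "compact ((\<lambda>x. K *\<^sub>R x) ` closure (T ` cball 0 1))"
      using T by (intro compact_scaling) (simp add: compact_linear_def)
  qed
qed

lemma compact_linear_compose_right:
  assumes T: "compact_linear T" and Y: "bounded_linear Y"
  shows "compact_linear (\<lambda>x. T (Y x))"
  unfolding compact_linear_def
proof
  show "bounded_linear (\<lambda>x. T (Y x))"
    by (rule bounded_linear_compose[OF compact_linear_bounded_linear[OF T] Y])
  obtain K where K: "K > 0" "\<And>x. norm (Y x) \<le> norm x * K" using bounded_linear.pos_bounded[OF Y] by blast
  have "(\<lambda>x. T (Y x)) ` cball 0 1 \<subseteq> closure (T ` cball 0 K)"
  proof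
    fix z assume "z \<in> (\<lambda>x. T (Y x)) ` cball 0 1"
    then obtain x where x: "norm x \<le> 1" "z = T (Y x)" by auto
    have "norm (Y x) \<le> K" using K(2)[of x] mult_right_mono[OF x(1), of K] K(1) by linarith
    then show "z \<in> closure (T ` cball 0 K)" using x(2) closure_subset by fastforce
  qed
  then show "compact (closure ((\<lambda>x. T (Y x)) ` cball 0 1))"
    by (rule compact_closure_subsetI[OF _ compact_linear_cball[OF T]])
qed

lemma compact_linear_compose_left:
  assumes T: "compact_linear T" and M: "bounded_linear M"
  shows "compact_linear (\<lambda>x. M (T x))"
  unfolding compact_linear_def
proof
  show "bounded_linear (\<lambda>x. M (T x))"
    by (rule bounded_linear_compose[OF M compact_linear_bounded_linear[OF T]])
  have "(\<lambda>x. M (T x)) ` cball 0 1 \<subseteq> M ` closure (T ` cball 0 1)"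
    using closure_subset[of "T ` cball 0 1"] by auto
  then show "compact (closure ((\<lambda>x. M (T x)) ` cball 0 1))"
    by (rule compact_closure_subsetI)
      (use T in \<open>simp add: compact_linear_def compact_continuous_image linear_continuous_on[OF M]\<close>)
qed

lemma compact_linear_add:
  assumes S: "compact_linear S" and T: "compact_linear T"
  shows "compact_linear (\<lambda>x. S x + T x)"
  unfolding compact_linear_def
proof
  show "bounded_linear (\<lambda>x. S x + T x)"
    by (intro bounded_linear_add compact_linear_bounded_linear S T)
  have "(\<lambda>x. S x + T x) ` cball 0 1 \<subseteq> {x + y |x y. x \<in> closure (S ` cball 0 1) \<and> y \<in> closure (T ` cball 0 1)}"
    using closure_subset[of "S ` cball 0 1"] closure_subset[of "T ` cball 0 1"] by blast
  then show "compact (closure ((\<lambda>x. S x + T x) ` cball 0 1))"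
    by (rule compact_closure_subsetI) (use S T in \<open>intro compact_sums; simp add: compact_linear_def\<close>)
qed

lemma compact_linear_zero: "compact_linear (\<lambda>_. 0)"
  unfolding compact_linear_def
  by (auto intro: compact_closure_subsetI[of _ "{0}"])

lemma compact_linear_sum:
  "finite F \<Longrightarrow> (\<And>n. n \<in> F \<Longrightarrow> compact_linear (T n)) \<Longrightarrow> compact_linear (\<lambda>x. \<Sum>n\<in>F. T n x)"
  by (induction F rule: finite_induct) (simp_all add: compact_linear_zero compact_linear_add)

lemma compact_linear_Pair:
  fixes S :: "'a::real_normed_vector \<Rightarrow> 'b::real_normed_vector"
    and T :: "'a \<Rightarrow> 'c::real_normed_vector"
  assumes S: "compact_linear S" and T: "compact_linear T"
  shows "compact_linear (\<lambda>x. (S x, T x))"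
proof -
  have "bounded_linear (\<lambda>a. (a, 0::'c))" "bounded_linear (\<lambda>b. (0::'b, b))"
    by (intro bounded_linear_Pair bounded_linear_ident bounded_linear_zero)+
  then have "compact_linear (\<lambda>x. (S x, 0) + (0, T x))"
    by (intro compact_linear_add compact_linear_compose_left[OF S] compact_linear_compose_left[OF T])
  then show ?thesis by simp
qed

text \<open>A finite net for the image under an approximating compact operator is a net for the
  image under \<open>T\<close>; completeness of the target turns total boundedness into
  compactness.\<close>

lemma compact_linear_uniform_limit:
  fixes T :: "'a::real_normed_vector \<Rightarrow> 'b::{real_normed_vector,complete_space}"
  assumes T: "bounded_linear T"
    and approx: "\<And>e. e > 0 \<Longrightarrow> \<exists>S. compact_linear S \<and> (\<forall>x. norm x \<le> 1 \<longrightarrow> norm (T x - S x) \<le> e)"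
  shows "compact_linear T"
  unfolding compact_linear_def
proof
  let ?X = "T ` cball 0 1"
  show "compact (closure ?X)"
    unfolding compact_eq_totally_bounded
  proof (intro conjI allI impI)
    show "complete (closure ?X)" by (simp add: complete_eq_closed)
    fix e :: real assume e: "e > 0"
    obtain S where S: "compact_linear S" "\<And>x. norm x \<le> 1 \<Longrightarrow> norm (T x - S x) \<le> e / 4"
      using approx[of "e / 4"] e by auto
    have "compact (closure (S ` cball 0 1))" using S(1) by (simp add: compact_linear_def)
    then obtain k where k: "finite k" "closure (S ` cball 0 1) \<subseteq> (\<Union>x\<in>k. ball x (e / 4))"
      using e unfolding compact_eq_totally_bounded by (meson divide_pos_pos zero_less_numeral)
    \<comment> \<open>Closed balls, so that their finite union is closed and also contains the
      closure of the image.\<close>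
    have "?X \<subseteq> (\<Union>x\<in>k. cball x (e / 2))"
    proof
      fix z assume "z \<in> ?X"
      then obtain x where x: "norm x \<le> 1" "z = T x" by auto
      then have "S x \<in> closure (S ` cball 0 1)" using closure_subset by fastforce
      then obtain y where y: "y \<in> k" "dist y (S x) < e / 4" using k(2) by auto
      have "dist y z \<le> dist y (S x) + dist (S x) (T x)" unfolding x(2) by (rule dist_triangle)
      also have "\<dots> \<le> e / 4 + e / 4"
        using y(2) S(2)[OF x(1)] by (intro add_mono) (simp_all add: dist_norm norm_minus_commute)
      finally show "z \<in> (\<Union>x\<in>k. cball x (e / 2))" using y(1) by auto
    qed
    then have "closure ?X \<subseteq> (\<Union>x\<in>k. cball x (e / 2))"
      by (rule closure_minimal) (use k(1) in auto)
    also have "\<dots> \<subseteq> (\<Union>x\<in>k. ball x e)" using e by fastforce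
    finally show "\<exists>k. finite k \<and> closure ?X \<subseteq> (\<Union>x\<in>k. ball x e)" using k(1) by blast
  qed
qed (rule T)

text \<open>With \<open>y\<close> the image of \<open>x\<close> under the inverse of
  \<open>T\<close>, the resolvent equation reads \<open>y = w + \<mu> T y\<close>, a contraction
  with factor \<open>1 / 2\<close>. Its solution \<open>Y w\<close> has norm at most
  \<open>2 * norm w\<close>, and the resolvent is \<open>T\<close> after \<open>Y\<close>, hence
  compact.\<close>

lemma neumann_inverse:
  fixes T :: "'a::{real_normed_vector,complete_space} \<Rightarrow> 'a"
  assumes T: "compact_linear T" and K: "\<And>x. norm (T x) \<le> K * norm x" and \<mu>: "\<bar>\<mu>\<bar> * K \<le> 1 / 2"
  shows "\<exists>R. compact_linear R \<and> (\<forall>w. norm (R w) \<le> 2 * K * norm w) \<and>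
    (\<forall>w x. (\<exists>y. x = T y \<and> w = y - \<mu> *\<^sub>R x) \<longleftrightarrow> x = R w)"
proof -
  interpret T: bounded_linear T by (rule compact_linear_bounded_linear[OF T])
  have half: "norm (\<mu> *\<^sub>R T x) \<le> 1 / 2 * norm x" for x
  proof -
    have "norm (\<mu> *\<^sub>R T x) \<le> \<bar>\<mu>\<bar> * (K * norm x)" using K[of x] by (simp add: mult_left_mono)
    also have "\<dots> = (\<bar>\<mu>\<bar> * K) * norm x" by simp
    also have "\<dots> \<le> 1 / 2 * norm x" by (rule mult_right_mono[OF \<mu>]) simp
    finally show ?thesis .
  qed
  have ex: "\<exists>!y. y = w + \<mu> *\<^sub>R T y" for w
  proof -
    have "\<exists>!y\<in>UNIV. w + \<mu> *\<^sub>R T y = y"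
    proof (rule Banach_fix[of UNIV "1 / 2"])
      show "complete (UNIV :: 'a set)" by (simp add: complete_eq_closed)
      show "dist (w + \<mu> *\<^sub>R T x) (w + \<mu> *\<^sub>R T y) \<le> 1 / 2 * dist x y" for x y
        using half[of "x - y"] by (simp add: dist_norm T.diff scaleR_diff_right)
    qed auto
    then show ?thesis by (simp add: eq_commute)
  qed
  define Y where "Y w = (THE y. y = w + \<mu> *\<^sub>R T y)" for w
  have Y: "Y w = w + \<mu> *\<^sub>R T (Y w)" for w unfolding Y_def by (rule theI'[OF ex])
  have Yu: "Y w = y" if "y = w + \<mu> *\<^sub>R T y" for w y using ex[of w] Y[of w] that by blast
  have nY: "norm (Y w) \<le> 2 * norm w" for w
  proof -
    have "norm (Y w) \<le> norm w + norm (\<mu> *\<^sub>R T (Y w))"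
      using norm_triangle_ineq[of w "\<mu> *\<^sub>R T (Y w)"] Y[of w] by simp
    then show ?thesis using half[of "Y w"] by simp
  qed
  have bY: "bounded_linear Y"
  proof (rule bounded_linear_intro)
    show "Y (v + w) = Y v + Y w" for v w
    proof (rule Yu)
      have "Y v + Y w = (v + \<mu> *\<^sub>R T (Y v)) + (w + \<mu> *\<^sub>R T (Y w))" using Y[of v] Y[of w] by simp
      also have "\<dots> = v + w + \<mu> *\<^sub>R T (Y v + Y w)" by (simp add: T.add scaleR_add_right)
      finally show "Y v + Y w = v + w + \<mu> *\<^sub>R T (Y v + Y w)" .
    qed
    show "Y (r *\<^sub>R w) = r *\<^sub>R Y w" for r w
    proof (rule Yu)
      have "r *\<^sub>R Y w = r *\<^sub>R (w + \<mu> *\<^sub>R T (Y w))" using Y[of w] by simp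
      also have "\<dots> = r *\<^sub>R w + \<mu> *\<^sub>R T (r *\<^sub>R Y w)" by (simp add: T.scaleR scaleR_add_right)
      finally show "r *\<^sub>R Y w = r *\<^sub>R w + \<mu> *\<^sub>R T (r *\<^sub>R Y w)" .
    qed
    show "norm (Y w) \<le> norm w * 2" for w using nY[of w] by simp
  qed
  have K0: "K * norm x \<ge> 0" for x :: 'a using K[of x] norm_ge_zero[of "T x"] by linarith
  show ?thesis
  proof (intro exI[of _ "\<lambda>w. T (Y w)"] conjI allI)
    show "compact_linear (\<lambda>w. T (Y w))" by (rule compact_linear_compose_right[OF T bY])
    show "norm (T (Y w)) \<le> 2 * K * norm w" for w
    proof (cases "w = 0")
      case True
      then show ?thesis using nY[of w] by (simp add: T.zero)
    next
      case False
      then have "K \<ge> 0" using K0[of w] by (simp add: zero_le_mult_iff)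
      then have "K * norm (Y w) \<le> K * (2 * norm w)" by (intro mult_left_mono nY)
      then show ?thesis using K[of "Y w"] by simp
    qed
    show "(\<exists>y. x = T y \<and> w = y - \<mu> *\<^sub>R x) \<longleftrightarrow> x = T (Y w)" for w x
    proof
      assume "\<exists>y. x = T y \<and> w = y - \<mu> *\<^sub>R x"
      then obtain y where "x = T y" "w = y - \<mu> *\<^sub>R x" by blast
      then have "Y w = y" by (intro Yu) simp
      then show "x = T (Y w)" using \<open>x = T y\<close> by simp
    next
      assume x: "x = T (Y w)"
      then have "w = Y w - \<mu> *\<^sub>R x" using Y[of w] by (simp add: algebra_simps)
      then show "\<exists>y. x = T y \<and> w = y - \<mu> *\<^sub>R x" using x by blast
    qed
  qed
qed

section \<open>Hilbert sums: components, completeness and diagonal operators\<close>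

lemma component_summable: "(\<lambda>n. (norm (component x n))\<^sup>2) summable_on UNIV"
  using component[of x] by simp

lemma norm_l2sum_square: "(norm x)\<^sup>2 = (\<Sum>\<^sub>\<infinity>n. (norm (component x n))\<^sup>2)"
  by (simp add: power2_norm_eq_inner inner_l2sum.rep_eq)

lemma sum_component_le: "finite F \<Longrightarrow> (\<Sum>n\<in>F. (norm (component x n))\<^sup>2) \<le> (norm x)\<^sup>2"
  unfolding norm_l2sum_square by (rule finite_sum_le_infsum[OF component_summable]) auto

lemma norm_component_le: "norm (component x n) \<le> norm x"
  using sum_component_le[of "{n}" x] by (simp add: power2_le_iff_abs_le)

lemma norm_l2sum_leI:
  assumes "\<And>F. finite F \<Longrightarrow> (\<Sum>n\<in>F. (norm (component x n))\<^sup>2) \<le> B\<^sup>2" "0 \<le> B"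
  shows "norm x \<le> B"
proof -
  have "(norm x)\<^sup>2 \<le> B\<^sup>2"
    unfolding norm_l2sum_square by (rule infsum_le_finite_sums[OF component_summable]) (rule assms(1))
  then show ?thesis using assms(2) by (rule power2_le_imp_le)
qed

lemma component_Abs:
  assumes "\<And>F. finite F \<Longrightarrow> (\<Sum>n\<in>F. (norm (x n))\<^sup>2) \<le> B"
  shows "component (Abs_l2sum x) = x"
proof (rule Abs_l2sum_inverse, rule CollectI)
  show "(\<lambda>n. (norm (x n))\<^sup>2) summable_on UNIV"
    by (rule nonneg_bdd_above_summable_on) (use assms in \<open>auto simp: bdd_above_def\<close>)
qed

lemma l2sum_eqI: "(\<And>n. component x n = component y n) \<Longrightarrow> x = y"
  by (metis component_inject ext)

lemmas component_simps = plus_l2sum.rep_eq minus_l2sum.rep_eq zero_l2sum.rep_eq scaleR_l2sum.rep_eq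
  scaleC_l2sum.rep_eq

lemma component_sum: "component (\<Sum>i\<in>F. f i) n = (\<Sum>i\<in>F. component (f i) n)"
  by (induction F rule: infinite_finite_induct) (simp_all add: component_simps)

instance l2sum :: ("{real_inner,complete_space}") complete_space
proof
  fix X :: "nat \<Rightarrow> 'a l2sum" assume X: "Cauchy X"
  have "Cauchy (\<lambda>k. component (X k) n)" for n
  proof (rule CauchyI)
    fix e :: real assume "e > 0"
    from CauchyD[OF X this] obtain M where M: "\<And>j k. j \<ge> M \<Longrightarrow> k \<ge> M \<Longrightarrow> norm (X j - X k) < e" by blast
    have "norm (component (X j) n - component (X k) n) < e" if "j \<ge> M" "k \<ge> M" for j k
      using norm_component_le[of "X j - X k" n] M[OF that] by (simp add: component_simps)
    then show "\<exists>M. \<forall>j\<ge>M. \<forall>k\<ge>M. norm (component (X j) n - component (X k) n) < e" by blast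
  qed
  then have "\<forall>n. \<exists>l. (\<lambda>k. component (X k) n) \<longlonglongrightarrow> l" using Cauchy_convergent convergent_def by metis
  then obtain L where L: "\<And>n. (\<lambda>k. component (X k) n) \<longlonglongrightarrow> L n" by metis
  have fin: "(\<Sum>n\<in>F. (norm (component (X j) n - L n))\<^sup>2) \<le> e\<^sup>2"
    if F: "finite F" and M: "\<And>j k. j \<ge> M \<Longrightarrow> k \<ge> M \<Longrightarrow> norm (X j - X k) < e" and j: "j \<ge> M" for F j M e
  proof (rule tendsto_upperbound)
    show "(\<lambda>k. \<Sum>n\<in>F. (norm (component (X j) n - component (X k) n))\<^sup>2) \<longlonglongrightarrow> (\<Sum>n\<in>F. (norm (component (X j) n - L n))\<^sup>2)"
      by (intro tendsto_intros L)
    show "\<forall>\<^sub>F k in sequentially. (\<Sum>n\<in>F. (norm (component (X j) n - component (X k) n))\<^sup>2) \<le> e\<^sup>2"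
      using eventually_ge_at_top[of M]
    proof eventually_elim
      case (elim k)
      have "(\<Sum>n\<in>F. (norm (component (X j) n - component (X k) n))\<^sup>2) \<le> (norm (X j - X k))\<^sup>2"
        using sum_component_le[OF F, of "X j - X k"] by (simp add: component_simps)
      also have "\<dots> \<le> e\<^sup>2" using M[OF j elim] by (intro power_mono) auto
      finally show ?case .
    qed
  qed simp
  obtain M1 where M1: "\<And>j k. j \<ge> M1 \<Longrightarrow> k \<ge> M1 \<Longrightarrow> norm (X j - X k) < 1"
    using CauchyD[OF X, of 1] by auto
  \<comment> \<open>The difference to a member of the sequence is square summable by the Cauchy
    bound, so the componentwise limit is itself an element of the sum.\<close>
  have "component (Abs_l2sum (\<lambda>n. component (X M1) n - L n)) = (\<lambda>n. component (X M1) n - L n)"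
    by (rule component_Abs[of _ "1\<^sup>2"]) (rule fin[OF _ M1], auto)
  then have "component (X M1 - Abs_l2sum (\<lambda>n. component (X M1) n - L n)) n = L n" for n
    by (simp add: component_simps)
  then obtain l where l: "\<And>n. component l n = L n" by blast
  have "X \<longlonglongrightarrow> l"
  proof (rule LIMSEQ_I)
    fix e :: real assume e: "e > 0"
    then obtain M where M: "\<And>j k. j \<ge> M \<Longrightarrow> k \<ge> M \<Longrightarrow> norm (X j - X k) < e / 2"
      using CauchyD[OF X, of "e / 2"] by auto
    have "norm (X j - l) < e" if "j \<ge> M" for j
    proof -
      have "norm (X j - l) \<le> e / 2"
        by (rule norm_l2sum_leI) (use fin[OF _ M that] e in \<open>simp_all add: component_simps l\<close>)
      then show ?thesis using e by simp
    qed
    then show "\<exists>M. \<forall>j\<ge>M. norm (X j - l) < e" by blast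
  qed
  then show "convergent X" by (rule convergentI)
qed

definition l2_single :: "int \<Rightarrow> 'a::real_inner \<Rightarrow> 'a l2sum" where
  "l2_single n a = Abs_l2sum (\<lambda>m. if m = n then a else 0)"

lemma component_l2_single: "component (l2_single n a) m = (if m = n then a else 0)"
proof -
  have "(\<Sum>m\<in>F. (norm (if m = n then a else 0))\<^sup>2) \<le> (norm a)\<^sup>2" if "finite F" for F
    using that by (simp add: if_distrib[of norm] if_distrib[of "\<lambda>x. x\<^sup>2"] cong: if_cong)
  then show ?thesis unfolding l2_single_def by (subst component_Abs) auto
qed

lemma norm_l2_single: "norm (l2_single n a) = norm a"
proof (rule antisym)
  show "norm (l2_single n a) \<le> norm a"
  proof (rule norm_l2sum_leI)
    show "(\<Sum>m\<in>F. (norm (component (l2_single n a) m))\<^sup>2) \<le> (norm a)\<^sup>2" if "finite F" for F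
      using that by (simp add: component_l2_single if_distrib[of norm] if_distrib[of "\<lambda>x. x\<^sup>2"] cong: if_cong)
  qed simp
  show "norm a \<le> norm (l2_single n a)"
    using norm_component_le[of "l2_single n a" n] by (simp add: component_l2_single)
qed

lemma bounded_linear_l2_single: "bounded_linear (l2_single n)"
  by (rule bounded_linear_intro[of _ 1])
    (auto intro!: l2sum_eqI simp: component_simps component_l2_single norm_l2_single)

lemma bounded_linear_component: "bounded_linear (\<lambda>x. component x n)"
  by (rule bounded_linear_intro[of _ 1]) (auto simp: component_simps norm_component_le)

text \<open>\<open>Abs_l2sum\<close> is meaningful only on square summable families; a common bound
  for the \<open>R n\<close> ensures this in \<open>component_l2_diag\<close>.\<close>

definition l2_diag :: "(int \<Rightarrow> 'a::real_inner \<Rightarrow> 'a) \<Rightarrow> 'a l2sum \<Rightarrow> 'a l2sum" where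
  "l2_diag R x = Abs_l2sum (\<lambda>n. R n (component x n))"

lemma sum_square_bound:
  assumes "\<And>n. norm (y n) \<le> B * norm (component x n)" "finite F"
  shows "(\<Sum>n\<in>F. (norm (y n))\<^sup>2) \<le> (B * norm x)\<^sup>2"
proof -
  have "(\<Sum>n\<in>F. (norm (y n))\<^sup>2) \<le> (\<Sum>n\<in>F. B\<^sup>2 * (norm (component x n))\<^sup>2)"
    using assms(1) by (intro sum_mono) (metis norm_ge_zero power_mono power_mult_distrib)
  also have "\<dots> \<le> B\<^sup>2 * (norm x)\<^sup>2"
    unfolding sum_distrib_left[symmetric] by (intro mult_left_mono sum_component_le assms) auto
  finally show ?thesis by (simp add: power_mult_distrib)
qed

lemma component_l2_diag:
  assumes "\<And>n a. norm (R n a) \<le> B * norm a"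
  shows "component (l2_diag R x) n = R n (component x n)"
  unfolding l2_diag_def by (subst component_Abs[OF sum_square_bound[of _ B]]) (auto intro: assms)

text \<open>Truncation to the finite set \<open>F\<close> is a finite sum of compact operators, and
  the omitted part has norm at most \<open>e\<close>.\<close>

lemma compact_linear_l2_diag:
  fixes R :: "int \<Rightarrow> 'a::{real_inner,complete_space} \<Rightarrow> 'a"
  assumes R: "\<And>n. compact_linear (R n)" and B: "\<And>n a. norm (R n a) \<le> B * norm a" "B \<ge> 0"
    and small: "\<And>e. e > 0 \<Longrightarrow> \<exists>F. finite F \<and> (\<forall>n a. n \<notin> F \<longrightarrow> norm (R n a) \<le> e * norm a)"
  shows "compact_linear (l2_diag R)"
proof (rule compact_linear_uniform_limit)
  note comp = component_l2_diag[of R B, OF B(1)]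
  interpret R: bounded_linear "R n" for n by (rule compact_linear_bounded_linear[OF R])
  show "bounded_linear (l2_diag R)"
  proof (rule bounded_linear_intro)
    show "norm (l2_diag R x) \<le> norm x * B" for x
    proof (rule norm_l2sum_leI)
      show "(\<Sum>n\<in>F. (norm (component (l2_diag R x) n))\<^sup>2) \<le> (norm x * B)\<^sup>2" if "finite F" for F
        using sum_square_bound[of "\<lambda>n. component (l2_diag R x) n" B x F] B(1) that by (simp add: comp mult.commute)
    qed (use B(2) in simp)
  qed (auto intro!: l2sum_eqI simp: component_simps comp R.add R.scaleR)
  fix e :: real assume e: "e > 0"
  obtain F where F: "finite F" "\<And>n a. n \<notin> F \<Longrightarrow> norm (R n a) \<le> e * norm a" using small[OF e] by blast
  define S where "S x = (\<Sum>n\<in>F. l2_single n (R n (component x n)))" for x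
  have "compact_linear S"
    unfolding S_def
    by (intro compact_linear_sum F(1) compact_linear_compose_left[OF _ bounded_linear_l2_single]
        compact_linear_compose_right[OF R bounded_linear_component])
  moreover have "norm (l2_diag R x - S x) \<le> e" if x: "norm x \<le> 1" for x
  proof -
    have cS: "component (S x) n = (if n \<in> F then R n (component x n) else 0)" for n
      unfolding S_def component_sum component_l2_single using F(1) by (simp add: if_distrib cong: if_cong)
    have "norm (l2_diag R x - S x) \<le> e * norm x"
    proof (rule norm_l2sum_leI)
      show "(\<Sum>n\<in>G. (norm (component (l2_diag R x - S x) n))\<^sup>2) \<le> (e * norm x)\<^sup>2" if "finite G" for G
        by (rule sum_square_bound[OF _ that]) (use F(2) e in \<open>auto simp: component_simps comp cS\<close>)
    qed (use e in simp)
    also have "\<dots> \<le> e" using x e by (simp add: mult_left_le)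
    finally show ?thesis .
  qed
  ultimately show "\<exists>S. compact_linear S \<and> (\<forall>x. norm x \<le> 1 \<longrightarrow> norm (l2_diag R x - S x) \<le> e)" by blast
qed

section \<open>Resolvents of direct sums\<close>

definition direct_sum_op :: "(int \<Rightarrow> 'a::real_inner unbounded_op) \<Rightarrow> 'a l2sum unbounded_op" where
  "direct_sum_op D = {(\<xi>, \<eta>). \<forall>n. (component \<xi> n, component \<eta> n) \<in> D n}"

text \<open>Recasts equality of graphs as an equation for \<open>x\<close>, which for a direct sum
  can be read component by component.\<close>

lemma is_resolvent_iff:
  assumes "is_resolvent A \<mu> R"
  shows "(x, y) \<in> A \<longleftrightarrow> x = R (y - scaleC \<mu> x)"
proof -
  have eq: "{(y - scaleC \<mu> x, x) | x y. (x, y) \<in> A} = {(v, R v) | v. True}"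
    using assms by (simp add: is_resolvent_def)
  show ?thesis
  proof
    assume "(x, y) \<in> A"
    then have "(y - scaleC \<mu> x, x) \<in> {(v, R v) | v. True}" unfolding eq[symmetric] by blast
    then show "x = R (y - scaleC \<mu> x)" by blast
  next
    assume x: "x = R (y - scaleC \<mu> x)"
    then have "(y - scaleC \<mu> x, x) \<in> {(v, R v) | v. True}" by blast
    then obtain x' y' where "y - scaleC \<mu> x = y' - scaleC \<mu> x'" "x = x'" "(x', y') \<in> A"
      unfolding eq[symmetric] by blast
    then show "(x, y) \<in> A" by simp
  qed
qed

lemma is_resolventI:
  assumes R: "bounded_linear R" and iff: "\<And>x y. (x, y) \<in> A \<longleftrightarrow> x = R (y - scaleC \<mu> x)"
  shows "is_resolvent A \<mu> R"
  unfolding is_resolvent_def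
proof (intro conjI R set_eqI iffI)
  fix p assume "p \<in> {(y - scaleC \<mu> x, x) | x y. (x, y) \<in> A}"
  then show "p \<in> {(v, R v) | v. True}" using iff by blast
next
  fix p assume "p \<in> {(v, R v) | v. True}"
  then obtain v where p: "p = (v, R v)" by blast
  have "(R v, v + scaleC \<mu> (R v)) \<in> A" unfolding iff by simp
  moreover have "p = (v + scaleC \<mu> (R v) - scaleC \<mu> (R v), R v)" using p by simp
  ultimately show "p \<in> {(y - scaleC \<mu> x, x) | x y. (x, y) \<in> A}" by blast
qed

lemma direct_sum_is_resolvent:
  assumes R: "\<And>n. is_resolvent (D n) \<mu> (R n)" and B: "\<And>n a. norm (R n a) \<le> B * norm a"
    and bl: "bounded_linear (l2_diag R)"
  shows "is_resolvent (direct_sum_op D) \<mu> (l2_diag R)"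
proof (rule is_resolventI[OF bl])
  fix x y
  have "(x, y) \<in> direct_sum_op D \<longleftrightarrow> (\<forall>n. component x n = R n (component y n - scaleC \<mu> (component x n)))"
    by (simp add: direct_sum_op_def is_resolvent_iff[OF R])
  also have "\<dots> \<longleftrightarrow> (\<forall>n. component x n = component (l2_diag R (y - scaleC \<mu> x)) n)"
    by (simp add: component_l2_diag[of R B, OF B] component_simps)
  also have "\<dots> \<longleftrightarrow> x = l2_diag R (y - scaleC \<mu> x)" using l2sum_eqI by metis
  finally show "(x, y) \<in> direct_sum_op D \<longleftrightarrow> x = l2_diag R (y - scaleC \<mu> x)" .
qed

text \<open>Normalised images of orthogonal vectors from infinitely many summands would be a separated
  sequence inside a relatively compact set.\<close>

lemma compact_resolvent_finitely_many_large:
  fixes D :: "int \<Rightarrow> 'a::complex_inner_space unbounded_op"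
  assumes res: "is_resolvent (direct_sum_op D) \<mu> R" and R: "compact_operator R"
    and zero: "\<And>n. (0, 0) \<in> D n" and e: "e > 0"
  shows "finite {n. \<exists>x y. (x, y) \<in> D n \<and> norm y \<le> 1 \<and> norm x > e}" 
proof (rule ccontr)
  define I where "I = {n. \<exists>x y. (x, y) \<in> D n \<and> norm y \<le> 1 \<and> norm x > e}"
  assume "infinite {n. \<exists>x y. (x, y) \<in> D n \<and> norm y \<le> 1 \<and> norm x > e}"
  then have inf: "infinite I" by (simp add: I_def)
  interpret R: bounded_linear R using res by (simp add: is_resolvent_def)
  have "\<forall>n\<in>I. \<exists>x y. (x, y) \<in> D n \<and> norm y \<le> 1 \<and> norm x > e" unfolding I_def by blast
  from bchoice[OF this] obtain x where "\<forall>n\<in>I. \<exists>y. (x n, y) \<in> D n \<and> norm y \<le> 1 \<and> norm (x n) > e" by blast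
  from bchoice[OF this] obtain y where "\<forall>n\<in>I. (x n, y n) \<in> D n \<and> norm (y n) \<le> 1 \<and> norm (x n) > e" by blast
  then have xy: "\<And>n. n \<in> I \<Longrightarrow> (x n, y n) \<in> D n" "\<And>n. n \<in> I \<Longrightarrow> norm (y n) \<le> 1"
    "\<And>n. n \<in> I \<Longrightarrow> norm (x n) > e" by blast+
  define X where "X n = l2_single n (x n)" for n
  define Y where "Y n = l2_single n (y n)" for n
  define u where "u n = X n /\<^sub>R norm (x n)" for n
  \<comment> \<open>Since \<open>norm (x n) > e\<close> and \<open>norm (y n) \<le> 1\<close>,
    dividing \<open>Y n - \<mu> X n\<close> by \<open>norm (x n)\<close> leaves a vector of norm at
    most \<open>1 / e + cmod \<mu>\<close>, uniformly in \<open>n\<close>.\<close>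
  define B where "B = 1 / e + cmod \<mu>"
  have u: "u n \<in> closure (R ` cball 0 B)" if n: "n \<in> I" for n
  proof -
    have "(X n, Y n) \<in> direct_sum_op D"
      using xy(1)[OF n] zero by (simp add: direct_sum_op_def X_def Y_def component_l2_single)
    then have XR: "X n = R (Y n - scaleC \<mu> (X n))" using is_resolvent_iff[OF res] by blast
    have "norm (Y n - scaleC \<mu> (X n)) \<le> norm (y n) + cmod \<mu> * norm (x n)"
      using norm_triangle_ineq4[of "Y n" "scaleC \<mu> (X n)"] by (simp add: norm_scaleC X_def Y_def norm_l2_single)
    also have "\<dots> \<le> B * norm (x n)"
    proof -
      have "1 \<le> 1 / e * norm (x n)" using xy(3)[OF n] e by (simp add: field_simps)
      then show ?thesis using xy(2)[OF n] unfolding B_def distrib_right by linarith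
    qed
    finally have nB: "norm (Y n - scaleC \<mu> (X n)) \<le> B * norm (x n)" .
    moreover have "x n \<noteq> 0" using xy(3)[OF n] e by auto
    ultimately have "norm ((Y n - scaleC \<mu> (X n)) /\<^sub>R norm (x n)) \<le> B"
      using pos_divide_le_eq[of "norm (x n)" "norm (Y n - scaleC \<mu> (X n))" B]
      by (simp add: divide_inverse_commute)
    moreover have "u n = R ((Y n - scaleC \<mu> (X n)) /\<^sub>R norm (x n))"
      unfolding u_def R.scaleR XR[symmetric] ..
    ultimately show ?thesis using closure_subset[of "R ` cball 0 B"] by auto
  qed
  \<comment> \<open>The \<open>n\<close>-th component of the difference is the unit vector in
    direction \<open>x n\<close>, because \<open>u m\<close> lives in another summand.\<close>
  have sep: "1 \<le> dist (u n) (u m)" if "n \<in> I" "m \<noteq> n" for n m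
  proof -
    have "component (u n - u m) n = x n /\<^sub>R norm (x n)"
      using that(2) by (simp add: u_def X_def component_simps component_l2_single)
    moreover have "x n \<noteq> 0" using xy(3)[OF that(1)] e by auto
    then have "norm (x n /\<^sub>R norm (x n)) = 1" by simp
    ultimately show ?thesis using norm_component_le[of "u n - u m" n] by (simp add: dist_norm)
  qed
  have "inj_on u I"
  proof (rule inj_onI, rule ccontr)
    fix n m assume "n \<in> I" "u n = u m" "n \<noteq> m"
    then show False using sep[of n m] by simp
  qed
  then have "infinite (u ` I)" using inf finite_image_iff by blast
  moreover have "compact (closure (R ` cball 0 B))"
    using R by (intro compact_linear_cball) (simp add: compact_operator_iff)
  ultimately obtain l where l: "l islimpt (u ` I)"
    using Heine_Borel_imp_Bolzano_Weierstrass[of "closure (R ` cball 0 B)" "u ` I"] u by blast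
  have "\<not> l islimpt (u ` I)"
  proof (rule discrete_imp_not_islimpt[of 1])
    fix p q assume "p \<in> u ` I" "q \<in> u ` I" "dist q p < 1"
    then obtain n m where "n \<in> I" "p = u n" "q = u m" "dist (u m) (u n) < 1" by blast
    then show "q = p" using sep[of n m] by (cases "m = n") (simp_all add: dist_commute)
  qed simp
  then show False using l by blast
qed

text \<open>The summand \<open>0\<close> may have a kernel, so it enters only through its resolvents
  at points of \<open>(0, 1)\<close>. It does not influence the limit, as the filter ignores
  finitely many indices.\<close>

theorem compact_resolvent_direct_sum_iff:
  fixes D :: "int \<Rightarrow> 'a::{complex_inner_space,complete_space} unbounded_op"
  assumes D: "\<And>n. n \<noteq> 0 \<Longrightarrow> D n = {(T n y, y) | y. True}"
    and T: "\<And>n. n \<noteq> 0 \<Longrightarrow> compact_operator (T n)"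
    and D0: "\<And>\<mu>. 0 < \<mu> \<Longrightarrow> \<mu> < 1 \<Longrightarrow> \<exists>R. compact_operator R \<and> is_resolvent (D 0) (complex_of_real \<mu>) R"
  shows "compact_resolvent (direct_sum_op D) \<longleftrightarrow> ((\<lambda>n. onorm (T n)) \<longlongrightarrow> 0) (filtercomap abs at_top)"
proof
  have bl: "bounded_linear (T n)" if "n \<noteq> 0" for n
    using T[OF that] by (simp add: compact_operator_def)
  {
    assume "compact_resolvent (direct_sum_op D)"
    then obtain \<mu> R where R: "is_resolvent (direct_sum_op D) \<mu> R" "compact_operator R"
      unfolding compact_resolvent_def by blast
    have zero: "(0, 0) \<in> D n" for n
    proof (cases "n = 0")
      case True
      \<comment> \<open>Any point of \<open>(0, 1)\<close> would do: linearity of the resolvent puts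
        \<open>(0, 0)\<close> into the graph of the summand \<open>0\<close>.\<close>
      obtain R0 where R0: "is_resolvent (D 0) (complex_of_real (1 / 2)) R0" using D0[of "1 / 2"] by auto
      interpret R0: bounded_linear R0 using R0 by (simp add: is_resolvent_def)
      have "scaleC (complex_of_real (1 / 2)) (0 :: 'a) = 0" unfolding scaleC_of_real by simp
      then show ?thesis using is_resolvent_iff[OF R0, of 0 0] True R0.zero by simp
    next
      case False
      have "T n 0 = 0" by (rule linear_0[OF bounded_linear.linear[OF bl[OF False]]])
      then show ?thesis using D[OF False] by force
    qed
    show "((\<lambda>n. onorm (T n)) \<longlongrightarrow> 0) (filtercomap abs at_top)"
    proof (rule tendstoI)
      fix e :: real assume e: "e > 0"
      \<comment> \<open>The threshold \<open>e / 2\<close> leaves room for the strict inequality, as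
        the operator norm is obtained from a bound that may be attained.\<close>
      let ?I = "{n. \<exists>x y. (x, y) \<in> D n \<and> norm y \<le> 1 \<and> norm x > e / 2}"
      have "finite ?I" by (rule compact_resolvent_finitely_many_large[OF R zero]) (use e in simp)
      then have "finite (abs ` ?I)" by simp
      then obtain N :: int where N: "\<And>n. n \<in> ?I \<Longrightarrow> \<bar>n\<bar> \<le> N"
        by (meson bdd_above_def bdd_above_finite imageI)
      have "dist (onorm (T n)) 0 < e" if n: "\<bar>n\<bar> \<ge> max 1 (N + 1)" for n
      proof -
        have n0: "n \<noteq> 0" and nI: "n \<notin> ?I" using n N[of n] by auto
        interpret T: bounded_linear "T n" by (rule bl[OF n0])
        have small: "norm (T n y) \<le> e / 2" if "norm y \<le> 1" for y
          using nI D[OF n0] that by force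
        have "onorm (T n) \<le> e / 2"
        proof (rule onorm_bound)
          fix y
          show "norm (T n y) \<le> e / 2 * norm y"
          proof (cases "y = 0")
            case False
            have "norm (T n (y /\<^sub>R norm y)) \<le> e / 2" by (rule small) (use False in simp)
            then show ?thesis using False by (simp add: T.scaleR field_simps)
          qed (simp add: T.zero)
        qed (use e in simp)
        moreover have "0 \<le> onorm (T n)" by (rule onorm_pos_le[OF bl[OF n0]])
        ultimately show ?thesis using e by simp
      qed
      then show "\<forall>\<^sub>F n in filtercomap abs at_top. dist (onorm (T n)) 0 < e"
        unfolding eventually_filtercomap_at_top_linorder by blast
    qed
  next
    assume lim: "((\<lambda>n. onorm (T n)) \<longlongrightarrow> 0) (filtercomap abs at_top)"
    have ev: "\<exists>F. finite F \<and> (\<forall>n. n \<notin> F \<longrightarrow> n \<noteq> 0 \<and> onorm (T n) < e)" if e: "e > 0" for e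
    proof -
      from tendstoD[OF lim e] obtain N where N: "\<And>n. \<bar>n\<bar> \<ge> N \<Longrightarrow> dist (onorm (T n)) 0 < e"
        unfolding eventually_filtercomap_at_top_linorder by blast
      have "n \<noteq> 0 \<and> onorm (T n) < e" if "n \<notin> {- \<bar>N\<bar>..\<bar>N\<bar>}" for n
      proof -
        have "\<bar>n\<bar> \<ge> N" "n \<noteq> 0" using that by auto
        then show ?thesis using N[of n] by simp
      qed
      then show ?thesis by (intro exI[of _ "{- \<bar>N\<bar>..\<bar>N\<bar>}"]) auto
    qed
    obtain F where F: "finite F" "\<And>n. n \<notin> F \<Longrightarrow> n \<noteq> 0 \<and> onorm (T n) < 1" using ev[of 1] by auto
    \<comment> \<open>Finite although it bounds infinitely many norms: outside \<open>F\<close> they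
      are below \<open>1\<close>, inside they are terms of the sum.\<close>
    define K where "K = 1 + (\<Sum>n\<in>F - {0}. onorm (T n))"
    have K: "onorm (T n) \<le> K" "K \<ge> 1" if "n \<noteq> 0" for n
    proof -
      have nn: "0 \<le> onorm (T m)" if "m \<in> F - {0}" for m using onorm_pos_le[OF bl] that by simp
      then have s: "0 \<le> (\<Sum>n\<in>F - {0}. onorm (T n))" by (rule sum_nonneg)
      then show "K \<ge> 1" by (simp add: K_def)
      show "onorm (T n) \<le> K"
      proof (cases "n \<in> F")
        case True
        then have "onorm (T n) \<le> (\<Sum>n\<in>F - {0}. onorm (T n))"
          using that F(1) nn by (intro member_le_sum) auto
        then show ?thesis by (simp add: K_def)
      next
        case False
        then show ?thesis using F(2)[OF False] s by (simp add: K_def)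
      qed
    qed
    have K1: "K \<ge> 1" using K(2)[of 1] by simp
    \<comment> \<open>Small enough for the Neumann series in every summand
      \<open>n \<noteq> 0\<close> at once, and in \<open>(0, 1)\<close> because
      \<open>K \<ge> 1\<close>.\<close>
    define \<mu> where "\<mu> = 1 / (2 * K)"
    have \<mu>: "0 < \<mu>" "\<mu> < 1" using K1 by (auto simp: \<mu>_def field_simps)
    obtain R0 where R0: "compact_operator R0" "is_resolvent (D 0) (complex_of_real \<mu>) R0"
      using D0[OF \<mu>] by blast
    have "\<exists>R. compact_operator R \<and> (\<forall>w. norm (R w) \<le> 2 * onorm (T n) * norm w) \<and>
        (\<forall>w x. (\<exists>y. x = T n y \<and> w = y - \<mu> *\<^sub>R x) \<longleftrightarrow> x = R w)" if n: "n \<noteq> 0" for n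
      unfolding compact_operator_iff
    proof (rule neumann_inverse)
      show "compact_linear (T n)" using T[OF n] by (simp add: compact_operator_iff)
      show "norm (T n x) \<le> onorm (T n) * norm x" for x by (rule onorm[OF bl[OF n]])
      have "\<bar>\<mu>\<bar> * onorm (T n) \<le> \<mu> * K" using K(1)[OF n] \<mu>(1) by (simp add: mult_left_mono)
      also have "\<dots> = 1 / 2" using K1 by (simp add: \<mu>_def)
      finally show "\<bar>\<mu>\<bar> * onorm (T n) \<le> 1 / 2" .
    qed
    then obtain R' where R': "\<And>n. n \<noteq> 0 \<Longrightarrow> compact_operator (R' n)"
      "\<And>n w. n \<noteq> 0 \<Longrightarrow> norm (R' n w) \<le> 2 * onorm (T n) * norm w"
      "\<And>n w x. n \<noteq> 0 \<Longrightarrow> (\<exists>y. x = T n y \<and> w = y - \<mu> *\<^sub>R x) \<longleftrightarrow> x = R' n w"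
      by metis
    define R where "R n = (if n = 0 then R0 else R' n)" for n
    have Rc: "compact_operator (R n)" for n using R0(1) R'(1) by (simp add: R_def)
    have Rres: "is_resolvent (D n) (complex_of_real \<mu>) (R n)" for n
    proof (cases "n = 0")
      case True
      then show ?thesis using R0(2) by (simp add: R_def)
    next
      case False
      show ?thesis
      proof (rule is_resolventI)
        show "bounded_linear (R n)" using Rc by (simp add: compact_operator_def)
        fix x y
        have "(x, y) \<in> D n \<longleftrightarrow> x = T n y" using D[OF False] by auto
        also have "\<dots> \<longleftrightarrow> (\<exists>y'. x = T n y' \<and> y - \<mu> *\<^sub>R x = y' - \<mu> *\<^sub>R x)" by auto
        also have "\<dots> \<longleftrightarrow> x = R n (y - scaleC (complex_of_real \<mu>) x)"
          using R'(3)[OF False, of x "y - \<mu> *\<^sub>R x"] False by (simp add: R_def scaleC_of_real)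
        finally show "(x, y) \<in> D n \<longleftrightarrow> x = R n (y - scaleC (complex_of_real \<mu>) x)" .
      qed
    qed
    define B where "B = max (2 * K) (onorm R0)"
    have B: "norm (R n a) \<le> B * norm a" for n a
    proof (cases "n = 0")
      case True
      have "norm (R0 a) \<le> onorm R0 * norm a"
        by (rule onorm) (use R0(1) in \<open>simp add: compact_operator_def\<close>)
      also have "\<dots> \<le> B * norm a" by (intro mult_right_mono) (auto simp: B_def)
      finally show ?thesis using True by (simp add: R_def)
    next
      case False
      have "norm (R' n a) \<le> 2 * onorm (T n) * norm a" by (rule R'(2)[OF False])
      also have "\<dots> \<le> B * norm a" using K(1)[OF False] by (intro mult_right_mono) (auto simp: B_def)
      finally show ?thesis using False by (simp add: R_def)
    qed
    have "compact_linear (l2_diag R)"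
    proof (rule compact_linear_l2_diag[of R B])
      show "compact_linear (R n)" for n using Rc by (simp add: compact_operator_iff)
      show "norm (R n a) \<le> B * norm a" for n a by (rule B)
      show "B \<ge> 0" using K1 by (simp add: B_def)
      fix e :: real assume "e > 0"
      then obtain F where F: "finite F" "\<And>n. n \<notin> F \<Longrightarrow> n \<noteq> 0 \<and> onorm (T n) < e / 2" using ev[of "e / 2"] by auto
      have "norm (R n a) \<le> e * norm a" if "n \<notin> F" for n a
      proof -
        have n: "n \<noteq> 0" "onorm (T n) < e / 2" using F(2)[OF that] by auto
        have "norm (R' n a) \<le> 2 * onorm (T n) * norm a" by (rule R'(2)[OF n(1)])
        also have "\<dots> \<le> e * norm a" using n(2) by (intro mult_right_mono) auto
        finally show ?thesis using n(1) by (simp add: R_def)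
      qed
      then show "\<exists>F. finite F \<and> (\<forall>n a. n \<notin> F \<longrightarrow> norm (R n a) \<le> e * norm a)" using F(1) by blast
    qed
    then have lc: "compact_operator (l2_diag R)" by (simp add: compact_operator_iff)
    then have "is_resolvent (direct_sum_op D) (complex_of_real \<mu>) (l2_diag R)"
      by (intro direct_sum_is_resolvent[OF Rres B]) (simp add: compact_operator_def)
    then show "compact_resolvent (direct_sum_op D)"
      unfolding compact_resolvent_def using lc by blast
  }
qed

section \<open>The components of the Dirac operator\<close>

lemma circle_C1I:
  assumes "\<And>z. z \<in> circle \<Longrightarrow> (\<phi> has_field_derivative \<phi>' z) (at z within circle)" "continuous_on circle \<phi>'"
  shows "circle_C1 \<phi>" "\<And>z. z \<in> circle \<Longrightarrow> circle_deriv \<phi> z = \<phi>' z"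
proof -
  show d: "circle_deriv \<phi> z = \<phi>' z" if "z \<in> circle" for z by (rule circle_deriv_eq[OF that assms(1)[OF that]])
  show "circle_C1 \<phi>"
    unfolding circle_C1_def field_differentiable_def
    using assms(1) continuous_on_eq[OF assms(2) d[symmetric]] by blast
qed

lemma circle_C1_has_derivative:
  "circle_C1 \<phi> \<Longrightarrow> z \<in> circle \<Longrightarrow> (\<phi> has_field_derivative circle_deriv \<phi> z) (at z within circle)"
  by (simp add: has_field_derivative_circle_deriv circle_C1_def)

lemma circle_C1_cong:
  assumes "circle_C1 \<phi>" "\<And>z. z \<in> circle \<Longrightarrow> \<phi> z = \<psi> z"
  shows "circle_C1 \<psi>"
proof (rule circle_C1I(1))
  show "(\<psi> has_field_derivative circle_deriv \<phi> z) (at z within circle)" if "z \<in> circle" for z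
    using circle_C1_has_derivative[OF assms(1) that] has_field_derivative_circle_cong[of z \<phi> \<psi>, OF that assms(2)] by blast
  show "continuous_on circle (circle_deriv \<phi>)" using assms(1) by (simp add: circle_C1_def)
qed

lemma circle_C1_mult:
  assumes "circle_C1 \<phi>" "circle_C1 \<psi>"
  shows "circle_C1 (\<lambda>z. \<phi> z * \<psi> z)"
proof (rule circle_C1I(1))
  show "((\<lambda>z. \<phi> z * \<psi> z) has_field_derivative circle_deriv \<phi> z * \<psi> z + circle_deriv \<psi> z * \<phi> z) (at z within circle)"
    if "z \<in> circle" for z
    by (rule DERIV_mult[OF circle_C1_has_derivative[OF assms(1) that] circle_C1_has_derivative[OF assms(2) that]])
  show "continuous_on circle (\<lambda>z. circle_deriv \<phi> z * \<psi> z + circle_deriv \<psi> z * \<phi> z)"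
    using assms circle_C1_continuous by (intro continuous_intros) (auto simp: circle_C1_def)
qed

lemma circle_C1_inverse:
  assumes "circle_C1 \<phi>" and nz: "\<And>z. z \<in> circle \<Longrightarrow> \<phi> z \<noteq> 0"
  shows "circle_C1 (\<lambda>z. inverse (\<phi> z))"
proof (rule circle_C1I(1))
  show "((\<lambda>z. inverse (\<phi> z)) has_field_derivative - (inverse (\<phi> z) * circle_deriv \<phi> z * inverse (\<phi> z))) (at z within circle)"
    if "z \<in> circle" for z
    by (rule DERIV_inverse'[OF circle_C1_has_derivative[OF assms(1) that] nz[OF that]])
  show "continuous_on circle (\<lambda>z. - (inverse (\<phi> z) * circle_deriv \<phi> z * inverse (\<phi> z)))"
    using assms circle_C1_continuous by (intro continuous_intros) (auto simp: circle_C1_def)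
qed

lemma circle_C1_ident: "circle_C1 (\<lambda>z. z)" and circle_deriv_ident: "z \<in> circle \<Longrightarrow> circle_deriv (\<lambda>z. z) z = 1"
  using circle_C1I[of "\<lambda>z. z" "\<lambda>_. 1"] by auto

lemma circle_has_derivative_compose:
  assumes "circle_C1 \<phi>" "circle_C1 g" "g ` circle \<subseteq> circle" "z \<in> circle"
  shows "((\<lambda>z. \<phi> (g z)) has_field_derivative circle_deriv \<phi> (g z) * circle_deriv g z) (at z within circle)"
proof -
  have "g z \<in> circle" using assms(3,4) by blast
  from DERIV_subset[OF circle_C1_has_derivative[OF assms(1) this] assms(3)]
    circle_C1_has_derivative[OF assms(2,4)]
  have "(\<phi> \<circ> g has_field_derivative circle_deriv \<phi> (g z) * circle_deriv g z) (at z within circle)"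
    by (rule DERIV_image_chain)
  then show ?thesis by (simp add: o_def)
qed

lemma circle_C1_compose:
  assumes "circle_C1 \<phi>" "circle_C1 g" "g ` circle \<subseteq> circle"
  shows "circle_C1 (\<lambda>z. \<phi> (g z))"
    and "\<And>z. z \<in> circle \<Longrightarrow> circle_deriv (\<lambda>z. \<phi> (g z)) z = circle_deriv \<phi> (g z) * circle_deriv g z"
proof -
  have "continuous_on circle (\<lambda>z. circle_deriv \<phi> (g z))"
    by (rule continuous_on_compose2[OF _ circle_C1_continuous[OF assms(2)] assms(3)])
      (use assms(1) in \<open>simp add: circle_C1_def\<close>)
  then have "continuous_on circle (\<lambda>z. circle_deriv \<phi> (g z) * circle_deriv g z)"
    using assms(2) by (intro continuous_intros) (simp_all add: circle_C1_def)
  note * = circle_C1I[OF circle_has_derivative_compose[OF assms] this]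
  show "circle_C1 (\<lambda>z. \<phi> (g z))" by (rule *(1))
  show "\<And>z. z \<in> circle \<Longrightarrow> circle_deriv (\<lambda>z. \<phi> (g z)) z = circle_deriv \<phi> (g z) * circle_deriv g z" by (rule *(2))
qed

text \<open>A regularity class stable under composition. Two derivatives are asked for because the
  weight \<open>dirac_delta\<close> contains the first derivative of an iterate and must itself be a
  \<open>circle_C1\<close> multiplier.\<close>

definition circle_C2_map :: "(complex \<Rightarrow> complex) \<Rightarrow> bool" where
  "circle_C2_map g \<longleftrightarrow> g ` circle \<subseteq> circle \<and> circle_C1 g \<and> circle_C1 (circle_deriv g)"

lemma circle_C2_map_compose:
  assumes f: "circle_C2_map f" and g: "circle_C2_map g"
  shows "circle_C2_map (\<lambda>z. f (g z))"
  unfolding circle_C2_map_def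
proof (intro conjI)
  have m: "f ` circle \<subseteq> circle" "g ` circle \<subseteq> circle" and c: "circle_C1 f" "circle_C1 g"
    and d: "circle_C1 (circle_deriv f)" "circle_C1 (circle_deriv g)"
    using f g by (simp_all add: circle_C2_map_def)
  show "(\<lambda>z. f (g z)) ` circle \<subseteq> circle" using m by blast
  show "circle_C1 (\<lambda>z. f (g z))" by (rule circle_C1_compose(1)[OF c m(2)])
  have "circle_C1 (\<lambda>z. circle_deriv f (g z) * circle_deriv g z)"
    by (rule circle_C1_mult[OF circle_C1_compose(1)[OF d(1) c(2) m(2)] d(2)])
  then show "circle_C1 (circle_deriv (\<lambda>z. f (g z)))"
    by (rule circle_C1_cong) (rule circle_C1_compose(2)[OF c m(2), symmetric])
qed

lemma circle_C2_map_funpow: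
  assumes "circle_C2_map f" shows "circle_C2_map (f ^^ k)"
proof (induction k)
  case 0
  have "circle_C1 (circle_deriv (\<lambda>z. z))"
    by (rule circle_C1_cong[OF circle_C1_const[of 1]]) (simp add: circle_deriv_ident)
  then show ?case by (simp add: circle_C2_map_def circle_C1_ident id_def)
next
  case (Suc k)
  then show ?case using circle_C2_map_compose[OF assms] by (simp add: o_def)
qed

lemma circle_smooth_imp_C2_map:
  assumes "circle_smooth f" "f ` circle \<subseteq> circle"
  shows "circle_C2_map f"
proof -
  have d: "(circle_deriv ^^ k) f field_differentiable (at z within circle)" if "z \<in> circle" for k z
    using assms(1) that unfolding circle_smooth_def by blast
  have c: "continuous_on circle ((circle_deriv ^^ k) f)" for k
    by (rule circle_differentiable_imp_continuous) (rule d)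
  show ?thesis
    using assms(2) d[of _ 0] d[of _ 1] c[of 1] c[of 2]
    by (simp add: circle_C2_map_def circle_C1_def numeral_2_eq_2)
qed

lemma funpow_left_inverse:
  assumes "\<And>z. z \<in> A \<Longrightarrow> q (p z) = z" "p ` A \<subseteq> A" "z \<in> A"
  shows "(q ^^ k) ((p ^^ k) z) = z"
proof (induction k)
  case (Suc k)
  have "(p ^^ k) z \<in> A" using assms(2,3) by (induction k) auto
  then have "q (p ((p ^^ k) z)) = (p ^^ k) z" by (rule assms(1))
  moreover have "(q ^^ Suc k) w = (q ^^ k) (q w)" for w by (simp only: funpow_Suc_right o_apply)
  moreover have "(p ^^ Suc k) z = p ((p ^^ k) z)" by simp
  ultimately have "(q ^^ Suc k) ((p ^^ Suc k) z) = (q ^^ k) ((p ^^ k) z)" by metis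
  then show ?case using Suc by simp
qed simp

text \<open>The chain rule for \<open>q (p z) = z\<close> exhibits an inverse of the
  derivative.\<close>

lemma circle_deriv_nonzero:
  assumes p: "circle_C1 p" "p ` circle \<subseteq> circle" and q: "circle_C1 q" and inv: "\<And>z. z \<in> circle \<Longrightarrow> q (p z) = z"
    and z: "z \<in> circle"
  shows "circle_deriv p z \<noteq> 0"
proof -
  have "circle_deriv (\<lambda>z. q (p z)) z = circle_deriv (\<lambda>z. z) z" by (rule circle_deriv_cong[OF z inv])
  then have "circle_deriv q (p z) * circle_deriv p z = 1"
    by (simp add: circle_C1_compose(2)[OF q p z] circle_deriv_ident[OF z])
  then show ?thesis by auto
qed

text \<open>Forward and backward iterates are both powers of a map in the stable class, and on the
  circle the iterate of index \<open>- n\<close> inverts the one of index \<open>n\<close>, so the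
  derivatives cannot vanish.\<close>

lemma
  assumes "circle_diffeo f"
  shows circle_iter_C2: "circle_C2_map (circle_iter f n)"
    and circle_iter_deriv_nonzero: "\<And>z. z \<in> circle \<Longrightarrow> circle_deriv (circle_iter f n) z \<noteq> 0"
proof -
  let ?h = "the_inv_into circle f"
  have bij: "bij_betw f circle circle" and sm: "circle_smooth f" "circle_smooth ?h"
    using assms by (simp_all add: circle_diffeo_def)
  have bij': "bij_betw ?h circle circle" by (rule bij_betw_the_inv_into[OF bij])
  have f: "circle_C2_map f" by (rule circle_smooth_imp_C2_map[OF sm(1)]) (use bij in \<open>simp add: bij_betw_def\<close>)
  have h: "circle_C2_map ?h" by (rule circle_smooth_imp_C2_map[OF sm(2)]) (use bij' in \<open>simp add: bij_betw_def\<close>)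
  have hf: "?h (f z) = z" if "z \<in> circle" for z
    using bij that by (simp add: bij_betw_def the_inv_into_f_f)
  have fh: "f (?h z) = z" if "z \<in> circle" for z
    using bij that by (simp add: bij_betw_def f_the_inv_into_f)
  show C2: "circle_C2_map (circle_iter f n)" for n
    using circle_C2_map_funpow[OF f] circle_C2_map_funpow[OF h] by (simp add: circle_iter_def)
  have fc: "f ` circle \<subseteq> circle" "?h ` circle \<subseteq> circle" using f h by (simp_all add: circle_C2_map_def)
  have inv: "circle_iter f (- n) (circle_iter f n z) = z" if z: "z \<in> circle" for z
  proof -
    consider "n > 0" | "n = 0" | "n < 0" by linarith
    then show ?thesis
    proof cases
      case 1
      then show ?thesis using funpow_left_inverse[of circle ?h f z "nat n", OF hf fc(1) z] by (simp add: circle_iter_def)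
    next
      case 3
      then show ?thesis using funpow_left_inverse[of circle f ?h z "nat (- n)", OF fh fc(2) z] by (simp add: circle_iter_def)
    qed (simp add: circle_iter_def)
  qed
  show "circle_deriv (circle_iter f n) z \<noteq> 0" if "z \<in> circle" for z
    by (rule circle_deriv_nonzero[of _ "circle_iter f (- n)", OF _ _ _ inv that])
      (use C2[of n] C2[of "- n"] in \<open>simp_all add: circle_C2_map_def\<close>)
qed

section \<open>Multiplication operators and the components with nonzero index\<close>

definition mult_L2 :: "(complex \<Rightarrow> complex) \<Rightarrow> circle_L2 \<Rightarrow> circle_L2" where
  "mult_L2 \<phi> x = class_L2 (\<lambda>z. \<phi> z * rep_L2 x z)"

lemma square_integrable_continuous_mult:
  assumes "continuous_on circle \<phi>" "square_integrable f"
  shows "square_integrable (\<lambda>z. \<phi> z * f z)"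
proof -
  obtain C where "\<And>z. z \<in> circle \<Longrightarrow> cmod (\<phi> z) \<le> C" using continuous_on_circle_bounded[OF assms(1)] by blast
  then show ?thesis
    by (rule square_integrable_bounded_mult[OF borel_measurable_continuous_circle[OF assms(1)] _ assms(2)])
qed

lemma mult_L2_class:
  assumes \<phi>: "continuous_on circle \<phi>" and f: "square_integrable f"
  shows "mult_L2 \<phi> (class_L2 f) = class_L2 (\<lambda>z. \<phi> z * f z)"
  unfolding mult_L2_def
proof (subst class_L2_eq_iff)
  show "AE z in circle_measure. \<phi> z * rep_L2 (class_L2 f) z = \<phi> z * f z"
    using rep_class_AE[OF f] by eventually_elim simp
qed (intro square_integrable_continuous_mult \<phi> f square_integrable_rep)+

lemma norm_mult_L2_le:
  assumes \<phi>: "continuous_on circle \<phi>" and C: "\<And>z. z \<in> circle \<Longrightarrow> cmod (\<phi> z) \<le> C" "C \<ge> 0"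
  shows "norm (mult_L2 \<phi> x) \<le> C * norm x"
proof -
  let ?f = "rep_L2 x"
  have sq: "square_integrable (\<lambda>z. \<phi> z * ?f z)"
    by (rule square_integrable_continuous_mult[OF \<phi> square_integrable_rep])
  have "(norm (mult_L2 \<phi> x))\<^sup>2 = integral\<^sup>L circle_measure (\<lambda>z. (cmod (\<phi> z * ?f z))\<^sup>2)"
    unfolding mult_L2_def by (rule norm_class_L2[OF sq])
  also have "\<dots> \<le> integral\<^sup>L circle_measure (\<lambda>z. C\<^sup>2 * (cmod (?f z))\<^sup>2)"
  proof (rule integral_mono)
    show "integrable circle_measure (\<lambda>z. (cmod (\<phi> z * ?f z))\<^sup>2)" using sq by (simp add: square_integrable_def)
    show "integrable circle_measure (\<lambda>z. C\<^sup>2 * (cmod (?f z))\<^sup>2)"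
      using square_integrable_rep[of x] by (simp add: square_integrable_def)
    show "(cmod (\<phi> z * ?f z))\<^sup>2 \<le> C\<^sup>2 * (cmod (?f z))\<^sup>2" if "z \<in> space circle_measure" for z
      using power_mono[OF C(1), of z 2] that by (simp add: norm_mult power_mult_distrib mult_right_mono)
  qed
  also have "\<dots> = (C * norm x)\<^sup>2"
    using norm_class_L2[OF square_integrable_rep[of x]] by (simp add: power_mult_distrib)
  finally show ?thesis by (rule power2_le_imp_le) (simp add: C(2))
qed

lemma bounded_linear_mult_L2:
  assumes \<phi>: "continuous_on circle \<phi>"
  shows "bounded_linear (mult_L2 \<phi>)"
proof -
  obtain C where C: "\<And>z. z \<in> circle \<Longrightarrow> cmod (\<phi> z) \<le> C" using continuous_on_circle_bounded[OF \<phi>] by blast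
  have "0 \<le> C" using C[of 1] norm_ge_zero[of "\<phi> 1"] by (simp del: norm_ge_zero)
  show ?thesis
  proof (rule bounded_linear_intro)
    note sq = square_integrable_continuous_mult[OF \<phi> square_integrable_rep]
    show "mult_L2 \<phi> (x + y) = mult_L2 \<phi> x + mult_L2 \<phi> y" for x y
    proof -
      have "mult_L2 \<phi> (class_L2 (rep_L2 x) + class_L2 (rep_L2 y)) = mult_L2 \<phi> (class_L2 (\<lambda>z. rep_L2 x z + rep_L2 y z))"
        by (subst class_L2_add) simp_all
      also have "\<dots> = class_L2 (\<lambda>z. \<phi> z * rep_L2 x z + \<phi> z * rep_L2 y z)"
        by (subst mult_L2_class[OF \<phi>]) (simp_all add: square_integrable_add distrib_left)
      also have "\<dots> = mult_L2 \<phi> x + mult_L2 \<phi> y" unfolding mult_L2_def by (rule class_L2_add[OF sq sq])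
      finally show ?thesis by simp
    qed
    show "mult_L2 \<phi> (r *\<^sub>R x) = r *\<^sub>R mult_L2 \<phi> x" for r x
    proof -
      have "mult_L2 \<phi> (r *\<^sub>R class_L2 (rep_L2 x)) = mult_L2 \<phi> (class_L2 (\<lambda>z. complex_of_real r * rep_L2 x z))"
        by (subst class_L2_scaleR) simp_all
      also have "\<dots> = class_L2 (\<lambda>z. complex_of_real r * (\<phi> z * rep_L2 x z))"
        by (subst mult_L2_class[OF \<phi>]) (simp_all add: square_integrable_scale mult.left_commute)
      also have "\<dots> = r *\<^sub>R mult_L2 \<phi> x" unfolding mult_L2_def by (rule class_L2_scaleR[OF sq])
      finally show ?thesis by simp
    qed
    show "norm (mult_L2 \<phi> x) \<le> norm x * C" for x
      using norm_mult_L2_le[OF \<phi> C \<open>0 \<le> C\<close>] by (simp add: mult.commute)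
  qed
qed

lemma mult_L2_inverse:
  assumes \<phi>: "continuous_on circle \<phi>" and \<psi>: "continuous_on circle \<psi>"
    and one: "\<And>z. z \<in> circle \<Longrightarrow> \<phi> z * \<psi> z = 1"
  shows "mult_L2 \<phi> (mult_L2 \<psi> x) = x"
proof -
  note sq = square_integrable_continuous_mult[OF \<psi> square_integrable_rep]
  have "mult_L2 \<phi> (mult_L2 \<psi> x) = class_L2 (\<lambda>z. \<phi> z * (\<psi> z * rep_L2 x z))"
    unfolding mult_L2_def[of \<psi>] by (rule mult_L2_class[OF \<phi> sq])
  also have "\<dots> = class_L2 (rep_L2 x)"
  proof (subst class_L2_eq_iff)
    show "AE z in circle_measure. \<phi> z * (\<psi> z * rep_L2 x z) = rep_L2 x z"
      using AE_circle_space by eventually_elim (simp add: one mult.assoc[symmetric])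
  qed (intro square_integrable_continuous_mult[OF \<phi> sq] square_integrable_rep)+
  finally show ?thesis by simp
qed

text \<open>On the circle \<open>z\<close> and its iterates have modulus \<open>1\<close>, so the
  weight has the modulus of the derivative of the iterate. That derivative is continuous, hence
  bounded, so the supremum in \<open>growth\<close> is a true upper bound.\<close>

lemma dirac_delta_C1:
  assumes "circle_diffeo f"
  shows "circle_C1 (dirac_delta f n)" and "\<And>z. z \<in> circle \<Longrightarrow> dirac_delta f n z \<noteq> 0"
    and "\<And>z. z \<in> circle \<Longrightarrow> cmod (dirac_delta f n z) \<le> growth f (nat \<bar>n\<bar>)"
    and growth_pos: "growth f k > 0"
proof -
  let ?g = "circle_iter f n"
  have g: "?g ` circle \<subseteq> circle" "circle_C1 ?g" "circle_C1 (circle_deriv ?g)"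
    using circle_iter_C2[OF assms, of n] by (simp_all add: circle_C2_map_def)
  have g1: "cmod (?g z) = 1" "?g z \<noteq> 0" if "z \<in> circle" for z
  proof -
    have "?g z \<in> circle" using g(1) that by blast
    then show "cmod (?g z) = 1" "?g z \<noteq> 0" by auto
  qed
  have eq: "dirac_delta f n = (\<lambda>z. (z * circle_deriv ?g z) * inverse (?g z))"
    by (simp add: fun_eq_iff dirac_delta_def divide_inverse)
  show "circle_C1 (dirac_delta f n)"
    unfolding eq by (intro circle_C1_mult circle_C1_ident circle_C1_inverse g g1)
  show "dirac_delta f n z \<noteq> 0" if "z \<in> circle" for z
    using circle_iter_deriv_nonzero[OF assms that] g1(2)[OF that] that by (auto simp: dirac_delta_def)
  have le: "cmod (circle_deriv (circle_iter f m) z) \<le> growth f k"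
    if "z \<in> circle" "m = int k \<or> m = - int k" for z k m
  proof -
    have "circle_C1 (circle_iter f m)" using circle_iter_C2[OF assms, of m] by (simp add: circle_C2_map_def)
    then have "continuous_on circle (circle_deriv (circle_iter f m))" by (simp add: circle_C1_def)
    then obtain C where C: "\<And>z. z \<in> circle \<Longrightarrow> cmod (circle_deriv (circle_iter f m) z) \<le> C"
      using continuous_on_circle_bounded by blast
    have "cmod (circle_deriv (circle_iter f m) z) \<le> circle_sup_norm (circle_deriv (circle_iter f m))"
      unfolding circle_sup_norm_def by (intro cSUP_upper that(1) bdd_aboveI2[of _ _ C] C)
    then show ?thesis using that(2) by (auto simp: growth_def)
  qed
  show "cmod (dirac_delta f n z) \<le> growth f (nat \<bar>n\<bar>)" if z: "z \<in> circle" for z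
  proof -
    have "n = int (nat \<bar>n\<bar>) \<or> n = - int (nat \<bar>n\<bar>)" by linarith
    from le[OF z this] show ?thesis using g1(1)[OF z] z by (simp add: dirac_delta_def norm_mult norm_divide)
  qed
  have "0 < cmod (circle_deriv (circle_iter f (int k)) 1)"
    using circle_iter_deriv_nonzero[OF assms, of 1 "int k"] by simp
  also have "\<dots> \<le> growth f k" by (rule le) auto
  finally show "growth f k > 0" .
qed

lemma dirac_a_nonzero:
  assumes "circle_diffeo f" "n \<noteq> 0"
  shows "dirac_a f n \<noteq> 0"
proof -
  have "0 < (\<Sum>l=1..nat \<bar>n\<bar>. 1 / growth f l)" "0 < (\<Sum>l=1..nat \<bar>n\<bar>. 1 / growth f (l - 1))"
    by (rule sum_pos; use growth_pos[OF assms(1)] assms(2) in simp)+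
  then show ?thesis using assms(2) by (cases "n > 0") (auto simp: dirac_a_def)
qed

text \<open>The weights are moved to the other side: the first row says that
  \<open>dirac_L a\<close> maps \<open>x2\<close> to \<open>\<delta> * y1\<close>, the second that
  \<open>dirac_L_adj a\<close> maps \<open>x1 / \<delta>\<close> to \<open>y2\<close>.
  Multiplication by \<open>\<delta>\<close> and by its inverse preserves \<open>circle_H1\<close>,
  so the domains match.\<close>

lemma weighted_first_order_graph_iff:
  assumes \<delta>: "circle_C1 \<delta>" and nz: "\<And>z. z \<in> circle \<Longrightarrow> \<delta> z \<noteq> 0"
  shows "((x1, x2), (y1, y2)) \<in> {((class_L2 u, class_L2 v),
       (class_L2 (\<lambda>z. inverse (\<delta> z) * dirac_L a v z),
        class_L2 (dirac_L_adj a (\<lambda>z. inverse (\<delta> z) * u z)))) | u v. u \<in> circle_H1 \<and> v \<in> circle_H1} \<longleftrightarrow>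
     (x2, mult_L2 \<delta> y1) \<in> first_order_graph a \<and>
     (mult_L2 (\<lambda>z. inverse (\<delta> z)) x1, - y2) \<in> first_order_graph (- a)" (is "?L \<longleftrightarrow> ?R")
proof -
  let ?\<psi> = "\<lambda>z. inverse (\<delta> z)"
  have \<psi>: "circle_C1 ?\<psi>" by (rule circle_C1_inverse[OF \<delta> nz])
  note c = circle_C1_continuous[OF \<delta>] circle_C1_continuous[OF \<psi>]
  have inv: "mult_L2 \<delta> (mult_L2 ?\<psi> x) = x" "mult_L2 ?\<psi> (mult_L2 \<delta> x) = x" for x
    by (rule mult_L2_inverse[OF c(1) c(2)], simp add: nz, rule mult_L2_inverse[OF c(2) c(1)], simp add: nz)
  have L: "square_integrable (dirac_L a v)" if "v \<in> circle_H1" for v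
    unfolding dirac_L_def by (rule square_integrable_first_order[OF that])
  \<comment> \<open>The negative of \<open>dirac_L_adj a\<close> is the first-order operator with
    parameter \<open>- a\<close>, which explains the sign in front of \<open>y2\<close>.\<close>
  have adj: "class_L2 (dirac_L_adj a w) = - class_L2 (\<lambda>z. \<i> * z * circle_deriv w z - complex_of_real (- a) * w z)"
    if "w \<in> circle_H1" for w
  proof -
    have eq: "dirac_L_adj a w = (\<lambda>z. - (\<i> * z * circle_deriv w z - complex_of_real (- a) * w z))"
      by (simp add: fun_eq_iff dirac_L_adj_def)
    show ?thesis unfolding eq by (rule class_L2_uminus[OF square_integrable_first_order[OF that]])
  qed
  show ?thesis
  proof
    assume ?L
    then obtain u v where u: "u \<in> circle_H1" "x1 = class_L2 u" and v: "v \<in> circle_H1" "x2 = class_L2 v"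
      and y: "y1 = class_L2 (\<lambda>z. ?\<psi> z * dirac_L a v z)" "y2 = class_L2 (dirac_L_adj a (\<lambda>z. ?\<psi> z * u z))" by blast
    have w: "(\<lambda>z. ?\<psi> z * u z) \<in> circle_H1" by (rule circle_H1_mult_C1(1)[OF \<psi> u(1)])
    have "mult_L2 \<delta> y1 = class_L2 (dirac_L a v)"
      unfolding y(1) mult_L2_class[OF c(2) L[OF v(1)], symmetric] by (rule inv)
    then have "(x2, mult_L2 \<delta> y1) \<in> first_order_graph a"
      unfolding first_order_graph_def v(2) dirac_L_def using v(1) by blast
    moreover have "mult_L2 ?\<psi> x1 = class_L2 (\<lambda>z. ?\<psi> z * u z)"
      unfolding u(2) by (rule mult_L2_class[OF c(2) circle_H1_square_integrable[OF u(1)]])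
    then have "(mult_L2 ?\<psi> x1, - y2) \<in> first_order_graph (complex_of_real (- a))"
      unfolding y(2) adj[OF w] first_order_graph_def using w by auto
    ultimately show ?R by simp
  next
    assume R: ?R
    then obtain v where v: "v \<in> circle_H1" "x2 = class_L2 v" "mult_L2 \<delta> y1 = class_L2 (dirac_L a v)"
      unfolding first_order_graph_def dirac_L_def by blast
    from R have "(mult_L2 ?\<psi> x1, - y2) \<in> first_order_graph (complex_of_real (- a))" by simp
    then obtain w where w: "w \<in> circle_H1" "mult_L2 ?\<psi> x1 = class_L2 w"
      "- y2 = class_L2 (\<lambda>z. \<i> * z * circle_deriv w z - complex_of_real (- a) * w z)"
      unfolding first_order_graph_def by blast
    \<comment> \<open>\<open>w\<close> represents \<open>x1 / \<delta>\<close>; multiplying back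
      gives a representative of \<open>x1\<close> in the domain.\<close>
    let ?u = "\<lambda>z. \<delta> z * w z"
    have u: "?u \<in> circle_H1" by (rule circle_H1_mult_C1(1)[OF \<delta> w(1)])
    have "x1 = class_L2 ?u"
      using inv(1)[of x1] w(2) mult_L2_class[OF c(1) circle_H1_square_integrable[OF w(1)]] by simp
    moreover have "y1 = class_L2 (\<lambda>z. ?\<psi> z * dirac_L a v z)"
      using inv(2)[of y1] v(3) mult_L2_class[OF c(2) L[OF v(1)]] by simp
    moreover have "y2 = class_L2 (dirac_L_adj a (\<lambda>z. ?\<psi> z * ?u z))"
    proof -
      have eq: "?\<psi> z * ?u z = w z" if "z \<in> circle" for z using nz[OF that] by simp
      have pw: "(\<lambda>z. ?\<psi> z * ?u z) \<in> circle_H1" by (rule circle_H1_mult_C1(1)[OF \<psi> u])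
      have "AE z in circle_measure. \<i> * z * circle_deriv (\<lambda>z. ?\<psi> z * ?u z) z - complex_of_real (- a) * (?\<psi> z * ?u z) =
          \<i> * z * circle_deriv w z - complex_of_real (- a) * w z"
        using AE_circle_space
      proof eventually_elim
        case (elim z)
        show ?case using circle_deriv_cong[OF elim eq] eq[OF elim] by simp
      qed
      then have "class_L2 (\<lambda>z. \<i> * z * circle_deriv (\<lambda>z. ?\<psi> z * ?u z) z - complex_of_real (- a) * (?\<psi> z * ?u z)) = - y2"
        unfolding w(3)
        by (subst class_L2_eq_iff[OF square_integrable_first_order[OF pw] square_integrable_first_order[OF w(1)]])
      then show ?thesis using adj[OF pw] by simp
    qed
    ultimately show ?L using u v by blast
  qed
qed

lemma dirac_component_iff:
  assumes "circle_diffeo f"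
  shows "((x1, x2), (y1, y2)) \<in> dirac_component f n \<longleftrightarrow>
    (x2, mult_L2 (dirac_delta f n) y1) \<in> first_order_graph (dirac_a f n) \<and>
    (mult_L2 (\<lambda>z. inverse (dirac_delta f n z)) x1, - y2) \<in> first_order_graph (- dirac_a f n)"
  unfolding dirac_component_def
  by (rule weighted_first_order_graph_iff[OF dirac_delta_C1(1)[OF assms] dirac_delta_C1(2)[OF assms]])

text \<open>The solution of the two uncoupled equations: \<open>x2\<close> solves the problem with
  parameter \<open>a\<close> and right-hand side \<open>\<delta> * y1\<close>, and
  \<open>x1 / \<delta>\<close> the one with parameter \<open>- a\<close> and right-hand side
  \<open>- y2\<close>.\<close>

definition component_inverse :: "(complex \<Rightarrow> complex) \<Rightarrow> int \<Rightarrow> circle_L2 \<times> circle_L2 \<Rightarrow> circle_L2 \<times> circle_L2" where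
  "component_inverse f n y =
    (mult_L2 (dirac_delta f n) (periodic_solution_L2 (- complex_of_real (dirac_a f n)) (- snd y)),
     periodic_solution_L2 (complex_of_real (dirac_a f n)) (mult_L2 (dirac_delta f n) (fst y)))"

lemma exp_real_neq_1:
  assumes "a \<noteq> 0"
  shows "exp (2 * complex_of_real pi * complex_of_real a) \<noteq> 1" "exp (2 * complex_of_real pi * - complex_of_real a) \<noteq> 1"
proof -
  have *: "exp (2 * complex_of_real pi * complex_of_real b) \<noteq> 1" if "b \<noteq> 0" for b
  proof -
    have "exp (2 * complex_of_real pi * complex_of_real b) = complex_of_real (exp (2 * pi * b))"
      by (simp flip: exp_of_real)
    moreover have "exp (2 * pi * b) \<noteq> 1" using that by simp
    ultimately show ?thesis by (metis of_real_eq_1_iff)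
  qed
  from *[OF assms] *[of "- a"] assms show "exp (2 * complex_of_real pi * complex_of_real a) \<noteq> 1"
    "exp (2 * complex_of_real pi * - complex_of_real a) \<noteq> 1" by simp_all
qed

context
  fixes f :: "complex \<Rightarrow> complex" and n :: int
  assumes f: "circle_diffeo f" and n: "n \<noteq> 0"
begin

lemma dirac_component_eq: "dirac_component f n = {(component_inverse f n y, y) | y. True}"
proof -
  let ?a = "complex_of_real (dirac_a f n)" and ?\<delta> = "dirac_delta f n"
  let ?\<psi> = "\<lambda>z. inverse (?\<delta> z)"
  note a = exp_real_neq_1[OF dirac_a_nonzero[OF f n]]
  note \<delta> = dirac_delta_C1(1)[OF f, of n] dirac_delta_C1(2)[OF f, of _ n]
  have \<psi>: "circle_C1 ?\<psi>" by (rule circle_C1_inverse[OF \<delta>])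
  note c = circle_C1_continuous[OF \<delta>(1)] circle_C1_continuous[OF \<psi>]
  have inv: "mult_L2 ?\<delta> (mult_L2 ?\<psi> x) = x" "mult_L2 ?\<psi> (mult_L2 ?\<delta> x) = x" for x
    by (rule mult_L2_inverse[OF c(1) c(2)], simp add: \<delta>(2), rule mult_L2_inverse[OF c(2) c(1)], simp add: \<delta>(2))
  have "((x1, x2), (y1, y2)) \<in> dirac_component f n \<longleftrightarrow> (x1, x2) = component_inverse f n (y1, y2)" for x1 x2 y1 y2
  proof -
    have "((x1, x2), (y1, y2)) \<in> dirac_component f n \<longleftrightarrow>
        (x2, mult_L2 ?\<delta> y1) \<in> first_order_graph ?a \<and> (mult_L2 ?\<psi> x1, - y2) \<in> first_order_graph (- ?a)"
      using dirac_component_iff[OF f] by simp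
    also have "\<dots> \<longleftrightarrow> x2 = periodic_solution_L2 ?a (mult_L2 ?\<delta> y1) \<and> mult_L2 ?\<psi> x1 = periodic_solution_L2 (- ?a) (- y2)"
      by (simp only: first_order_graph_iff[OF a(1)] first_order_graph_iff[OF a(2)])
    also have "mult_L2 ?\<psi> x1 = periodic_solution_L2 (- ?a) (- y2) \<longleftrightarrow> x1 = mult_L2 ?\<delta> (periodic_solution_L2 (- ?a) (- y2))"
    proof
      assume "mult_L2 ?\<psi> x1 = periodic_solution_L2 (- ?a) (- y2)"
      from arg_cong[OF this, of "mult_L2 ?\<delta>"] show "x1 = mult_L2 ?\<delta> (periodic_solution_L2 (- ?a) (- y2))"
        by (simp only: inv(1))
    qed (simp only: inv(2))
    finally show ?thesis
      by (simp only: component_inverse_def fst_conv snd_conv prod.inject conj_commute)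
  qed
  then have iff: "(x, y) \<in> dirac_component f n \<longleftrightarrow> x = component_inverse f n y" for x y
    by (cases x; cases y) (simp only:)
  show ?thesis
  proof (rule set_eqI)
    fix p :: "(circle_L2 \<times> circle_L2) \<times> (circle_L2 \<times> circle_L2)"
    show "p \<in> dirac_component f n \<longleftrightarrow> p \<in> {(component_inverse f n y, y) | y. True}"
      using iff[of "fst p" "snd p"] by (cases p) auto
  qed
qed

lemma component_inverse_compact: "compact_operator (component_inverse f n)"
proof -
  note a = exp_real_neq_1[OF dirac_a_nonzero[OF f n]]
  note S = periodic_solution_compact[OF a(1), unfolded compact_operator_iff] periodic_solution_compact[OF a(2), unfolded compact_operator_iff]
  note M = bounded_linear_mult_L2[OF circle_C1_continuous[OF dirac_delta_C1(1)[OF f, of n]]]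
  have "compact_linear (\<lambda>y. (mult_L2 (dirac_delta f n) (periodic_solution_L2 (- complex_of_real (dirac_a f n)) (- snd y)),
     periodic_solution_L2 (complex_of_real (dirac_a f n)) (mult_L2 (dirac_delta f n) (fst y))) :: circle_L2 \<times> circle_L2)"
    by (intro compact_linear_Pair compact_linear_compose_left[OF _ M] compact_linear_compose_right[OF S(2)]
        compact_linear_compose_right[OF S(1)] bounded_linear_minus bounded_linear_snd
        bounded_linear_compose[OF M] bounded_linear_fst)
  then show ?thesis by (simp add: compact_operator_iff component_inverse_def[abs_def])
qed

text \<open>The kernel is trivial, so the orthogonality conditions hold for all vectors and
  \<open>k = 0\<close>.\<close>

lemma reduced_inverse_dirac_component: "reduced_inverse (dirac_component f n) = component_inverse f n"
proof
  fix w
  interpret T: bounded_linear "component_inverse f n"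
    using component_inverse_compact by (simp add: compact_operator_def)
  have mem: "(x, y) \<in> dirac_component f n \<longleftrightarrow> x = component_inverse f n y" for x y
    unfolding dirac_component_eq by blast
  have ker: "op_kernel (dirac_component f n) = {0}"
    unfolding op_kernel_def mem T.zero by (rule singleton_conv)
  have "x \<in> orthogonal_comp {0}" for x :: "circle_L2 \<times> circle_L2"
    by (simp only: orthogonal_comp_def orthogonal_def mem_Collect_eq ball_simps inner_zero_left simp_thms)
  then show "reduced_inverse (dirac_component f n) w = component_inverse f n w"
    unfolding reduced_inverse_def mem ker by (intro the_equality) (simp_all del: split_paired_Ex)
qed

text \<open>In each entry one multiplication by \<open>\<delta>\<close>, of norm at most the growth,
  meets one solution operator of norm at most \<open>1 / \<bar>a\<bar>\<close>. The entries act on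
  different coordinates, so their squares add without a further constant.\<close>

lemma onorm_component_inverse_le: "onorm (component_inverse f n) \<le> growth f (nat \<bar>n\<bar>) / \<bar>dirac_a f n\<bar>"
proof (rule onorm_bound)
  let ?C = "growth f (nat \<bar>n\<bar>)" and ?a = "dirac_a f n"
  have C: "0 \<le> ?C" using growth_pos[OF f, of "nat \<bar>n\<bar>"] by (rule less_imp_le)
  have a: "0 < \<bar>?a\<bar>" using dirac_a_nonzero[OF f n] by simp
  show "0 \<le> ?C / \<bar>?a\<bar>" using C by simp
  note M = norm_mult_L2_le[OF circle_C1_continuous[OF dirac_delta_C1(1)[OF f, of n]] dirac_delta_C1(3)[OF f] C]
  note neq = exp_real_neq_1[OF dirac_a_nonzero[OF f n]]
  have S1: "norm (periodic_solution_L2 (complex_of_real ?a) y) \<le> norm y / \<bar>?a\<bar>" for y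
    using first_order_graph_bound[of _ y ?a] first_order_graph_iff[OF neq(1)] a by (simp add: field_simps)
  have S2: "norm (periodic_solution_L2 (- complex_of_real ?a) y) \<le> norm y / \<bar>?a\<bar>" for y
    using first_order_graph_bound[of _ y "- ?a"] first_order_graph_iff[OF neq(2)] a by (simp add: field_simps)
  fix y :: "circle_L2 \<times> circle_L2"
  obtain y1 y2 where y: "y = (y1, y2)" by fastforce
  let ?k = "?C / \<bar>?a\<bar>"
  have 1: "norm (mult_L2 (dirac_delta f n) (periodic_solution_L2 (- complex_of_real ?a) (- y2))) \<le> ?k * norm y2"
    using order_trans[OF M mult_left_mono[OF S2[of "- y2"] C]] by simp
  have 2: "norm (periodic_solution_L2 (complex_of_real ?a) (mult_L2 (dirac_delta f n) y1)) \<le> ?k * norm y1"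
    using order_trans[OF S1 divide_right_mono[OF M[of y1], of "\<bar>?a\<bar>"]] by simp
  have "norm (component_inverse f n y) \<le> sqrt ((?k * norm y2)\<^sup>2 + (?k * norm y1)\<^sup>2)"
    unfolding y component_inverse_def norm_Pair fst_conv snd_conv
    by (intro real_sqrt_le_mono add_mono power_mono 1 2 norm_ge_zero)
  also have "(?k * norm y2)\<^sup>2 + (?k * norm y1)\<^sup>2 = ?k\<^sup>2 * ((norm y1)\<^sup>2 + (norm y2)\<^sup>2)"
    by (simp only: power_mult_distrib distrib_left add.commute)
  also have "sqrt \<dots> = ?k * norm y"
    using C by (simp add: real_sqrt_mult y norm_Pair)
  finally show "norm (component_inverse f n y) \<le> ?k * norm y" .
qed

end

section \<open>The component with index zero\<close>

lemma scaleC_minus_left: "scaleC (- c) x = - scaleC c x" for x :: "'a::complex_inner_space"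
  using scaleC_scaleC[of "-1" c x] by (simp add: scaleC_minus1)

lemma scaleC_one: "scaleC 1 x = x" for x :: "'a::complex_inner_space"
  using scaleC_of_real[of 1 x] by simp

lemma scaleC_minus_right: "scaleC c (- x) = - scaleC c x" for x :: "'a::complex_inner_space"
  using scaleC_scaleC[of c "-1" x] scaleC_minus_left[of c x] by (simp add: scaleC_minus1)

lemma scaleC_diff_right: "scaleC c (x - y) = scaleC c x - scaleC c y" for x :: "'a::complex_inner_space"
  using scaleC_add_right[of c x "- y"] by (simp add: scaleC_minus_right)

lemmas scaleC_simps = scaleC_add_right scaleC_diff_right scaleC_minus_left scaleC_minus_right scaleC_one scaleC_scaleC

lemma bounded_linear_scaleC: "bounded_linear (scaleC c)"
  for c :: complex
proof (rule bounded_linear_intro)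
  show "scaleC c (r *\<^sub>R x) = r *\<^sub>R scaleC c x" for r and x :: "'a::complex_inner_space"
    by (simp add: scaleC_of_real[symmetric] scaleC_scaleC mult.commute)
  show "norm (scaleC c x) \<le> norm x * cmod c" for x :: 'a by (simp add: norm_scaleC mult.commute)
qed (rule scaleC_add_right)

text \<open>The decoupled problems at \<open>n = 0\<close> have parameters
  \<open>\<i> * \<mu>\<close> and \<open>- \<i> * \<mu>\<close>; they are uniquely solvable because
  no point of \<open>(0, 1)\<close> is an integer.\<close>

lemma exp_imaginary_neq_1:
  assumes "0 < \<mu>" "\<mu> < 1"
  shows "exp (2 * complex_of_real pi * (\<i> * complex_of_real \<mu>)) \<noteq> 1"
    and "exp (2 * complex_of_real pi * - (\<i> * complex_of_real \<mu>)) \<noteq> 1"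
proof -
  have *: "\<not> (\<exists>n::int. s * \<mu> = of_int n)" if "s = 1 \<or> s = -1" for s :: real
  proof
    assume "\<exists>n::int. s * \<mu> = of_int n"
    then obtain n :: int where n: "s * \<mu> = of_int n" by blast
    then have "\<bar>of_int n :: real\<bar> < 1" "(of_int n :: real) \<noteq> 0" using that assms by auto
    then have "real_of_int \<bar>n\<bar> < real_of_int 1" "n \<noteq> 0" by simp_all
    then show False unfolding of_int_less_iff by linarith
  qed
  show "exp (2 * complex_of_real pi * (\<i> * complex_of_real \<mu>)) \<noteq> 1"
    using *[of 1] by (auto simp: exp_eq_1)
  show "exp (2 * complex_of_real pi * - (\<i> * complex_of_real \<mu>)) \<noteq> 1"
  proof
    assume "exp (2 * complex_of_real pi * - (\<i> * complex_of_real \<mu>)) = 1"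
    then obtain n :: int where "- (pi * \<mu>) = pi * real_of_int n" by (auto simp: exp_eq_1)
    then have "pi * (-1 * \<mu>) = pi * real_of_int n" by simp
    then have "-1 * \<mu> = real_of_int n" unfolding mult_cancel_left by simp
    then show False using *[of "-1"] by blast
  qed
qed

text \<open>The combinations \<open>x\<^sub>1 \<plusminus> \<i> x\<^sub>2\<close> decouple the system.\<close>

lemma dirac_component_0_resolvent:
  assumes f: "circle_diffeo f" and \<mu>: "0 < \<mu>" "\<mu> < 1"
  shows "\<exists>R. compact_operator R \<and> is_resolvent (dirac_component f 0) (complex_of_real \<mu>) R"
proof -
  let ?m = "complex_of_real \<mu>" and ?G = "first_order_graph 0"
  let ?P = "periodic_solution_L2 (\<i> * ?m)" and ?M = "periodic_solution_L2 (- (\<i> * ?m))"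
  note neq = exp_imaginary_neq_1[OF \<mu>]
  have one: "dirac_delta f 0 z = 1" if "z \<in> circle" for z
  proof -
    have "circle_iter f 0 = (\<lambda>z. z)" by (simp add: circle_iter_def id_def)
    then show ?thesis using that by (auto simp: dirac_delta_def circle_deriv_ident)
  qed
  have id: "mult_L2 \<phi> x = x" if \<phi>: "\<And>z. z \<in> circle \<Longrightarrow> \<phi> z = 1" for \<phi> x
  proof -
    have c: "continuous_on circle \<phi>" by (rule continuous_on_eq[OF continuous_on_const[of _ 1]]) (simp add: \<phi>)
    have "mult_L2 \<phi> x = class_L2 (rep_L2 x)"
      unfolding mult_L2_def
    proof (subst class_L2_eq_iff)
      show "AE z in circle_measure. \<phi> z * rep_L2 x z = rep_L2 x z"
        using AE_circle_space by eventually_elim (simp add: \<phi>)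
    qed (intro square_integrable_continuous_mult[OF c] square_integrable_rep)+
    then show ?thesis by simp
  qed
  have D0: "((x1, x2), (y1, y2)) \<in> dirac_component f 0 \<longleftrightarrow> (x2, y1) \<in> ?G \<and> (x1, - y2) \<in> ?G" for x1 x2 y1 y2
  proof -
    have "mult_L2 (dirac_delta f 0) y1 = y1" "mult_L2 (\<lambda>z. inverse (dirac_delta f 0 z)) x1 = x1"
      by (rule id, simp add: one)+
    then show ?thesis using dirac_component_iff[OF f, of x1 x2 y1 y2 0] by (simp add: dirac_a_def)
  qed
  have shift: "(x, y + scaleC d x) \<in> ?G \<longleftrightarrow> (x, y) \<in> first_order_graph d" for x y d
    using first_order_graph_shift[of x y 0 d] by simp
  \<comment> \<open>Both decoupled equations are solved for \<open>x1 + \<i> x2\<close> and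
    \<open>x1 - \<i> x2\<close>; half the sum is \<open>x1\<close> and \<open>- \<i> / 2\<close>
    times the difference is \<open>x2\<close>.\<close>
  define R :: "circle_L2 \<times> circle_L2 \<Rightarrow> circle_L2 \<times> circle_L2" where
    "R w = (scaleC (1 / 2) (?P (scaleC \<i> (fst w) - snd w) + ?M (- scaleC \<i> (fst w) - snd w)),
            scaleC (- \<i> / 2) (?P (scaleC \<i> (fst w) - snd w) + - ?M (- scaleC \<i> (fst w) - snd w)))" for w
  note S = periodic_solution_compact[OF neq(1), unfolded compact_operator_iff]
    periodic_solution_compact[OF neq(2), unfolded compact_operator_iff]
  have "compact_linear R"
    unfolding R_def[abs_def]
    by (intro compact_linear_Pair compact_linear_compose_left[OF _ bounded_linear_scaleC] compact_linear_add
        compact_linear_compose_left[OF _ bounded_linear_minus[OF bounded_linear_ident]]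
        compact_linear_compose_right[OF S(1)] compact_linear_compose_right[OF S(2)]
        bounded_linear_sub bounded_linear_minus bounded_linear_compose[OF bounded_linear_scaleC]
        bounded_linear_fst bounded_linear_snd)
  then have R: "compact_operator R" by (simp add: compact_operator_iff)
  have iff: "((x1, x2), (y1, y2)) \<in> dirac_component f 0 \<longleftrightarrow> (x1, x2) = R ((y1, y2) - scaleC ?m (x1, x2))"
    for x1 x2 y1 y2
  proof -
    define g where "g = y1 - scaleC ?m x1"
    define h where "h = y2 - scaleC ?m x2"
    have y: "y1 = g + scaleC ?m x1" "y2 = h + scaleC ?m x2" by (simp_all add: g_def h_def)
    have arg: "(y1, y2) - scaleC ?m (x1, x2) = (g, h)"
      by (simp add: scaleC_prod_def g_def h_def)
    \<comment> \<open>With \<open>y = w + \<mu> x\<close>, where \<open>w = (g, h)\<close>, the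
      right-hand side for \<open>x1 + \<i> x2\<close> contains the same combination of the unknowns
      with factor \<open>\<i> * \<mu>\<close>, which \<open>shift\<close> absorbs into the
      operator.\<close>
    have plus: "- y2 + scaleC \<i> y1 = (scaleC \<i> g - h) + scaleC (\<i> * ?m) (x1 + scaleC \<i> x2)"
      unfolding y by (simp add: scaleC_simps algebra_simps)
    have minus: "- y2 - scaleC \<i> y1 = (- scaleC \<i> g - h) + scaleC (- (\<i> * ?m)) (x1 - scaleC \<i> x2)"
      unfolding y by (simp add: scaleC_simps algebra_simps)
    have P: "(x1 + scaleC \<i> x2, - y2 + scaleC \<i> y1) \<in> ?G \<longleftrightarrow> x1 + scaleC \<i> x2 = ?P (scaleC \<i> g - h)"
      unfolding plus shift by (rule first_order_graph_iff[OF neq(1)])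
    have M: "(x1 - scaleC \<i> x2, - y2 - scaleC \<i> y1) \<in> ?G \<longleftrightarrow> x1 - scaleC \<i> x2 = ?M (- scaleC \<i> g - h)"
      unfolding minus shift by (rule first_order_graph_iff[OF neq(2)])
    have half: "scaleC (1 / 2) (p + m) = x1 \<and> scaleC (- \<i> / 2) (p - m) = x2 \<longleftrightarrow>
        x1 + scaleC \<i> x2 = p \<and> x1 - scaleC \<i> x2 = m" for p m x1 x2 :: circle_L2
    proof -
      have h2: "scaleC (1 / 2) x + scaleC (1 / 2) x = x" for x :: circle_L2
        using scaleC_add_left[of "1 / 2" "1 / 2" x] by (simp add: scaleC_one)
      have a: "scaleC (1 / 2) ((x1 + scaleC \<i> x2) + (x1 - scaleC \<i> x2)) = x1"
        by (simp add: scaleC_simps h2)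
      have k: "- \<i> / 2 * \<i> = 1 / 2" by simp
      have "(x1 + scaleC \<i> x2) - (x1 - scaleC \<i> x2) = scaleC \<i> x2 + scaleC \<i> x2" by simp
      then have b: "scaleC (- \<i> / 2) ((x1 + scaleC \<i> x2) - (x1 - scaleC \<i> x2)) = x2"
        by (simp only: scaleC_add_right scaleC_scaleC k h2)
      have i: "scaleC \<i> (scaleC (- \<i> / 2) x) = scaleC (1 / 2) x" for x :: circle_L2
        by (simp add: scaleC_scaleC)
      have c: "scaleC (1 / 2) (p + m) + scaleC \<i> (scaleC (- \<i> / 2) (p - m)) = p"
        unfolding i by (simp add: scaleC_simps h2)
      have "scaleC (1 / 2) (p + m) - scaleC \<i> (scaleC (- \<i> / 2) (p - m)) = scaleC (1 / 2) m + scaleC (1 / 2) m"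
        unfolding i by (simp add: scaleC_simps)
      then have d: "scaleC (1 / 2) (p + m) - scaleC \<i> (scaleC (- \<i> / 2) (p - m)) = m" by (simp only: h2)
      show ?thesis using a b c d by metis
    qed
    \<comment> \<open>The graph is a complex subspace, so the original pair of memberships and the
      pair for the combinations are obtained from each other by linear combination.\<close>
    have "((x1, x2), (y1, y2)) \<in> dirac_component f 0 \<longleftrightarrow>
        (x1 + scaleC \<i> x2, - y2 + scaleC \<i> y1) \<in> ?G \<and> (x1 - scaleC \<i> x2, - y2 - scaleC \<i> y1) \<in> ?G"
    proof
      assume "((x1, x2), (y1, y2)) \<in> dirac_component f 0"
      then have 1: "(x1, - y2) \<in> ?G" "(x2, y1) \<in> ?G" using D0 by auto
      from first_order_graph_add[OF 1(1) first_order_graph_scaleC[OF 1(2), of \<i>]]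
        first_order_graph_add[OF 1(1) first_order_graph_scaleC[OF 1(2), of "- \<i>"]]
      show "(x1 + scaleC \<i> x2, - y2 + scaleC \<i> y1) \<in> ?G \<and> (x1 - scaleC \<i> x2, - y2 - scaleC \<i> y1) \<in> ?G"
        by (simp add: scaleC_minus_left)
    next
      assume 2: "(x1 + scaleC \<i> x2, - y2 + scaleC \<i> y1) \<in> ?G \<and> (x1 - scaleC \<i> x2, - y2 - scaleC \<i> y1) \<in> ?G"
      have e: "scaleC (1 / 2) (a + scaleC \<i> b) + scaleC (1 / 2) (a - scaleC \<i> b) = a"
        "scaleC (- \<i> / 2) (a + scaleC \<i> b) + scaleC (\<i> / 2) (a - scaleC \<i> b) = b" for a b :: circle_L2
      proof -
        from half[of "a + scaleC \<i> b" "a - scaleC \<i> b" a b]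
        have "scaleC (1 / 2) ((a + scaleC \<i> b) + (a - scaleC \<i> b)) = a"
          "scaleC (- \<i> / 2) ((a + scaleC \<i> b) - (a - scaleC \<i> b)) = b" by blast+
        moreover have "scaleC (1 / 2) X + scaleC (1 / 2) Y = scaleC (1 / 2) (X + Y)"
          "scaleC (- \<i> / 2) X + scaleC (\<i> / 2) Y = scaleC (- \<i> / 2) (X - Y)" for X Y :: circle_L2
          using scaleC_minus_left[of "\<i> / 2" Y]
          by (simp_all only: scaleC_add_right scaleC_diff_right minus_divide_left diff_minus_eq_add)
        ultimately show "scaleC (1 / 2) (a + scaleC \<i> b) + scaleC (1 / 2) (a - scaleC \<i> b) = a"
          "scaleC (- \<i> / 2) (a + scaleC \<i> b) + scaleC (\<i> / 2) (a - scaleC \<i> b) = b" by (simp_all only:)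
      qed
      from 2 have "(scaleC (1 / 2) (x1 + scaleC \<i> x2) + scaleC (1 / 2) (x1 - scaleC \<i> x2),
          scaleC (1 / 2) (- y2 + scaleC \<i> y1) + scaleC (1 / 2) (- y2 - scaleC \<i> y1)) \<in> ?G"
        by (intro first_order_graph_add[OF first_order_graph_scaleC first_order_graph_scaleC]) blast+
      then have "(x1, - y2) \<in> ?G" unfolding e(1) .
      moreover from 2 have "(scaleC (- \<i> / 2) (x1 + scaleC \<i> x2) + scaleC (\<i> / 2) (x1 - scaleC \<i> x2),
          scaleC (- \<i> / 2) (- y2 + scaleC \<i> y1) + scaleC (\<i> / 2) (- y2 - scaleC \<i> y1)) \<in> ?G"
        by (intro first_order_graph_add[OF first_order_graph_scaleC first_order_graph_scaleC]) blast+
      then have "(x2, y1) \<in> ?G" unfolding e(2) .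
      ultimately show "((x1, x2), (y1, y2)) \<in> dirac_component f 0" using D0 by blast
    qed
    also have "\<dots> \<longleftrightarrow> x1 + scaleC \<i> x2 = ?P (scaleC \<i> g - h) \<and> x1 - scaleC \<i> x2 = ?M (- scaleC \<i> g - h)"
      unfolding P M ..
    also have "\<dots> \<longleftrightarrow> scaleC (1 / 2) (?P (scaleC \<i> g - h) + ?M (- scaleC \<i> g - h)) = x1 \<and>
        scaleC (- \<i> / 2) (?P (scaleC \<i> g - h) - ?M (- scaleC \<i> g - h)) = x2"
      by (rule half[symmetric])
    also have "\<dots> \<longleftrightarrow> (x1, x2) = R (g, h)"
      unfolding R_def fst_conv snd_conv prod.inject by (auto simp only: diff_conv_add_uminus)
    finally show ?thesis unfolding arg .
  qed
  have "is_resolvent (dirac_component f 0) ?m R"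
  proof (rule is_resolventI)
    show "bounded_linear R" using R by (simp add: compact_operator_def)
    show "(x, y) \<in> dirac_component f 0 \<longleftrightarrow> x = R (y - scaleC ?m x)" for x y
      by (cases x; cases y) (simp only: iff)
  qed
  then show ?thesis using R by blast
qed

section \<open>The full operator and the effect of slow growth\<close>

lemma dirac_eq_direct_sum: "dirac f = direct_sum_op (dirac_component f)"
  by (simp add: dirac_def direct_sum_op_def)

text \<open>For \<open>n \<noteq> 0\<close> the reduced inverse is the full compact inverse; at
  \<open>n = 0\<close> the resolvent on \<open>(0, 1)\<close> takes its place.\<close>

theorem dirac_compact_resolvent_iff:
  assumes f: "circle_diffeo f"
  shows "compact_resolvent (dirac f) \<longleftrightarrow>
    ((\<lambda>n::int. onorm (reduced_inverse (dirac_component f n))) \<longlongrightarrow> 0) (filtercomap abs at_top)"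
  unfolding dirac_eq_direct_sum
proof (rule compact_resolvent_direct_sum_iff)
  show "dirac_component f n = {(reduced_inverse (dirac_component f n) y, y) | y. True}" if "n \<noteq> 0" for n
    unfolding reduced_inverse_dirac_component[OF f that] by (rule dirac_component_eq[OF f that])
  show "compact_operator (reduced_inverse (dirac_component f n))" if "n \<noteq> 0" for n
    unfolding reduced_inverse_dirac_component[OF f that] by (rule component_inverse_compact[OF f that])
  show "\<exists>R. compact_operator R \<and> is_resolvent (dirac_component f 0) (complex_of_real \<mu>) R" if "0 < \<mu>" "\<mu> < 1" for \<mu>
    by (rule dirac_component_0_resolvent[OF f that])
qed

text \<open>With \<open>m = \<bar>n\<bar>\<close>, at least \<open>m - N - 1\<close> terms of the
  sum are bounded below by \<open>1 / ln m\<close>, since growth at an index \<open>k\<close>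
  between \<open>N\<close> and \<open>m\<close> is at most \<open>ln k\<close> and \<open>ln\<close>
  increases.\<close>

lemma dirac_a_lower_bound:
  assumes f: "circle_diffeo f" and N: "N \<ge> 2" "\<And>k. k \<ge> N \<Longrightarrow> growth f k \<le> ln (real k)" and n: "nat \<bar>n\<bar> > N + 1"
  shows "(real (nat \<bar>n\<bar>) - real N - 1) / ln (real (nat \<bar>n\<bar>)) \<le> \<bar>dirac_a f n\<bar>"
proof -
  define m where "m = nat \<bar>n\<bar>"
  have m: "m > N + 1" using n by (simp add: m_def)
  have ln: "ln (real m) > 0" using m N(1) by simp
  have le: "1 / ln (real m) \<le> 1 / growth f k" if "N \<le> k" "k \<le> m" for k
  proof -
    have "growth f k \<le> ln (real k)" by (rule N(2)[OF that(1)])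
    also have "\<dots> \<le> ln (real m)" using that N(1) by simp
    finally show ?thesis using growth_pos[OF f, of k] by (intro divide_left_mono) (auto intro: mult_pos_pos ln)
  qed
  have nonneg: "0 \<le> 1 / growth f k" for k using growth_pos[OF f, of k] by simp
  \<comment> \<open>The window starts at \<open>N + 2\<close>, so both \<open>l\<close> and
    \<open>l - 1\<close> are at least \<open>N\<close>; one count serves the sums for positive and
    for negative \<open>n\<close>, whose indices differ by one.\<close>
  have card: "(real m - real N - 1) / ln (real m) \<le> (\<Sum>l\<in>{N + 2..m}. 1 / ln (real m)) + 0"
  proof -
    have "real (card {N + 2..m}) = real m - real N - 1" using m by simp
    then show ?thesis by simp
  qed
  have 1: "(\<Sum>l\<in>{N + 2..m}. 1 / ln (real m)) \<le> (\<Sum>l=1..m. 1 / growth f l)"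
  proof (rule order_trans[OF sum_mono])
    show "1 / ln (real m) \<le> 1 / growth f l" if "l \<in> {N + 2..m}" for l using that by (intro le) auto
    show "(\<Sum>l\<in>{N + 2..m}. 1 / growth f l) \<le> (\<Sum>l=1..m. 1 / growth f l)"
      by (rule sum_mono2) (use nonneg in auto)
  qed
  have 2: "(\<Sum>l\<in>{N + 2..m}. 1 / ln (real m)) \<le> (\<Sum>l=1..m. 1 / growth f (l - 1))"
  proof (rule order_trans[OF sum_mono])
    show "1 / ln (real m) \<le> 1 / growth f (l - 1)" if "l \<in> {N + 2..m}" for l using that by (intro le) auto
    show "(\<Sum>l\<in>{N + 2..m}. 1 / growth f (l - 1)) \<le> (\<Sum>l=1..m. 1 / growth f (l - 1))"
      by (rule sum_mono2) (use nonneg in auto)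
  qed
  have s: "0 \<le> (\<Sum>l=1..m. 1 / growth f l)" "0 \<le> (\<Sum>l=1..m. 1 / growth f (l - 1))"
    by (rule sum_nonneg, rule nonneg)+
  show ?thesis
  proof (cases "n > 0")
    case True
    then have "dirac_a f n = (\<Sum>l=1..m. 1 / growth f l)" by (simp add: dirac_a_def m_def)
    then show ?thesis unfolding m_def[symmetric] using card 1 s(1) by linarith
  next
    case False
    then have "dirac_a f n = - (\<Sum>l=1..m. 1 / growth f (l - 1))"
      using m by (auto simp: dirac_a_def m_def)
    then show ?thesis unfolding m_def[symmetric] using card 2 s(2) by linarith
  qed
qed

lemma growth_imp_tendsto:
  assumes f: "circle_diffeo f" and o: "growth f \<in> o(\<lambda>n. ln (real n))"
  shows "((\<lambda>n::int. onorm (reduced_inverse (dirac_component f n))) \<longlongrightarrow> 0) (filtercomap abs at_top)"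
proof (rule tendstoI)
  fix e :: real assume e: "e > 0"
  have "eventually (\<lambda>n. norm (growth f n) \<le> 1 * norm (ln (real n))) sequentially"
    using landau_o.smallD[OF o, of 1] by simp
  then obtain N0 where N0: "\<And>k. k \<ge> N0 \<Longrightarrow> norm (growth f k) \<le> norm (ln (real k))"
    unfolding eventually_sequentially by auto
  define N where "N = max 2 N0"
  have N: "growth f k \<le> ln (real k)" if "k \<ge> N" for k
  proof -
    have "\<bar>ln (real k)\<bar> = ln (real k)" using that by (simp add: N_def)
    then show ?thesis using N0[of k] that by (simp add: N_def)
  qed
  \<comment> \<open>One logarithm comes from the growth in the numerator, the other from the lower
    bound for \<open>\<bar>a\<bar>\<close>.\<close>
  have "(\<lambda>m. ln (real m) * ln (real m) / (real m - real N - 1)) \<longlonglongrightarrow> 0" by real_asymp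
  from tendstoD[OF this e] obtain M where M: "\<And>m. m \<ge> M \<Longrightarrow> \<bar>ln (real m) * ln (real m) / (real m - real N - 1)\<bar> < e"
    unfolding eventually_sequentially by auto
  have "dist (onorm (reduced_inverse (dirac_component f n))) 0 < e" if n: "\<bar>n\<bar> \<ge> int (max M (N + 2))" for n
  proof -
    define m where "m = nat \<bar>n\<bar>"
    have m: "m \<ge> M" "m > N + 1" "n \<noteq> 0" using n by (auto simp: m_def)
    note red = reduced_inverse_dirac_component[OF f m(3)]
    have ln: "ln (real m) > 0" using m(2) by (simp add: N_def)
    have q: "0 < (real m - real N - 1) / ln (real m)" using m(2) ln by simp
    have a: "(real m - real N - 1) / ln (real m) \<le> \<bar>dirac_a f n\<bar>"
      unfolding m_def by (rule dirac_a_lower_bound[OF f _ N]) (use m(2) in \<open>auto simp: N_def m_def\<close>)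
    have "onorm (component_inverse f n) \<le> growth f m / \<bar>dirac_a f n\<bar>"
      unfolding m_def by (rule onorm_component_inverse_le[OF f m(3)])
    also have "\<dots> \<le> ln (real m) / ((real m - real N - 1) / ln (real m))"
      using N[of m] m(2) ln q a by (intro frac_le) auto
    also have "\<dots> = ln (real m) * ln (real m) / (real m - real N - 1)" by simp
    also have "\<dots> < e" using M[OF m(1)] by linarith
    finally have "onorm (component_inverse f n) < e" .
    moreover have "0 \<le> onorm (component_inverse f n)"
      by (rule onorm_pos_le) (use component_inverse_compact[OF f m(3)] in \<open>simp add: compact_operator_def\<close>)
    ultimately show ?thesis by (simp add: red)
  qed
  then show "\<forall>\<^sub>F n in filtercomap abs at_top. dist (onorm (reduced_inverse (dirac_component f n))) 0 < e"
    unfolding eventually_filtercomap_at_top_linorder by blast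
qed

theorem theorem9p1:
  fixes \<alpha> :: real and f :: "complex \<Rightarrow> complex"
  assumes "0 < \<alpha>" and "\<alpha> < 1 / 2" and "\<alpha> \<notin> \<rat>"
    and "circle_diffeo f"
    and "orientation_preserving f"
    and "has_rotation_number f (2 * \<alpha>)"
  shows "(compact_resolvent (dirac f) \<longleftrightarrow>
            ((\<lambda>n::int. onorm (reduced_inverse (dirac_component f n))) \<longlongrightarrow> 0)
              (filtercomap abs at_top)) \<and>
         (growth f \<in> o(\<lambda>n. ln (real n)) \<longrightarrow> compact_resolvent (dirac f))"
  using dirac_compact_resolvent_iff[OF assms(4)] growth_imp_tendsto[OF assms(4)] by blast

end
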